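(* Let $k,d\geq2$ and let $f\in U_{d,k}(\mathbb{C})$. Then an irreducible hypersurface $X\subset\mathbb{P}^k$ is $f$-special if and only if it is $f$-preperiodic.
   Context: Work over $\mathbb{C}$. $\mathrm{End}_d^k$ is the space of endomorphisms $\mathbb{P}^k\to\mathbb{P}^k$ of algebraic degree $d$ (a Zariski open subset of the projective space of $(k+1)$-tuples of degree-$d$ forms). $U_{d,k}\subset\mathrm{End}_d^k$ is a fixed dense Zariski open subset, defined over $\mathbb{Q}$, such that for every $f\in U_{d,k}(\mathbb{C})$ every dominant rational map $h:\mathbb{P}^k\dashrightarrow\mathbb{P}^k$ with $h\circ f^m=f^m\circ h$ for some $m\geq1$ is an iterate $f^s$, $s\geq0$ (such a subset exists by the paper's main theorem). An irreducible subvariety $X\subset\mathbb{P}^k$ is $f$-preperiodic if $f^a(X)=f^b(X)$ for some integers $a>b\geq0$; likewise for another self-map $\psi$. $X$ is $f$-special if there exist an irreducible subvariety $Z\subset\mathbb{P}^k$ containing $X$, an integer $n\geq1$, and a polarizable endomorphism $\psi:Z\to Z$ such that $f^n(Z)=Z$, $f^n|_Z\circ\psi=\psi\circ f^n|_Z$, and $X$ is $\psi$-preperiodic. Polarizable means that there exist an ample line bundle $L$ on $Z$ and an integer $q>1$ with $\psi^*L\simeq L^{\otimes q}$. *)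

theory Defs
  imports "HOL-Analysis.Analysis" "HOL-Library.Poly_Mapping"
begin

section \<open>Forms\<close>

text \<open>Complex polynomials in variables of type \<open>'i\<close>; the keys of a polynomial are its monomials,
  themselves finitely supported exponent vectors.\<close>

type_synonym 'i mpoly = "('i \<Rightarrow>\<^sub>0 nat) \<Rightarrow>\<^sub>0 complex"

definition monom_eval :: "('i \<Rightarrow>\<^sub>0 nat) \<Rightarrow> ('i \<Rightarrow> complex) \<Rightarrow> complex" where
  "monom_eval m v = (\<Prod>i\<in>Poly_Mapping.keys m. v i ^ Poly_Mapping.lookup m i)"

definition eval :: "'i mpoly \<Rightarrow> ('i \<Rightarrow> complex) \<Rightarrow> complex" where
  "eval p v = (\<Sum>m\<in>Poly_Mapping.keys p. Poly_Mapping.lookup p m * monom_eval m v)"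

definition monoms :: "'i set \<Rightarrow> nat \<Rightarrow> ('i \<Rightarrow>\<^sub>0 nat) set" where
  "monoms I e =
     {m. Poly_Mapping.keys m \<subseteq> I \<and> (\<Sum>i\<in>Poly_Mapping.keys m. Poly_Mapping.lookup m i) = e}"

definition forms :: "'i set \<Rightarrow> nat \<Rightarrow> 'i mpoly set" where
  "forms I e = {p. Poly_Mapping.keys p \<subseteq> monoms I e}"


section \<open>Projective space and its Zariski topology\<close>

text \<open>A point is the set of all nonzero multiples of a nonzero vector supported in the (finite) index
  set \<open>I\<close>. Thus \<open>Proj {..k}\<close> is projective \<open>k\<close>-space; other index sets are needed for the
  projective space of tuples of forms.\<close>

type_synonym 'i point = "('i \<Rightarrow> complex) set"

definition pt :: "('i \<Rightarrow> complex) \<Rightarrow> 'i point" where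
  "pt v = {(\<lambda>i. c * v i) |c. c \<noteq> 0}"

definition Proj :: "'i set \<Rightarrow> 'i point set" where
  "Proj I = {pt v |v. (\<forall>i. i \<notin> I \<longrightarrow> v i = 0) \<and> (\<exists>i\<in>I. v i \<noteq> 0)}"

text \<open>Some choice of homogeneous coordinates. It is only used in expressions that do not depend on
  this choice.\<close>

definition rep :: "'i point \<Rightarrow> 'i \<Rightarrow> complex" where
  "rep x = (SOME v. v \<in> x)"

definition zariski :: "'i set \<Rightarrow> 'i point topology" where
  "zariski I = topology (\<lambda>W. \<exists>S. S \<subseteq> (\<Union>e. forms I e) \<and>
     W = {x \<in> Proj I. \<exists>p\<in>S. eval p (rep x) \<noteq> 0})"

definition irreducible_variety :: "'i set \<Rightarrow> 'i point set \<Rightarrow> bool" where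
  "irreducible_variety I X \<longleftrightarrow> closedin (zariski I) X \<and> X \<noteq> {} \<and>
     (\<forall>A B. closedin (zariski I) A \<and> closedin (zariski I) B \<and> X = A \<union> B \<longrightarrow> X = A \<or> X = B)"

definition irreducible_hypersurface :: "nat \<Rightarrow> nat point set \<Rightarrow> bool" where
  "irreducible_hypersurface k X \<longleftrightarrow> irreducible_variety {..k} X \<and>
     (\<exists>e p. e \<ge> 1 \<and> p \<in> forms {..k} e \<and> p \<noteq> 0 \<and> X = {x \<in> Proj {..k}. eval p (rep x) = 0})"


section \<open>Morphisms and rational maps\<close>

definition form_map :: "'j set \<Rightarrow> ('j \<Rightarrow> 'i mpoly) \<Rightarrow> 'i point \<Rightarrow> 'j point" where
  "form_map J G x = pt (\<lambda>j. if j \<in> J then eval (G j) (rep x) else 0)"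

text \<open>Morphisms from a locally closed subset \<open>A\<close> of \<open>Proj I\<close> (with its reduced structure) to
  \<open>Proj J\<close>, and regular functions on such an \<open>A\<close>.\<close>

definition morphism :: "'i set \<Rightarrow> 'j set \<Rightarrow> 'i point set \<Rightarrow> ('i point \<Rightarrow> 'j point) \<Rightarrow> bool" where
  "morphism I J A g \<longleftrightarrow>
     (\<forall>x\<in>A. \<exists>W e G. openin (zariski I) W \<and> x \<in> W \<and> (\<forall>j\<in>J. G j \<in> forms I e) \<and>
        (\<forall>y\<in>A \<inter> W. (\<exists>j\<in>J. eval (G j) (rep y) \<noteq> 0) \<and> g y = form_map J G y))"

definition regular_fun :: "'i set \<Rightarrow> 'i point set \<Rightarrow> ('i point \<Rightarrow> complex) \<Rightarrow> bool" where
  "regular_fun I A \<phi> \<longleftrightarrow>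
     (\<forall>x\<in>A. \<exists>W e p q. openin (zariski I) W \<and> x \<in> W \<and> p \<in> forms I e \<and> q \<in> forms I e \<and>
        (\<forall>y\<in>A \<inter> W. eval q (rep y) \<noteq> 0 \<and> \<phi> y = eval p (rep y) / eval q (rep y)))"

definition regular_unit :: "'i set \<Rightarrow> 'i point set \<Rightarrow> ('i point \<Rightarrow> complex) \<Rightarrow> bool" where
  "regular_unit I A \<phi> \<longleftrightarrow> regular_fun I A \<phi> \<and> (\<forall>x\<in>A. \<phi> x \<noteq> 0)"

text \<open>A closed immersion of a closed subset \<open>Z\<close>: an isomorphism onto a closed subvariety.\<close>

definition closed_immersion ::
    "'i set \<Rightarrow> 'j set \<Rightarrow> 'i point set \<Rightarrow> ('i point \<Rightarrow> 'j point) \<Rightarrow> bool" where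
  "closed_immersion I J Z \<iota> \<longleftrightarrow> morphism I J Z \<iota> \<and> inj_on \<iota> Z \<and>
     closedin (zariski J) (\<iota> ` Z) \<and> morphism J I (\<iota> ` Z) (inv_into Z \<iota>)"

text \<open>A rational self-map of projective \<open>k\<close>-space is represented by a pair of a nonempty open set
  and a morphism on it; two representatives are identified if they agree on a nonempty open set.\<close>

type_synonym rat_map = "nat point set \<times> (nat point \<Rightarrow> nat point)"

definition rational_map :: "nat \<Rightarrow> rat_map \<Rightarrow> bool" where
  "rational_map k h \<longleftrightarrow>
     openin (zariski {..k}) (fst h) \<and> fst h \<noteq> {} \<and> morphism {..k} {..k} (fst h) (snd h)"

definition rat_eq :: "nat \<Rightarrow> rat_map \<Rightarrow> rat_map \<Rightarrow> bool" where
  "rat_eq k g h \<longleftrightarrow> (\<exists>W. openin (zariski {..k}) W \<and> W \<noteq> {} \<and> W \<subseteq> fst g \<inter> fst h \<and>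
     (\<forall>x\<in>W. snd g x = snd h x))"

definition dominant :: "nat \<Rightarrow> rat_map \<Rightarrow> bool" where
  "dominant k h \<longleftrightarrow> zariski {..k} closure_of (snd h ` fst h) = Proj {..k}"

definition rat_comp :: "rat_map \<Rightarrow> rat_map \<Rightarrow> rat_map" where
  "rat_comp g h = ({x \<in> fst h. snd h x \<in> fst g}, snd g \<circ> snd h)"

definition total_map :: "nat \<Rightarrow> (nat point \<Rightarrow> nat point) \<Rightarrow> rat_map" where
  "total_map k g = (Proj {..k}, g)"


section \<open>Line bundles\<close>

text \<open>A line bundle is given by an open cover by trivializing patches and a cocycle of transition
  functions; a section corresponds to functions \<open>s\<^sub>a\<close> on the patches with
  \<open>s\<^sub>a = transition a b * s\<^sub>b\<close>. Since varieties are quasi-compact, patches indexed by natural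
  numbers suffice.\<close>

record 'i line_bundle =
  idx :: "nat set"
  patch :: "nat \<Rightarrow> 'i point set"
  transition :: "nat \<Rightarrow> nat \<Rightarrow> 'i point \<Rightarrow> complex"

definition is_line_bundle :: "'i set \<Rightarrow> 'i point set \<Rightarrow> 'i line_bundle \<Rightarrow> bool" where
  "is_line_bundle I Z L \<longleftrightarrow>
     (\<forall>a\<in>idx L. openin (subtopology (zariski I) Z) (patch L a)) \<and>
     (\<Union>a\<in>idx L. patch L a) = Z \<and>
     (\<forall>a\<in>idx L. \<forall>b\<in>idx L. regular_unit I (patch L a \<inter> patch L b) (transition L a b)) \<and>
     (\<forall>a\<in>idx L. \<forall>b\<in>idx L. \<forall>c\<in>idx L. \<forall>x\<in>patch L a \<inter> patch L b \<inter> patch L c.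
        transition L a b x * transition L b c x = transition L a c x)"

text \<open>An isomorphism is given, in the trivializations \<open>a\<close> of \<open>L\<close> and \<open>c\<close> of \<open>M\<close>, by
  multiplication with a nowhere vanishing regular function \<open>u c a\<close>.\<close>

definition line_bundle_iso :: "'i set \<Rightarrow> 'i line_bundle \<Rightarrow> 'i line_bundle \<Rightarrow> bool" where
  "line_bundle_iso I L M \<longleftrightarrow> (\<exists>u.
     (\<forall>a\<in>idx L. \<forall>c\<in>idx M. regular_unit I (patch L a \<inter> patch M c) (u c a)) \<and>
     (\<forall>a\<in>idx L. \<forall>b\<in>idx L. \<forall>c\<in>idx M. \<forall>d\<in>idx M.
        \<forall>x\<in>patch L a \<inter> patch L b \<inter> patch M c \<inter> patch M d.
          u c a x * transition L a b x = transition M c d x * u d b x))"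

definition tensor_power :: "'i line_bundle \<Rightarrow> nat \<Rightarrow> 'i line_bundle" where
  "tensor_power L q = L\<lparr>transition := (\<lambda>a b x. transition L a b x ^ q)\<rparr>"

definition pullback ::
    "'i point set \<Rightarrow> ('i point \<Rightarrow> 'j point) \<Rightarrow> 'j line_bundle \<Rightarrow> 'i line_bundle" where
  "pullback Z g L = \<lparr>idx = idx L, patch = (\<lambda>a. {x \<in> Z. g x \<in> patch L a}),
     transition = (\<lambda>a b x. transition L a b (g x))\<rparr>"

text \<open>The line bundle \<open>O(1)\<close>: on the patch \<open>x\<^sub>a \<noteq> 0\<close> a linear form \<open>l\<close> is the section
  \<open>l / x\<^sub>a\<close>.\<close>

definition twisting :: "nat \<Rightarrow> nat line_bundle" where
  "twisting N = \<lparr>idx = {..N}, patch = (\<lambda>a. {x \<in> Proj {..N}. rep x a \<noteq> 0}),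
     transition = (\<lambda>a b x. rep x b / rep x a)\<rparr>"

definition very_ample :: "'i set \<Rightarrow> 'i point set \<Rightarrow> 'i line_bundle \<Rightarrow> bool" where
  "very_ample I Z L \<longleftrightarrow>
     (\<exists>N \<iota>. closed_immersion I {..N} Z \<iota> \<and> line_bundle_iso I L (pullback Z \<iota> (twisting N)))"

definition ample :: "'i set \<Rightarrow> 'i point set \<Rightarrow> 'i line_bundle \<Rightarrow> bool" where
  "ample I Z L \<longleftrightarrow> is_line_bundle I Z L \<and> (\<exists>n\<ge>1. very_ample I Z (tensor_power L n))"

definition polarizable :: "'i set \<Rightarrow> 'i point set \<Rightarrow> ('i point \<Rightarrow> 'i point) \<Rightarrow> bool" where
  "polarizable I Z \<psi> \<longleftrightarrow> morphism I I Z \<psi> \<and> \<psi> ` Z \<subseteq> Z \<and>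
     (\<exists>L q. ample I Z L \<and> q > 1 \<and> line_bundle_iso I (pullback Z \<psi> L) (tensor_power L q))"


section \<open>Endomorphisms of projective space\<close>

text \<open>A \<open>(k+1)\<close>-tuple of forms of degree \<open>d\<close> up to scaling is a point of \<open>Proj (coeff_index k d)\<close>:
  the coordinate \<open>(j, m)\<close> is the coefficient of the monomial \<open>m\<close> in the \<open>j\<close>-th form.\<close>

definition coeff_index :: "nat \<Rightarrow> nat \<Rightarrow> (nat \<times> (nat \<Rightarrow>\<^sub>0 nat)) set" where
  "coeff_index k d = {..k} \<times> monoms {..k} d"

type_synonym endo = "(nat \<times> (nat \<Rightarrow>\<^sub>0 nat)) point"

definition endo_form :: "nat \<Rightarrow> nat \<Rightarrow> endo \<Rightarrow> nat \<Rightarrow> nat mpoly" where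
  "endo_form k d f j = (\<Sum>m\<in>monoms {..k} d. Poly_Mapping.single m (rep f (j, m)))"

definition End :: "nat \<Rightarrow> nat \<Rightarrow> endo set" where
  "End k d = {f \<in> Proj (coeff_index k d).
     \<forall>x\<in>Proj {..k}. \<exists>j\<le>k. eval (endo_form k d f j) (rep x) \<noteq> 0}"

definition endo_map :: "nat \<Rightarrow> nat \<Rightarrow> endo \<Rightarrow> nat point \<Rightarrow> nat point" where
  "endo_map k d f = form_map {..k} (endo_form k d f)"

text \<open>An open subset of \<open>End k d\<close> defined over the rationals: its complement in \<open>End k d\<close> is cut
  out by forms with rational coefficients.\<close>

definition open_over_rat :: "nat \<Rightarrow> nat \<Rightarrow> endo set \<Rightarrow> bool" where
  "open_over_rat k d U \<longleftrightarrow> (\<exists>S. S \<subseteq> (\<Union>e. forms (coeff_index k d) e) \<and>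
     (\<forall>p\<in>S. range (Poly_Mapping.lookup p) \<subseteq> \<rat>) \<and>
     U = {f \<in> End k d. \<exists>p\<in>S. eval p (rep f) \<noteq> 0})"


section \<open>Preperiodic and special subvarieties\<close>

definition preperiodic :: "('a \<Rightarrow> 'a) \<Rightarrow> 'a set \<Rightarrow> bool" where
  "preperiodic g X \<longleftrightarrow> (\<exists>a b. a > b \<and> (g ^^ a) ` X = (g ^^ b) ` X)"

definition special :: "nat \<Rightarrow> (nat point \<Rightarrow> nat point) \<Rightarrow> nat point set \<Rightarrow> bool" where
  "special k f X \<longleftrightarrow> (\<exists>Z n \<psi>. irreducible_variety {..k} Z \<and> X \<subseteq> Z \<and> n \<ge> 1 \<and>
     polarizable {..k} Z \<psi> \<and> (f ^^ n) ` Z = Z \<and>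
     (\<forall>x\<in>Z. (f ^^ n) (\<psi> x) = \<psi> ((f ^^ n) x)) \<and> preperiodic \<psi> X)"


section \<open>The Zariski topology is a topology\<close>

lemma eval_superset:
  assumes "finite A" "Poly_Mapping.keys p \<subseteq> A"
  shows "eval p v = (\<Sum>m\<in>A. Poly_Mapping.lookup p m * monom_eval m v)"
  unfolding eval_def by (rule sum.mono_neutral_left) (use assms in \<open>auto simp: in_keys_iff\<close>)

lemma eval_add: "eval (p + q) v = eval p v + eval q v"
  using Poly_Mapping.keys_add[of p q]
  by (simp add: eval_superset[of "Poly_Mapping.keys p \<union> Poly_Mapping.keys q"]
      lookup_add algebra_simps sum.distrib)

lemma eval_zero [simp]: "eval 0 v = 0"
  by (simp add: eval_def)

lemma eval_sum: "eval (sum f A) v = (\<Sum>a\<in>A. eval (f a) v)"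
  by (induction A rule: infinite_finite_induct) (auto simp: eval_add)

lemma eval_single [simp]: "eval (Poly_Mapping.single m c) v = c * monom_eval m v"
  by (simp add: eval_def)

lemma monom_eval_superset:
  assumes "finite A" "Poly_Mapping.keys m \<subseteq> A"
  shows "monom_eval m v = (\<Prod>i\<in>A. v i ^ Poly_Mapping.lookup m i)"
  unfolding monom_eval_def by (rule prod.mono_neutral_left) (use assms in \<open>auto simp: in_keys_iff\<close>)

lemma monom_eval_add: "monom_eval (m + n) v = monom_eval m v * monom_eval n v"
  using Poly_Mapping.keys_add[of m n]
  by (simp add: monom_eval_superset[of "Poly_Mapping.keys m \<union> Poly_Mapping.keys n"]
      lookup_add power_add prod.distrib)

lemma sum_single_keys: "(\<Sum>m\<in>Poly_Mapping.keys p. Poly_Mapping.single m (Poly_Mapping.lookup p m)) = p"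
  by (rule poly_mapping_eqI)
    (simp add: lookup_sum lookup_single when_def in_keys_iff)

lemma eval_mult: "eval (p * q) v = eval p v * eval q v"
proof -
  have "p * q = (\<Sum>m\<in>Poly_Mapping.keys p. \<Sum>n\<in>Poly_Mapping.keys q.
      Poly_Mapping.single (m + n) (Poly_Mapping.lookup p m * Poly_Mapping.lookup q n))"
    using sum_product[of "\<lambda>m. Poly_Mapping.single m (Poly_Mapping.lookup p m)" "Poly_Mapping.keys p"
        "\<lambda>n. Poly_Mapping.single n (Poly_Mapping.lookup q n)" "Poly_Mapping.keys q"]
    by (simp only: sum_single_keys mult_single)
  then have "eval (p * q) v = (\<Sum>m\<in>Poly_Mapping.keys p. \<Sum>n\<in>Poly_Mapping.keys q.
      (Poly_Mapping.lookup p m * monom_eval m v) * (Poly_Mapping.lookup q n * monom_eval n v))"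
    by (simp add: eval_sum monom_eval_add algebra_simps)
  then show ?thesis
    by (simp add: eval_def sum_product)
qed

lemma monoms_add: "m \<in> monoms I d \<Longrightarrow> n \<in> monoms I e \<Longrightarrow> m + n \<in> monoms I (d + e)"
  using Poly_Mapping.keys_add[of m n] setsum_keys_plus_distrib[of "\<lambda>_ x. x" m n]
  by (auto simp: monoms_def)

lemma forms_mult: "p \<in> forms I d \<Longrightarrow> q \<in> forms I e \<Longrightarrow> p * q \<in> forms I (d + e)"
  using keys_mult[of p q] monoms_add[of _ I d _ e] unfolding forms_def by blast

lemma openin_zariski:
  "openin (zariski I) W \<longleftrightarrow>
     (\<exists>S. S \<subseteq> (\<Union>e. forms I e) \<and> W = {x \<in> Proj I. \<exists>p\<in>S. eval p (rep x) \<noteq> 0})"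
proof -
  define D where "D S = {x \<in> Proj I. \<exists>p\<in>S. eval p (rep x) \<noteq> 0}" for S :: "'a mpoly set"
  define F where "F = (\<Union>e. forms I e)"
  define P where "P W \<longleftrightarrow> (\<exists>S. S \<subseteq> F \<and> W = D S)" for W
  have F_mult: "p * q \<in> F" if "p \<in> F" "q \<in> F" for p q
    using that forms_mult unfolding F_def by blast
  have D_mult: "D S \<inter> D T = D {p * q |p q. p \<in> S \<and> q \<in> T}" (is "_ = D ?R") for S T
  proof (rule set_eqI)
    fix x
    have "(\<exists>r\<in>?R. eval r (rep x) \<noteq> 0) \<longleftrightarrow>
        (\<exists>p\<in>S. \<exists>q\<in>T. eval (p * q) (rep x) \<noteq> 0)"
      by blast
    also have "\<dots> \<longleftrightarrow> (\<exists>p\<in>S. eval p (rep x) \<noteq> 0) \<and> (\<exists>q\<in>T. eval q (rep x) \<noteq> 0)"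
      by (simp add: eval_mult)
    finally show "x \<in> D S \<inter> D T \<longleftrightarrow> x \<in> D ?R"
      unfolding D_def Int_iff mem_Collect_eq by argo
  qed
  have D_UN: "(\<Union>W\<in>K. D (S W)) = D (\<Union>W\<in>K. S W)" for S and K :: "'a point set set"
    by (auto simp: D_def)
  have "P (A \<inter> B)" if "P A" "P B" for A B
  proof -
    from \<open>P A\<close> obtain S where S: "S \<subseteq> F" "A = D S"
      by (auto simp: P_def)
    from \<open>P B\<close> obtain T where T: "T \<subseteq> F" "B = D T"
      by (auto simp: P_def)
    have "{p * q |p q. p \<in> S \<and> q \<in> T} \<subseteq> F"
      using S(1) T(1) F_mult by (auto dest: subsetD)
    then show ?thesis
      unfolding P_def S(2) T(2) D_mult by auto
  qed
  moreover have "P (\<Union>K)" if K: "\<forall>W\<in>K. P W" for K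
  proof -
    from K have "\<forall>W\<in>K. \<exists>S. S \<subseteq> F \<and> W = D S"
      by (simp add: P_def)
    then obtain S where S: "\<forall>W\<in>K. S W \<subseteq> F \<and> W = D (S W)"
      by (rule bchoice[THEN exE])
    then have "(\<Union>W\<in>K. S W) \<subseteq> F"
      by (simp add: UN_subset_iff)
    moreover have "(\<Union>W\<in>K. D (S W)) = (\<Union>W\<in>K. W)"
      by (rule SUP_cong) (use S in auto)
    then have "\<Union>K = D (\<Union>W\<in>K. S W)"
      by (simp add: D_UN)
    ultimately show ?thesis
      unfolding P_def by (intro exI conjI)
  qed
  ultimately have "istopology P"
    by (simp add: istopology_def)
  moreover have "zariski I = topology P"
    unfolding zariski_def P_def F_def D_def ..
  ultimately have "openin (zariski I) = P"
    by simp
  then show ?thesis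
    by (simp add: P_def F_def D_def)
qed

end

theory Submission
  imports Defs "HOL-Complex_Analysis.Conformal_Mappings"
    "HOL-Computational_Algebra.Fundamental_Theorem_Algebra"
begin

text \<open>If \<open>X\<close> is preperiodic under \<open>f\<close>, then \<open>Z = P\<^sup>k\<close> and \<open>\<psi> = f\<close> show that it is special: \<open>f\<close> pulls
  \<open>O(1)\<close> back to \<open>O(d)\<close> and is surjective. Conversely, let \<open>Z\<close>, \<open>n\<close> and \<open>\<psi>\<close> show that \<open>X\<close> is special.
  A variety containing the hypersurface \<open>X\<close> is \<open>X\<close> or \<open>P\<^sup>k\<close>. If \<open>Z = X\<close>, then \<open>f\<^sup>n\<close> fixes \<open>X\<close>. If
  \<open>Z = P\<^sup>k\<close>, then \<open>\<psi>\<close> is a dominant map commuting with \<open>f\<^sup>n\<close>, so rigidity makes it an iterate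
  \<open>f\<^sup>s\<close>; here \<open>s \<ge> 1\<close>, as the identity is not polarizable, and preperiodicity passes from \<open>\<psi>\<close> to \<open>f\<close>.

  Surjectivity of \<open>f\<close>, dominance of \<open>\<psi>\<close> and \<open>s \<ge> 1\<close> all come from one minimum principle. Let
  \<open>\<psi>\<close> pull \<open>L\<close> back to the \<open>q\<close>-th power of \<open>L\<close>, and let \<open>\<iota>\<close> be the embedding given by a very ample
  power of \<open>L\<close>. The pullback by \<open>\<psi>\<close> of the Fubini-Study metric on this power, compared with the
  \<open>q\<close>-th power of the metric itself, is a positive function \<open>\<Phi>\<close> on \<open>P\<^sup>k\<close>. Locally
  \<open>\<Phi> = \<bar>h\<bar> \<parallel>A\<parallel> / \<parallel>B\<parallel>\<^sup>q\<close>, where \<open>h\<close> is a nonvanishing holomorphic function and \<open>A\<close>, \<open>B\<close> are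
  homogeneous coordinates of \<open>\<iota> \<circ> \<psi>\<close> and \<open>\<iota>\<close>. By compactness \<open>\<Phi>\<close> has a minimum. Suppose that \<open>\<psi>\<close> is
  constant to first order along a disc through the minimum. There \<open>log \<bar>h\<bar>\<close> is harmonic,
  \<open>log \<parallel>A\<parallel>\<close> has Laplacian zero at the centre, and \<open>log \<parallel>B\<parallel>\<close> has positive Laplacian because \<open>\<iota>\<close> is
  an immersion; so \<open>log \<Phi>\<close> has negative Laplacian at its minimum, which is absurd
  (\<open>metric_quotient_no_minimum\<close>). If \<open>\<psi>\<close> were not dominant, a counting argument in linear algebra
  would give such a disc through every point (\<open>degenerate_direction\<close>). If \<open>\<psi>\<close> were the identity, then
  \<open>\<Phi> = \<bar>h\<bar> / \<parallel>B\<parallel>\<^sup>q\<^sup>-\<^sup>1\<close> and every disc would do. Finally \<open>k\<close> forms of positive degree without a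
  common zero on \<open>P\<^sup>k\<close> would define a map to \<open>P\<^sup>k\<^sup>-\<^sup>1\<close>, which degenerates somewhere for reasons of dimension
  (\<open>forms_common_zero\<close>); if \<open>f\<close> missed a point, the forms cutting out this point would pull back to
  such \<open>k\<close> forms.

  That \<open>Z\<close> is \<open>X\<close> or \<open>P\<^sup>k\<close> is elimination theory (\<open>hypersurface_maximal\<close>): project from a point outside
  \<open>X\<close> and compare the forms of least degree in the fibre direction that vanish on \<open>X\<close> and on \<open>Z\<close>.

  All computations take place on the cone \<open>vecs k\<close> of nonzero coordinate vectors, with polynomial
  functions of vectors in place of formal polynomials. Since \<open>k\<close> is a number and not a type, calculus
  is only done in one complex variable, along curves in the cone.\<close>

section \<open>Homogeneous polynomial functions\<close>

text \<open>The function defined by a form of degree \<open>e\<close> in the variables \<open>0, \<dots>, k\<close>. The inductive definition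
  yields composition, restriction to lines and gradients by induction; \<open>homog_eval\<close> and
  \<open>homog_imp_form\<close> identify these functions with the values of forms.\<close>

inductive homog :: "nat \<Rightarrow> nat \<Rightarrow> ((nat \<Rightarrow> complex) \<Rightarrow> complex) \<Rightarrow> bool" for k where
  homog_const: "homog k 0 (\<lambda>v. c)"
| homog_coord: "i \<le> k \<Longrightarrow> homog k 1 (\<lambda>v. v i)"
| homog_add: "homog k e f \<Longrightarrow> homog k e g \<Longrightarrow> homog k e (\<lambda>v. f v + g v)"
| homog_mult: "homog k d f \<Longrightarrow> homog k e g \<Longrightarrow> homog k (d + e) (\<lambda>v. f v * g v)"

lemma homog_scale: "homog k e f \<Longrightarrow> f (\<lambda>i. c * v i) = c ^ e * f v"
  by (induction rule: homog.induct) (auto simp: algebra_simps power_add)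

lemma homog_cong: "homog k e f \<Longrightarrow> (\<And>i. i \<le> k \<Longrightarrow> v i = w i) \<Longrightarrow> f v = f w"
  by (induction rule: homog.induct) auto

lemma homog_power: "homog k d f \<Longrightarrow> homog k (d * n) (\<lambda>v. f v ^ n)"
proof (induction n)
  case 0
  then show ?case using homog_const[of k 1] by simp
next
  case (Suc n)
  then show ?case using homog_mult[of k d f "d * n" "\<lambda>v. f v ^ n"] by simp
qed

lemma homog_cmult: "homog k e f \<Longrightarrow> homog k e (\<lambda>v. c * f v)"
  using homog_mult[OF homog_const] by fastforce

lemma homog_zero: "homog k e (\<lambda>v. 0)"
proof -
  have "homog k (0 + 1 * e) (\<lambda>v. 0 * v 0 ^ e)"
    by (intro homog_mult homog_const homog_power homog_coord) simp
  then show ?thesis by simp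
qed

lemma homog_diff: "homog k e f \<Longrightarrow> homog k e g \<Longrightarrow> homog k e (\<lambda>v. f v - g v)"
  using homog_add[OF _ homog_cmult[of k e g "-1"]] by simp

lemma homog_sum: "(\<And>a. a \<in> A \<Longrightarrow> homog k e (f a)) \<Longrightarrow> homog k e (\<lambda>v. \<Sum>a\<in>A. f a v)"
  by (induction A rule: infinite_finite_induct) (auto intro: homog_zero homog_add)

lemma homog_comp:
  "homog l d f \<Longrightarrow> (\<And>i. i \<le> l \<Longrightarrow> homog k e (G i)) \<Longrightarrow> homog k (d * e) (\<lambda>v. f (\<lambda>i. G i v))"
  by (induction rule: homog.induct)
    (auto intro: homog.intros simp: add_mult_distrib)

lemma homog_degree_0: assumes "homog k e f" "e = 0" shows "f v = f w"
  using assms by (induction rule: homog.induct) auto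

lemma homog_prod_coords:
  assumes "finite A" "A \<subseteq> {..k}"
  shows "homog k (\<Sum>i\<in>A. n i) (\<lambda>v. \<Prod>i\<in>A. v i ^ n i)"
  using assms
proof (induction rule: finite_induct)
  case empty
  show ?case using homog_const[of k 1] by simp
next
  case (insert x F)
  have "homog k (1 * n x) (\<lambda>v. v x ^ n x)"
    using insert by (intro homog_power homog_coord) simp
  from homog_mult[OF this insert.IH] show ?case
    using insert by simp
qed

lemma homog_eval: assumes "p \<in> forms {..k} e" shows "homog k e (eval p)"
proof -
  have "homog k e (\<lambda>v. \<Sum>m\<in>Poly_Mapping.keys p. Poly_Mapping.lookup p m * monom_eval m v)"
  proof (rule homog_sum, rule homog_cmult)
    fix m assume "m \<in> Poly_Mapping.keys p"
    then have m: "Poly_Mapping.keys m \<subseteq> {..k}" "(\<Sum>i\<in>Poly_Mapping.keys m. Poly_Mapping.lookup m i) = e"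
      using assms by (auto simp: forms_def monoms_def)
    show "homog k e (monom_eval m)"
      using homog_prod_coords[OF _ m(1), of "Poly_Mapping.lookup m"] m(2)
      by (simp add: monom_eval_def[abs_def])
  qed
  then show ?thesis by (simp add: eval_def[abs_def])
qed

lemma homog_imp_form: assumes "homog k e f" shows "\<exists>p\<in>forms {..k} e. f = eval p"
  using assms
proof (induction rule: homog.induct)
  case (homog_const c)
  have "Poly_Mapping.single 0 c \<in> forms {..k} 0"
    by (auto simp: forms_def monoms_def)
  moreover have "(\<lambda>v. c) = eval (Poly_Mapping.single 0 c)"
    by (auto simp: monom_eval_def)
  ultimately show ?case by blast
next
  case (homog_coord i)
  have "Poly_Mapping.single (Poly_Mapping.single i 1) 1 \<in> forms {..k} 1"
    using homog_coord by (auto simp: forms_def monoms_def)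
  moreover have "(\<lambda>v. v i) = eval (Poly_Mapping.single (Poly_Mapping.single i 1) 1)"
    by (auto simp: monom_eval_def)
  ultimately show ?case by blast
next
  case (homog_add e f g)
  then obtain p q where "p \<in> forms {..k} e" "q \<in> forms {..k} e" "f = eval p" "g = eval q"
    by blast
  moreover from this have "p + q \<in> forms {..k} e"
    using Poly_Mapping.keys_add[of p q] by (auto simp: forms_def)
  ultimately show ?case by (intro bexI[of _ "p + q"]) (auto simp: eval_add)
next
  case (homog_mult d f e g)
  then obtain p q where "p \<in> forms {..k} d" "q \<in> forms {..k} e" "f = eval p" "g = eval q"
    by blast
  then show ?case by (intro bexI[of _ "p * q"]) (auto simp: eval_mult forms_mult)
qed

lemma homog_continuous: "homog k e f \<Longrightarrow> continuous_on UNIV f"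
  by (induction rule: homog.induct)
    (auto intro!: continuous_intros continuous_on_product_coordinates)

lemma homog_tendsto:
  assumes "homog k e f" "(c \<longlongrightarrow> v) F"
  shows "((\<lambda>t. f (c t)) \<longlongrightarrow> f v) F"
proof -
  have "isCont f v"
    using homog_continuous[OF assms(1)] by (simp add: continuous_on_eq_continuous_at)
  then show ?thesis by (rule isCont_tendsto_compose) fact
qed

text \<open>Restriction to a line turns a form into a polynomial in one variable. This is the source of all
  density arguments below.\<close>

lemma homog_line_poly:
  "homog k e f \<Longrightarrow> \<exists>P. \<forall>t. f (\<lambda>i. v i + t * w i) = poly P t"
proof (induction rule: homog.induct)
  case (homog_const c)
  show ?case by (rule exI[of _ "[:c:]"]) simp
next
  case (homog_coord i)
  show ?case by (rule exI[of _ "[:v i, w i:]"]) (simp add: mult.commute)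
next
  case (homog_add e f g)
  then show ?case by (metis poly_add)
next
  case (homog_mult d f e g)
  then show ?case by (metis poly_mult)
qed

lemma homog_line_holomorphic:
  assumes "homog k e f" shows "(\<lambda>t. f (\<lambda>i. v i + t * w i)) holomorphic_on S"
proof -
  obtain P where "\<And>t. f (\<lambda>i. v i + t * w i) = poly P t"
    using homog_line_poly[OF assms] by blast
  then have "(\<lambda>t. f (\<lambda>i. v i + t * w i)) = poly P" by auto
  then show ?thesis by (simp add: holomorphic_intros)
qed

text \<open>The partial derivatives, characterized by the chain rule along all holomorphic curves: this is
  the form in which they are applied, to lines, to radial curves and to images of lines under other
  forms.\<close>

definition gradient :: "nat \<Rightarrow> ((nat \<Rightarrow> complex) \<Rightarrow> complex) \<Rightarrow> (nat \<Rightarrow> (nat \<Rightarrow> complex) \<Rightarrow> complex) \<Rightarrow> bool"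
  where "gradient k f G \<longleftrightarrow> (\<forall>c c' t. (\<forall>i\<le>k. ((\<lambda>s. c s i) has_field_derivative c' i) (at t)) \<longrightarrow>
     ((\<lambda>s. f (c s)) has_field_derivative (\<Sum>i\<le>k. G i (c t) * c' i)) (at t))"

lemma gradientD:
  assumes "gradient k f G" "\<And>i. i \<le> k \<Longrightarrow> ((\<lambda>s. c s i) has_field_derivative c' i) (at t)"
  shows "((\<lambda>s. f (c s)) has_field_derivative (\<Sum>i\<le>k. G i (c t) * c' i)) (at t)"
  using assms unfolding gradient_def by blast

lemma homog_gradient:
  assumes "homog k e f"
  obtains G where "gradient k f G" "\<And>i. homog k (e - 1) (G i)"
proof -
  have "\<exists>G. gradient k f G \<and> (\<forall>i. homog k (e - 1) (G i)) \<and> (e = 0 \<longrightarrow> (\<forall>i v. G i v = 0))"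
    using assms
  proof (induction rule: homog.induct)
    case (homog_const c)
    show ?case
      by (rule exI[of _ "\<lambda>i v. 0"]) (auto simp: gradient_def intro: homog_zero)
  next
    case (homog_coord i)
    have "(\<Sum>j\<le>k. (if j = i then 1 else 0) * c' j) = (c' i :: complex)" for c'
      using homog_coord by (simp add: if_distrib[of "\<lambda>x. x * _"] cong: if_cong)
    then show ?case using homog_coord
      by (intro exI[of _ "\<lambda>j v. if j = i then 1 else 0"])
        (auto simp: gradient_def simp del: mult_eq_if intro: homog.homog_const homog_zero)
  next
    case (homog_add e f g)
    then obtain G H where "gradient k f G \<and> (\<forall>i. homog k (e - 1) (G i)) \<and> (e = 0 \<longrightarrow> (\<forall>i v. G i v = 0))"
      "gradient k g H \<and> (\<forall>i. homog k (e - 1) (H i)) \<and> (e = 0 \<longrightarrow> (\<forall>i v. H i v = 0))" by blast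
    then show ?case
      by (intro exI[of _ "\<lambda>i v. G i v + H i v"])
        (auto simp: gradient_def distrib_right sum.distrib intro: homog.homog_add DERIV_add)
  next
    case (homog_mult d f e g)
    then obtain G H where
      G: "gradient k f G" "\<And>i. homog k (d - 1) (G i)" "d = 0 \<Longrightarrow> \<forall>i v. G i v = 0" and
      H: "gradient k g H" "\<And>i. homog k (e - 1) (H i)" "e = 0 \<Longrightarrow> \<forall>i v. H i v = 0" by blast
    let ?K = "\<lambda>i v. G i v * g v + f v * H i v"
    have "homog k (d + e - 1) (\<lambda>v. G i v * g v)" for i
    proof (cases "d = 0")
      case True then show ?thesis using G(3) homog_zero by simp
    next
      case False
      then have "d - 1 + e = d + e - 1" by simp
      then show ?thesis using homog.homog_mult[OF G(2) homog_mult.hyps(2)] by metis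
    qed
    moreover have "homog k (d + e - 1) (\<lambda>v. f v * H i v)" for i
    proof (cases "e = 0")
      case True then show ?thesis using H(3) homog_zero by simp
    next
      case False
      then have "d + (e - 1) = d + e - 1" by simp
      then show ?thesis using homog.homog_mult[OF homog_mult.hyps(1) H(2)] by metis
    qed
    ultimately have "homog k (d + e - 1) (?K i)" for i
      by (rule homog.homog_add)
    moreover have "gradient k (\<lambda>v. f v * g v) ?K"
      unfolding gradient_def
    proof (intro allI impI)
      fix c :: "complex \<Rightarrow> nat \<Rightarrow> complex" and c' t assume c: "\<forall>i\<le>k. ((\<lambda>s. c s i) has_field_derivative c' i) (at t)"
      have "((\<lambda>s. f (c s) * g (c s)) has_field_derivative
          (\<Sum>i\<le>k. G i (c t) * c' i) * g (c t) + (\<Sum>i\<le>k. H i (c t) * c' i) * f (c t)) (at t)"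
        using c by (intro DERIV_mult gradientD[OF G(1)] gradientD[OF H(1)]) auto
      then show "((\<lambda>s. f (c s) * g (c s)) has_field_derivative (\<Sum>i\<le>k. ?K i (c t) * c' i)) (at t)"
        by (simp add: sum_distrib_left sum.distrib algebra_simps)
    qed
    ultimately show ?case using G(3) H(3) by (intro exI[of _ ?K]) auto
  qed
  then show ?thesis using that by blast
qed

lemma euler:
  assumes "homog k e f" "gradient k f G"
  shows "(\<Sum>i\<le>k. G i v * v i) = of_nat e * f v"
proof -
  have "((\<lambda>s. f (\<lambda>i. s * v i)) has_field_derivative (\<Sum>i\<le>k. G i (\<lambda>i. 1 * v i) * v i)) (at 1)"
    by (rule gradientD[OF assms(2)]) (auto intro!: derivative_eq_intros)
  moreover have "((\<lambda>s. s ^ e * f v) has_field_derivative of_nat e * f v) (at 1)"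
    by (auto intro!: derivative_eq_intros)
  ultimately show ?thesis
    using DERIV_unique by (fastforce simp: homog_scale[OF assms(1)])
qed

lemma gradient_line:
  assumes "gradient k f G"
  shows "((\<lambda>t. f (\<lambda>i. v i + t * w i)) has_field_derivative (\<Sum>i\<le>k. G i v * w i)) (at 0)"
proof -
  have "((\<lambda>t. v i + t * w i) has_field_derivative w i) (at 0)" for i
    by (auto intro!: derivative_eq_intros)
  then show ?thesis
    using gradientD[OF assms, of "\<lambda>t i. v i + t * w i" w 0] by simp
qed

section \<open>Points of projective space and Zariski neighbourhoods\<close>

text \<open>The punctured affine cone over projective \<open>k\<close>-space.\<close>

definition vecs :: "nat \<Rightarrow> (nat \<Rightarrow> complex) set" where
  "vecs k = {v. (\<forall>i. i \<notin> {..k} \<longrightarrow> v i = 0) \<and> (\<exists>i\<in>{..k}. v i \<noteq> 0)}"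

lemma Proj_eq_image: "Proj {..k} = pt ` vecs k"
  by (auto simp: Proj_def vecs_def)

lemma pt_in_Proj: "v \<in> vecs k \<Longrightarrow> pt v \<in> Proj {..k}"
  by (simp add: Proj_eq_image)

lemma vecs_scale: "v \<in> vecs k \<Longrightarrow> c \<noteq> 0 \<Longrightarrow> (\<lambda>i. c * v i) \<in> vecs k"
  by (auto simp: vecs_def)

lemma pt_scale: assumes "c \<noteq> 0" shows "pt (\<lambda>i. c * v i) = pt v"
proof -
  have "\<exists>b. b \<noteq> 0 \<and> (\<lambda>i. a * v i) = (\<lambda>i. b * (c * v i))" if "a \<noteq> 0" for a
    using that assms by (intro exI[of _ "a / c"]) auto
  then have "pt v \<subseteq> pt (\<lambda>i. c * v i)"
    unfolding pt_def by blast
  moreover have "\<exists>b. b \<noteq> 0 \<and> (\<lambda>i. a * (c * v i)) = (\<lambda>i. b * v i)" if "a \<noteq> 0" for a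
    using that assms by (intro exI[of _ "a * c"]) (auto simp: algebra_simps)
  then have "pt (\<lambda>i. c * v i) \<subseteq> pt v"
    unfolding pt_def by blast
  ultimately show ?thesis by (rule subset_antisym[OF _ _, symmetric])
qed

lemma rep_pt: "\<exists>c. c \<noteq> 0 \<and> rep (pt v) = (\<lambda>i. c * v i)"
proof -
  have "(\<lambda>i. 1 * v i) \<in> pt v" unfolding pt_def by (rule CollectI) (rule exI[of _ 1], simp)
  then have "rep (pt v) \<in> pt v" unfolding rep_def by (rule someI[where P = "\<lambda>w. w \<in> pt v"])
  then show ?thesis by (auto simp: pt_def)
qed

lemma rep_in_vecs: assumes "x \<in> Proj {..k}" shows "rep x \<in> vecs k" "pt (rep x) = x"
proof -
  obtain v where v: "v \<in> vecs k" "x = pt v"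
    using assms by (auto simp: Proj_eq_image)
  obtain c where "c \<noteq> 0" "rep x = (\<lambda>i. c * v i)"
    using rep_pt[of v] v by blast
  then show "rep x \<in> vecs k" "pt (rep x) = x"
    using v by (simp_all add: vecs_scale pt_scale)
qed

lemma pt_eq_imp: assumes "pt v = pt w" shows "\<exists>c. c \<noteq> 0 \<and> v = (\<lambda>i. c * w i)"
proof -
  have "(\<lambda>i. 1 * v i) \<in> pt v" unfolding pt_def by (rule CollectI) (rule exI[of _ 1], simp)
  then show ?thesis unfolding assms by (auto simp: pt_def)
qed

lemma homog_rep_eq_0: "homog k e f \<Longrightarrow> f (rep (pt v)) = 0 \<longleftrightarrow> f v = 0"
  using rep_pt[of v] by (auto simp: homog_scale)

lemma homog_rep_ratio:
  "homog k e f \<Longrightarrow> homog k e g \<Longrightarrow> f (rep (pt v)) / g (rep (pt v)) = f v / g v"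
  using rep_pt[of v] by (auto simp: homog_scale)

lemma openin_zariski_homog:
  "openin (zariski {..k}) W \<longleftrightarrow> (\<exists>S. (\<forall>f\<in>S. \<exists>e. homog k e f) \<and>
     W = {x \<in> Proj {..k}. \<exists>f\<in>S. f (rep x) \<noteq> 0})"
proof
  assume "openin (zariski {..k}) W"
  then obtain S where S: "S \<subseteq> (\<Union>e. forms {..k} e)" "W = {x \<in> Proj {..k}. \<exists>p\<in>S. eval p (rep x) \<noteq> 0}"
    unfolding openin_zariski by blast
  have "\<forall>f\<in>eval ` S. \<exists>e. homog k e f" using S(1) homog_eval by blast
  then show "\<exists>S. (\<forall>f\<in>S. \<exists>e. homog k e f) \<and> W = {x \<in> Proj {..k}. \<exists>f\<in>S. f (rep x) \<noteq> 0}"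
    using S(2) by (intro exI[of _ "eval ` S"]) auto
next
  assume "\<exists>S. (\<forall>f\<in>S. \<exists>e. homog k e f) \<and> W = {x \<in> Proj {..k}. \<exists>f\<in>S. f (rep x) \<noteq> 0}"
  then obtain S where S: "\<forall>f\<in>S. \<exists>e. homog k e f" "W = {x \<in> Proj {..k}. \<exists>f\<in>S. f (rep x) \<noteq> 0}"
    by blast
  have "S \<subseteq> eval ` (\<Union>e. forms {..k} e)"
  proof
    fix f assume "f \<in> S"
    then obtain e where "homog k e f" using S(1) by blast
    then obtain p where "p \<in> forms {..k} e" "f = eval p" using homog_imp_form by blast
    then show "f \<in> eval ` (\<Union>e. forms {..k} e)" by blast
  qed
  then obtain T where T: "T \<subseteq> (\<Union>e. forms {..k} e)" "S = eval ` T"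
    by (rule subset_imageE)
  then have "W = {x \<in> Proj {..k}. \<exists>p\<in>T. eval p (rep x) \<noteq> 0}"
    unfolding S(2) by simp
  then show "openin (zariski {..k}) W"
    unfolding openin_zariski using T(1) by blast
qed

lemma openin_nonzero_set: "homog k e f \<Longrightarrow> openin (zariski {..k}) {x \<in> Proj {..k}. f (rep x) \<noteq> 0}"
  unfolding openin_zariski_homog by (intro exI[of _ "{f}"]) auto

lemma openin_Proj: "openin (zariski {..k::nat}) (Proj {..k})"
  using openin_nonzero_set[OF homog_const[of k 1]] by simp

lemma topspace_zariski: "topspace (zariski {..k::nat}) = Proj {..k}"
proof
  show "topspace (zariski {..k}) \<subseteq> Proj {..k}"
    using openin_topspace[of "zariski {..k}"] unfolding openin_zariski by blast
  show "Proj {..k} \<subseteq> topspace (zariski {..k})"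
    using openin_Proj by (rule openin_subset)
qed

text \<open>The property \<open>\<phi>\<close> holds on the part of a Zariski open neighbourhood of \<open>v0\<close> that lies in the cone.
  Basic open sets suffice, so that pulling back by forms stays within the definition.\<close>

definition near :: "nat \<Rightarrow> (nat \<Rightarrow> complex) \<Rightarrow> ((nat \<Rightarrow> complex) \<Rightarrow> bool) \<Rightarrow> bool" where
  "near k v0 \<phi> \<longleftrightarrow> (\<exists>d s. homog k d s \<and> s v0 \<noteq> 0 \<and> (\<forall>v\<in>vecs k. s v \<noteq> 0 \<longrightarrow> \<phi> v))"

lemma near_nonzero: "homog k d s \<Longrightarrow> s v0 \<noteq> 0 \<Longrightarrow> near k v0 (\<lambda>v. s v \<noteq> 0)"
  by (auto simp: near_def)

lemma near_conj: assumes "near k v0 \<phi>" "near k v0 \<psi>" shows "near k v0 (\<lambda>v. \<phi> v \<and> \<psi> v)"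
proof -
  obtain d s e r where "homog k d s" "s v0 \<noteq> 0" "\<forall>v\<in>vecs k. s v \<noteq> 0 \<longrightarrow> \<phi> v"
    "homog k e r" "r v0 \<noteq> 0" "\<forall>v\<in>vecs k. r v \<noteq> 0 \<longrightarrow> \<psi> v"
    using assms unfolding near_def by blast
  then show ?thesis
    unfolding near_def using homog_mult[of k d s e r]
    by (intro exI[of _ "d + e"] exI[of _ "\<lambda>v. s v * r v"]) simp
qed

lemma near_mono: "near k v0 \<phi> \<Longrightarrow> (\<And>v. v \<in> vecs k \<Longrightarrow> \<phi> v \<Longrightarrow> \<psi> v) \<Longrightarrow> near k v0 \<psi>"
  unfolding near_def by blast

lemma near_self: "near k v0 \<phi> \<Longrightarrow> v0 \<in> vecs k \<Longrightarrow> \<phi> v0"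
  unfolding near_def by blast

text \<open>Zariski neighbourhoods are neighbourhoods in the classical topology.\<close>

lemma near_eventually:
  assumes "near k v0 \<phi>" "(c \<longlongrightarrow> v0) F" "\<forall>\<^sub>F x in F. c x \<in> vecs k"
  shows "\<forall>\<^sub>F x in F. \<phi> (c x)"
proof -
  obtain d s where s: "homog k d s" "s v0 \<noteq> 0" "\<forall>v\<in>vecs k. s v \<noteq> 0 \<longrightarrow> \<phi> v"
    using assms(1) unfolding near_def by blast
  have "\<forall>\<^sub>F x in F. s (c x) \<noteq> 0"
    using homog_tendsto[OF s(1) assms(2)] s(2) by (rule tendsto_imp_eventually_ne)
  with assms(3) show ?thesis by eventually_elim (use s(3) in blast)
qed

lemma near_comp:
  assumes "near l (\<lambda>j. G j v0) \<phi>" "\<And>j. homog k e (G j)" "near k v0 (\<lambda>v. (\<lambda>j. G j v) \<in> vecs l)"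
  shows "near k v0 (\<lambda>v. \<phi> (\<lambda>j. G j v))"
proof -
  obtain d s where s: "homog l d s" "s (\<lambda>j. G j v0) \<noteq> 0" "\<forall>w\<in>vecs l. s w \<noteq> 0 \<longrightarrow> \<phi> w"
    using assms(1) unfolding near_def by blast
  have "near k v0 (\<lambda>v. s (\<lambda>j. G j v) \<noteq> 0)"
    using homog_comp[OF s(1), of k e G] assms(2) s(2) by (intro near_nonzero) auto
  from near_conj[OF this assms(3)] show ?thesis
    by (rule near_mono) (use s(3) in blast)
qed

lemma openin_zariski_near:
  assumes "openin (zariski {..k}) W" "pt v0 \<in> W"
  shows "near k v0 (\<lambda>v. pt v \<in> W)"
proof -
  obtain S where S: "\<forall>f\<in>S. \<exists>e. homog k e f" "W = {x \<in> Proj {..k}. \<exists>f\<in>S. f (rep x) \<noteq> 0}"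
    using assms(1) unfolding openin_zariski_homog by blast
  obtain f where f: "f \<in> S" "f (rep (pt v0)) \<noteq> 0" using assms(2) S(2) by blast
  obtain e where e: "homog k e f" using S(1) f(1) by blast
  have "f v0 \<noteq> 0" using f(2) homog_rep_eq_0[OF e] by simp
  moreover have "pt v \<in> W" if "v \<in> vecs k" "f v \<noteq> 0" for v
    using that f(1) homog_rep_eq_0[OF e] pt_in_Proj unfolding S(2) by blast
  ultimately show ?thesis using e unfolding near_def by blast
qed

lemma closedin_zero_set:
  assumes "homog k e f" shows "closedin (zariski {..k}) {x \<in> Proj {..k}. f (rep x) = 0}"
proof -
  have "Proj {..k} - {x \<in> Proj {..k}. f (rep x) = 0} = {x \<in> Proj {..k}. f (rep x) \<noteq> 0}" by auto
  then show ?thesis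
    using openin_nonzero_set[OF assms] by (auto simp: closedin_def topspace_zariski)
qed

text \<open>The form witnessing that a point does not lie on a closed set.\<close>

lemma closedin_separating_form:
  assumes "closedin (zariski {..k}) C" "v0 \<in> vecs k" "pt v0 \<notin> C"
  obtains e f where "homog k e f" "f v0 \<noteq> 0" "\<And>v. v \<in> vecs k \<Longrightarrow> pt v \<in> C \<Longrightarrow> f v = 0"
proof -
  have "openin (zariski {..k}) (Proj {..k} - C)" "pt v0 \<in> Proj {..k} - C"
    using assms pt_in_Proj by (auto simp: closedin_def topspace_zariski)
  from openin_zariski_near[OF this] obtain e f
    where f: "homog k e f" "f v0 \<noteq> 0" "\<forall>v\<in>vecs k. f v \<noteq> 0 \<longrightarrow> pt v \<in> Proj {..k} - C"
    unfolding near_def by blast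
  show thesis by (rule that[OF f(1,2)]) (use f(3) in blast)
qed

lemma homog_line_finite_zeros:
  assumes "homog k e f" "f (\<lambda>i. v i + t * w i) \<noteq> 0"
  shows "finite {s. f (\<lambda>i. v i + s * w i) = 0}"
proof -
  obtain P where "\<And>t. f (\<lambda>i. v i + t * w i) = poly P t"
    using homog_line_poly[OF assms(1)] by blast
  moreover from this have "P \<noteq> 0" using assms(2) by auto
  ultimately show ?thesis using poly_roots_finite by simp
qed

text \<open>On the line joining the two points each of the functions, and the cone itself, loses only
  finitely many parameters.\<close>

lemma homog_common_nonzero:
  assumes "homog k d f" "homog k e g" "v \<in> vecs k" "f v \<noteq> 0" "w \<in> vecs k" "g w \<noteq> 0"
  obtains u where "u \<in> vecs k" "f u \<noteq> 0" "g u \<noteq> 0"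
proof -
  obtain i where i: "i \<le> k" "v i \<noteq> 0" using assms(3) by (auto simp: vecs_def)
  let ?l = "\<lambda>t j. v j + t * (w j - v j)"
  have "finite {t. f (?l t) = 0}" "finite {t. ?l t i = 0}"
    using assms(4) i by (auto intro!: homog_line_finite_zeros[where t = 0] assms(1) homog_coord)
  moreover have "finite {t. g (?l t) = 0}"
    by (rule homog_line_finite_zeros[where t = 1]) (use assms in auto)
  ultimately have "finite ({t. f (?l t) = 0} \<union> {t. ?l t i = 0} \<union> {t. g (?l t) = 0})"
    by blast
  then have "\<exists>t. t \<notin> {t. f (?l t) = 0} \<union> {t. ?l t i = 0} \<union> {t. g (?l t) = 0}"
    by (rule ex_new_if_finite[OF infinite_UNIV_char_0])
  then obtain t where t: "f (?l t) \<noteq> 0" "?l t i \<noteq> 0" "g (?l t) \<noteq> 0"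
    by auto
  moreover have "?l t \<in> vecs k"
    using assms(3,5) i t(2) by (auto simp: vecs_def)
  ultimately show thesis by (intro that[of "?l t"])
qed

lemma openin_zariski_meet:
  fixes k :: nat
  assumes "openin (zariski {..k}) A" "openin (zariski {..k}) B" "A \<noteq> {}" "B \<noteq> {}"
  shows "A \<inter> B \<noteq> {}"
proof -
  obtain x y where "x \<in> A" "y \<in> B" using assms by blast
  moreover from this have "x \<in> Proj {..k}" "y \<in> Proj {..k}"
    using assms openin_subset topspace_zariski by blast+
  ultimately obtain v w where vw: "v \<in> vecs k" "pt v \<in> A" "w \<in> vecs k" "pt w \<in> B"
    unfolding Proj_eq_image by blast
  obtain d f where f: "homog k d f" "f v \<noteq> 0" "\<forall>v\<in>vecs k. f v \<noteq> 0 \<longrightarrow> pt v \<in> A"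
    using openin_zariski_near[OF assms(1) vw(2)] unfolding near_def by blast
  obtain e g where g: "homog k e g" "g w \<noteq> 0" "\<forall>v\<in>vecs k. g v \<noteq> 0 \<longrightarrow> pt v \<in> B"
    using openin_zariski_near[OF assms(2) vw(4)] unfolding near_def by blast
  obtain u where "u \<in> vecs k" "f u \<noteq> 0" "g u \<noteq> 0"
    using homog_common_nonzero[OF f(1) g(1) vw(1) f(2) vw(3) g(2)] .
  then show ?thesis using f(3) g(3) by blast
qed

lemma vecs_nonempty: "(\<lambda>i. if i = 0 then 1 else 0) \<in> vecs k"
  by (auto simp: vecs_def)

lemma irreducible_Proj: "irreducible_variety {..k::nat} (Proj {..k})"
  unfolding irreducible_variety_def
proof (intro conjI allI impI)
  show "closedin (zariski {..k}) (Proj {..k})"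
    using closedin_topspace[of "zariski {..k}"] by (simp add: topspace_zariski)
  show "Proj {..k} \<noteq> {}" using vecs_nonempty by (auto simp: Proj_eq_image)
  fix A B assume "closedin (zariski {..k}) A \<and> closedin (zariski {..k}) B \<and> Proj {..k} = A \<union> B"
  then have "openin (zariski {..k}) (Proj {..k} - A)" "openin (zariski {..k}) (Proj {..k} - B)"
    "Proj {..k} = A \<union> B" by (auto simp: closedin_def topspace_zariski)
  with openin_zariski_meet[OF this(1,2)] show "Proj {..k} = A \<or> Proj {..k} = B" by blast
qed

text \<open>Homogeneous coordinates \<open>G\<close> for \<open>g\<close> around a point of \<open>A\<close>. All components, also those beyond \<open>l\<close>, are
  forms of the same degree, so that \<open>G\<close> can be substituted into forms without side conditions.\<close>

definition represents ::
  "nat \<Rightarrow> nat \<Rightarrow> nat point set \<Rightarrow> (nat point \<Rightarrow> nat point) \<Rightarrow> (nat \<Rightarrow> complex) \<Rightarrow> nat \<Rightarrow>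
   (nat \<Rightarrow> (nat \<Rightarrow> complex) \<Rightarrow> complex) \<Rightarrow> bool" where
  "represents k l A g v0 e G \<longleftrightarrow> (\<forall>j. homog k e (G j)) \<and>
     near k v0 (\<lambda>v. pt v \<in> A \<longrightarrow> (\<lambda>j. G j v) \<in> vecs l \<and> g (pt v) = pt (\<lambda>j. G j v))"

lemma morphism_represents:
  assumes "morphism {..k} {..l} A g" "pt v0 \<in> A"
  obtains e G where "represents k l A g v0 e G"
proof -
  from assms obtain W e G where W: "openin (zariski {..k}) W" "pt v0 \<in> W"
      "\<forall>j\<in>{..l}. G j \<in> forms {..k} e"
      "\<forall>y\<in>A \<inter> W. (\<exists>j\<in>{..l}. eval (G j) (rep y) \<noteq> 0) \<and> g y = form_map {..l} G y"
    unfolding morphism_def by - (drule (1) bspec; elim exE conjE; rule that; assumption)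
  let ?G = "\<lambda>j v. if j \<le> l then eval (G j) v else 0"
  have hG: "homog k e (?G j)" for j
    using W(3) homog_eval homog_zero by (cases "j \<le> l") auto
  have "near k v0 (\<lambda>v. pt v \<in> A \<longrightarrow> (\<lambda>j. ?G j v) \<in> vecs l \<and> g (pt v) = pt (\<lambda>j. ?G j v))"
    using openin_zariski_near[OF W(1,2)]
  proof (rule near_mono, intro impI)
    fix v assume v: "pt v \<in> W" "pt v \<in> A"
    then have W': "\<exists>j\<in>{..l}. eval (G j) (rep (pt v)) \<noteq> 0" "g (pt v) = form_map {..l} G (pt v)"
      using W(4) by blast+
    obtain c where c: "c \<noteq> 0" "rep (pt v) = (\<lambda>i. c * v i)" using rep_pt by blast
    have *: "?G j (rep (pt v)) = c ^ e * ?G j v" for j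
      unfolding c(2) by (rule homog_scale[OF hG])
    obtain j where "j \<le> l" "eval (G j) (rep (pt v)) \<noteq> 0" using W'(1) by auto
    then have "\<exists>j\<le>l. ?G j v \<noteq> 0"
      using *[of j] by (intro exI[of _ j]) auto
    then have 1: "(\<lambda>j. ?G j v) \<in> vecs l" by (auto simp: vecs_def)
    have "g (pt v) = pt (\<lambda>j. ?G j (rep (pt v)))"
      unfolding W'(2) form_map_def by simp
    also have "\<dots> = pt (\<lambda>j. ?G j v)"
      unfolding * using c(1) by (intro pt_scale) simp
    finally show "(\<lambda>j. ?G j v) \<in> vecs l \<and> g (pt v) = pt (\<lambda>j. ?G j v)"
      using 1 by blast
  qed
  then have "represents k l A g v0 e ?G" using hG by (simp add: represents_def)
  then show thesis by (rule that)
qed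

lemma regular_unit_represents:
  assumes "regular_unit {..k} A \<phi>" "pt v0 \<in> A"
  obtains e p q where "homog k e p" "homog k e q"
    "near k v0 (\<lambda>v. pt v \<in> A \<longrightarrow> p v \<noteq> 0 \<and> q v \<noteq> 0 \<and> \<phi> (pt v) = p v / q v)"
proof -
  from assms obtain W e p q where W: "openin (zariski {..k}) W" "pt v0 \<in> W"
      "p \<in> forms {..k} e" "q \<in> forms {..k} e"
      "\<forall>y\<in>A \<inter> W. eval q (rep y) \<noteq> 0 \<and> \<phi> y = eval p (rep y) / eval q (rep y)"
    unfolding regular_unit_def regular_fun_def
    by - (elim conjE; drule (1) bspec; elim exE conjE; rule that; assumption)
  note h = homog_eval[OF W(3)] homog_eval[OF W(4)]
  show thesis
  proof (rule that[OF h], rule near_mono[OF openin_zariski_near[OF W(1,2)]], rule impI)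
    fix v assume v: "pt v \<in> W" "pt v \<in> A"
    then have W': "eval q (rep (pt v)) \<noteq> 0" "\<phi> (pt v) = eval p (rep (pt v)) / eval q (rep (pt v))"
      using W(5) by blast+
    moreover have "\<phi> (pt v) \<noteq> 0" using assms(1) v(2) by (auto simp: regular_unit_def)
    ultimately show "eval p v \<noteq> 0 \<and> eval q v \<noteq> 0 \<and> \<phi> (pt v) = eval p v / eval q v"
      using homog_rep_eq_0[OF h(2)] homog_rep_ratio[OF h] by auto
  qed
qed

lemma regular_unit_ratio:
  assumes "homog k e p" "homog k e q" "A \<subseteq> Proj {..k}"
    "\<And>x. x \<in> A \<Longrightarrow> p (rep x) \<noteq> 0 \<and> q (rep x) \<noteq> 0 \<and> \<phi> x = p (rep x) / q (rep x)"
  shows "regular_unit {..k} A \<phi>"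
proof -
  obtain P Q where "P \<in> forms {..k} e" "p = eval P" "Q \<in> forms {..k} e" "q = eval Q"
    using homog_imp_form assms(1,2) by metis
  then have "regular_fun {..k} A \<phi>"
    unfolding regular_fun_def using assms(3,4) openin_Proj by blast
  then show ?thesis using assms(4) by (auto simp: regular_unit_def)
qed

section \<open>Minima along discs and linear systems\<close>

text \<open>Orthogonal splitting of a curve \<open>A\<close> along its value \<open>A 0\<close>: the component along \<open>A 0\<close> has the
  holomorphic coefficient \<open>\<alpha>\<close>, and the square \<open>R\<close> of the other component is, to second order, the
  squared norm of the part of the derivative orthogonal to \<open>A 0\<close>.\<close>

lemma split_along_value:
  fixes A :: "nat \<Rightarrow> complex \<Rightarrow> complex"
  assumes fin: "finite I" and nz: "\<exists>i\<in>I. A i 0 \<noteq> 0"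
    and hol: "\<And>i. i \<in> I \<Longrightarrow> A i holomorphic_on UNIV"
    and der: "\<And>i. i \<in> I \<Longrightarrow> (A i has_field_derivative a i) (at 0)"
  obtains \<alpha> \<rho> R where "\<alpha> holomorphic_on UNIV" "\<alpha> 0 = 1"
    "complex_of_real (\<Sum>i\<in>I. (cmod (A i 0))\<^sup>2) * \<rho> = (\<Sum>i\<in>I. cnj (A i 0) * a i)"
    "\<And>t. (\<Sum>i\<in>I. (cmod (A i t))\<^sup>2) = (\<Sum>i\<in>I. (cmod (A i 0))\<^sup>2) * (cmod (\<alpha> t))\<^sup>2 + R t"
    "\<And>t. R t \<ge> 0"
    "((\<lambda>t. R t / (cmod t)\<^sup>2) \<longlongrightarrow> (\<Sum>i\<in>I. (cmod (a i - \<rho> * A i 0))\<^sup>2)) (at 0)"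
proof -
  define N where "N = (\<Sum>i\<in>I. (cmod (A i 0))\<^sup>2)"
  define \<alpha> where "\<alpha> t = (\<Sum>i\<in>I. cnj (A i 0) * A i t) / N" for t
  define \<rho> where "\<rho> = (\<Sum>i\<in>I. cnj (A i 0) * a i) / N"
  define E where "E i t = A i t - \<alpha> t * A i 0" for i t
  define R where "R t = (\<Sum>i\<in>I. (cmod (E i t))\<^sup>2)" for t
  have N: "N > 0"
    using nz fin unfolding N_def by (auto intro!: sum_pos2)
  have cN: "complex_of_real N = (\<Sum>i\<in>I. cnj (A i 0) * A i 0)"
    unfolding N_def of_real_sum
    by (rule sum.cong) (auto simp: complex_norm_square algebra_simps simp flip: of_real_power)
  have \<alpha>0: "\<alpha> 0 = 1" using N by (simp add: \<alpha>_def cN[symmetric])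
  have orth: "(\<Sum>i\<in>I. cnj (A i 0) * E i t) = 0" for t
  proof -
    have "(\<Sum>i\<in>I. cnj (A i 0) * E i t) = (\<Sum>i\<in>I. cnj (A i 0) * A i t) - \<alpha> t * N"
      by (simp add: E_def cN algebra_simps sum_subtractf sum_distrib_left)
    then show ?thesis using N by (simp add: \<alpha>_def)
  qed
  \<comment> \<open>Pythagoras for the components along and orthogonal to the value at the centre.\<close>
  have dec: "(\<Sum>i\<in>I. (cmod (A i t))\<^sup>2) = N * (cmod (\<alpha> t))\<^sup>2 + R t" for t
  proof -
    have *: "(cmod (A i t))\<^sup>2 = (cmod (\<alpha> t))\<^sup>2 * (cmod (A i 0))\<^sup>2 + (cmod (E i t))\<^sup>2
        + 2 * Re (cnj (\<alpha> t) * (cnj (A i 0) * E i t))" for i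
    proof -
      have "A i t = \<alpha> t * A i 0 + E i t" by (simp add: E_def)
      then have "(cmod (A i t))\<^sup>2 = (cmod (\<alpha> t * A i 0 + E i t))\<^sup>2" by simp
      also have "\<dots> = (cmod (\<alpha> t * A i 0))\<^sup>2 + (cmod (E i t))\<^sup>2 + 2 * Re (cnj (\<alpha> t * A i 0) * E i t)"
        by (simp add: cmod_power2) (simp add: power2_eq_square algebra_simps)
      finally show ?thesis by (simp add: norm_mult power_mult_distrib mult.assoc)
    qed
    have "(\<Sum>i\<in>I. (cmod (A i t))\<^sup>2) = (cmod (\<alpha> t))\<^sup>2 * N + R t
        + 2 * Re (cnj (\<alpha> t) * (\<Sum>i\<in>I. cnj (A i 0) * E i t))"
      unfolding * by (simp only: sum.distrib sum_distrib_left[symmetric] N_def R_def Re_sum[symmetric])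
    then show ?thesis unfolding orth by simp
  qed
  have E0: "E i 0 = 0" for i by (simp add: E_def \<alpha>0)
  have "(\<alpha> has_field_derivative \<rho>) (at 0)"
    unfolding \<alpha>_def[abs_def] \<rho>_def
    by (intro DERIV_cdivide DERIV_sum DERIV_cmult der)
  then have dE: "(E i has_field_derivative (a i - \<rho> * A i 0)) (at 0)" if "i \<in> I" for i
    unfolding E_def[abs_def] using der[OF that] by (auto intro!: derivative_eq_intros)
  have "((\<lambda>t. (cmod (E i t / t))\<^sup>2) \<longlongrightarrow> (cmod (a i - \<rho> * A i 0))\<^sup>2) (at 0)" if "i \<in> I" for i
    using dE[OF that] unfolding has_field_derivative_iff by (intro tendsto_intros) (simp add: E0)
  then have "((\<lambda>t. \<Sum>i\<in>I. (cmod (E i t / t))\<^sup>2) \<longlongrightarrow> (\<Sum>i\<in>I. (cmod (a i - \<rho> * A i 0))\<^sup>2)) (at 0)"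
    by (rule tendsto_sum)
  then have lim: "((\<lambda>t. R t / (cmod t)\<^sup>2) \<longlongrightarrow> (\<Sum>i\<in>I. (cmod (a i - \<rho> * A i 0))\<^sup>2)) (at 0)"
    by (simp add: R_def norm_divide power_divide sum_divide_distrib)
  have "\<alpha> holomorphic_on UNIV"
    unfolding \<alpha>_def[abs_def] using N by (intro holomorphic_intros hol) auto
  from this \<alpha>0 show thesis
  proof (rule that)
    show "complex_of_real (\<Sum>i\<in>I. (cmod (A i 0))\<^sup>2) * \<rho> = (\<Sum>i\<in>I. cnj (A i 0) * a i)"
      using N by (simp add: \<rho>_def flip: N_def)
    show "(\<Sum>i\<in>I. (cmod (A i t))\<^sup>2) = (\<Sum>i\<in>I. (cmod (A i 0))\<^sup>2) * (cmod (\<alpha> t))\<^sup>2 + R t" for t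
      by (rule dec[unfolded N_def])
    show "R t \<ge> 0" for t by (simp add: R_def sum_nonneg)
  qed (rule lim)
qed

text \<open>The one-variable core. Dividing \<open>\<parallel>A\<parallel>\<close> and \<open>\<parallel>B\<parallel>\<close> by the absolute values of their holomorphic
  coefficients \<open>\<alpha>\<close> and \<open>\<beta>\<close> leaves \<open>1 + o(\<bar>t\<bar>\<^sup>2)\<close> for \<open>A\<close>, whose derivative is parallel to its value, and
  at least \<open>1 + \<epsilon> \<bar>t\<bar>\<^sup>2\<close> for \<open>B\<close>. If the quotient had a minimum at the centre, the holomorphic function
  \<open>Q \<beta>\<^sup>q / (P \<alpha>)\<close> would have a strict maximum of its modulus there.\<close>

lemma no_minimum_on_disc:
  fixes A B :: "nat \<Rightarrow> complex \<Rightarrow> complex" and q :: nat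
  assumes fin: "finite I" "finite J" and q: "q \<ge> 1"
    and PQ: "P holomorphic_on UNIV" "Q holomorphic_on UNIV" "P 0 \<noteq> 0" "Q 0 \<noteq> 0"
    and A: "\<exists>i\<in>I. A i 0 \<noteq> 0" "\<And>i. i \<in> I \<Longrightarrow> A i holomorphic_on UNIV"
      "\<And>i. i \<in> I \<Longrightarrow> (A i has_field_derivative c * A i 0) (at 0)"
    and B: "\<exists>j\<in>J. B j 0 \<noteq> 0" "\<And>j. j \<in> J \<Longrightarrow> B j holomorphic_on UNIV"
      "\<And>j. j \<in> J \<Longrightarrow> (B j has_field_derivative b j) (at 0)"
      "\<And>\<mu>. \<exists>j\<in>J. b j \<noteq> \<mu> * B j 0"
    and min: "\<forall>\<^sub>F t in at 0.
       cmod (P 0 / Q 0) * L2_set (\<lambda>i. cmod (A i 0)) I / L2_set (\<lambda>j. cmod (B j 0)) J ^ q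
       \<le> cmod (P t / Q t) * L2_set (\<lambda>i. cmod (A i t)) I / L2_set (\<lambda>j. cmod (B j t)) J ^ q"
  shows False
proof -
  define nA where "nA t = L2_set (\<lambda>i. cmod (A i t)) I" for t
  define nB where "nB t = L2_set (\<lambda>j. cmod (B j t)) J" for t
  obtain \<alpha> \<rho> R where \<alpha>: "\<alpha> holomorphic_on UNIV" "\<alpha> 0 = 1"
    "complex_of_real (\<Sum>i\<in>I. (cmod (A i 0))\<^sup>2) * \<rho> = (\<Sum>i\<in>I. cnj (A i 0) * (c * A i 0))"
    "\<And>t. (\<Sum>i\<in>I. (cmod (A i t))\<^sup>2) = (\<Sum>i\<in>I. (cmod (A i 0))\<^sup>2) * (cmod (\<alpha> t))\<^sup>2 + R t"
    "\<And>t. R t \<ge> 0"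
    "((\<lambda>t. R t / (cmod t)\<^sup>2) \<longlongrightarrow> (\<Sum>i\<in>I. (cmod (c * A i 0 - \<rho> * A i 0))\<^sup>2)) (at 0)"
    by (rule split_along_value[OF fin(1) A]; (assumption | (rule that; assumption)))
  obtain \<beta> \<mu> S where \<beta>: "\<beta> holomorphic_on UNIV" "\<beta> 0 = 1"
    "complex_of_real (\<Sum>i\<in>J. (cmod (B i 0))\<^sup>2) * \<mu> = (\<Sum>i\<in>J. cnj (B i 0) * b i)"
    "\<And>t. (\<Sum>i\<in>J. (cmod (B i t))\<^sup>2) = (\<Sum>i\<in>J. (cmod (B i 0))\<^sup>2) * (cmod (\<beta> t))\<^sup>2 + S t"
    "\<And>t. S t \<ge> 0"
    "((\<lambda>t. S t / (cmod t)\<^sup>2) \<longlongrightarrow> (\<Sum>i\<in>J. (cmod (b i - \<mu> * B i 0))\<^sup>2)) (at 0)"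
    by (rule split_along_value[OF fin(2) B(1-3)]; (assumption | (rule that; assumption)))
  have nA: "(nA t)\<^sup>2 = (\<Sum>i\<in>I. (cmod (A i t))\<^sup>2)" and nB: "(nB t)\<^sup>2 = (\<Sum>i\<in>J. (cmod (B i t))\<^sup>2)" for t
    by (auto simp: nA_def nB_def L2_set_def sum_nonneg)
  have nA0: "nA 0 > 0" and nB0: "nB 0 > 0"
    using A(1) B(1) fin unfolding nA_def nB_def
    by (auto simp: less_le L2_set_nonneg L2_set_eq_0_iff)
  have sq: "(nA t)\<^sup>2 = (nA 0)\<^sup>2 * (cmod (\<alpha> t))\<^sup>2 + R t" "(nB t)\<^sup>2 = (nB 0)\<^sup>2 * (cmod (\<beta> t))\<^sup>2 + S t" for t
    unfolding nA nB by (rule \<alpha>(4), rule \<beta>(4))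
  have "complex_of_real ((nA 0)\<^sup>2) * \<rho> = complex_of_real ((nA 0)\<^sup>2) * c"
  proof -
    have "complex_of_real ((nA 0)\<^sup>2) * c = (\<Sum>i\<in>I. cnj (A i 0) * (c * A i 0))"
      unfolding nA of_real_sum sum_distrib_right
      by (rule sum.cong) (auto simp: complex_norm_square algebra_simps simp flip: of_real_power)
    then show ?thesis using \<alpha>(3) unfolding nA by simp
  qed
  \<comment> \<open>Since the derivative of the first curve is parallel to its value, its orthogonal part is zero.\<close>
  then have "\<rho> = c" using nA0 by simp
  then have R0: "((\<lambda>t. R t / (cmod t)\<^sup>2) \<longlongrightarrow> 0) (at 0)" using \<alpha>(6) by simp
  define m where "m = (\<Sum>i\<in>J. (cmod (b i - \<mu> * B i 0))\<^sup>2)"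
  have m: "m > 0"
    using B(4)[of \<mu>] fin(2) unfolding m_def by (auto intro!: sum_pos2)
  have cont: "isCont \<alpha> 0" "isCont \<beta> 0" "isCont P 0" "isCont Q 0"
    using \<alpha>(1) \<beta>(1) PQ holomorphic_on_imp_continuous_on continuous_on_eq_continuous_at by blast+
  have l\<alpha>: "(\<alpha> \<longlongrightarrow> 1) (at 0)" and l\<beta>: "(\<beta> \<longlongrightarrow> 1) (at 0)"
    using cont(1,2) \<alpha>(2) \<beta>(2) by (auto simp: isCont_def)
  have "((\<lambda>t. R t / (cmod t)\<^sup>2 / ((nA 0)\<^sup>2 * (cmod (\<alpha> t))\<^sup>2) - S t / (cmod t)\<^sup>2 / ((nB 0)\<^sup>2 * (cmod (\<beta> t))\<^sup>2))
      \<longlongrightarrow> 0 / ((nA 0)\<^sup>2 * (cmod 1)\<^sup>2) - m / ((nB 0)\<^sup>2 * (cmod 1)\<^sup>2)) (at 0)"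
    using nA0 nB0 by (intro tendsto_intros R0 \<beta>(6)[folded m_def] l\<alpha> l\<beta>) auto
  then have "\<forall>\<^sub>F t in at 0. R t / (cmod t)\<^sup>2 / ((nA 0)\<^sup>2 * (cmod (\<alpha> t))\<^sup>2)
      - S t / (cmod t)\<^sup>2 / ((nB 0)\<^sup>2 * (cmod (\<beta> t))\<^sup>2) < 0"
    by (rule order_tendstoD(2)) (use m nB0 in simp)
  moreover have "\<forall>\<^sub>F t in at 0. t \<noteq> (0::complex)"
    by (simp add: eventually_at_filter)
  moreover have "\<forall>\<^sub>F t in at 0. \<alpha> t \<noteq> 0" "\<forall>\<^sub>F t in at 0. \<beta> t \<noteq> 0"
    using l\<alpha> l\<beta> by (auto intro: tendsto_imp_eventually_ne)
  moreover have "\<forall>\<^sub>F t in at 0. P t \<noteq> 0" "\<forall>\<^sub>F t in at 0. Q t \<noteq> 0"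
    using cont(3,4) PQ(3,4) by (auto simp: isCont_def intro: tendsto_imp_eventually_ne)
  ultimately have "\<forall>\<^sub>F t in at 0. P t \<noteq> 0 \<and> \<alpha> t \<noteq> 0 \<and>
     cmod (Q t * \<beta> t ^ q / (P t * \<alpha> t)) < cmod (Q 0 * \<beta> 0 ^ q / (P 0 * \<alpha> 0))"
    using min
  proof eventually_elim
    case (elim t)
    \<comment> \<open>The normalized norms, both at least one; the inequality to be contradicted compares their sizes.\<close>
    define x where "x = nA t / (nA 0 * cmod (\<alpha> t))"
    define y where "y = nB t / (nB 0 * cmod (\<beta> t))"
    have pos: "cmod (\<alpha> t) > 0" "cmod (\<beta> t) > 0" "cmod (P t) > 0" "cmod (Q t) > 0" "(cmod t)\<^sup>2 > 0"
      using elim by auto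
    have x2: "x\<^sup>2 = 1 + R t / ((nA 0)\<^sup>2 * (cmod (\<alpha> t))\<^sup>2)"
      using pos nA0 by (simp add: x_def power_divide power_mult_distrib sq(1)[of t] field_simps)
    have y2: "y\<^sup>2 = 1 + S t / ((nB 0)\<^sup>2 * (cmod (\<beta> t))\<^sup>2)"
      using pos nB0 by (simp add: y_def power_divide power_mult_distrib sq(2)[of t] field_simps)
    have "R t / ((nA 0)\<^sup>2 * (cmod (\<alpha> t))\<^sup>2) / (cmod t)\<^sup>2 < S t / ((nB 0)\<^sup>2 * (cmod (\<beta> t))\<^sup>2) / (cmod t)\<^sup>2"
      using elim(1) by (simp add: mult.commute)
    then have "R t / ((nA 0)\<^sup>2 * (cmod (\<alpha> t))\<^sup>2) < S t / ((nB 0)\<^sup>2 * (cmod (\<beta> t))\<^sup>2)"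
      using pos(5) divide_less_cancel less_asym by blast
    then have "x\<^sup>2 < y\<^sup>2" unfolding x2 y2 by simp
    moreover have y0: "y \<ge> 0" using nB0 by (simp add: y_def nB_def L2_set_nonneg)
    ultimately have xy: "x < y" by (rule power_less_imp_less_base)
    have "1 \<le> y\<^sup>2" unfolding y2 using \<beta>(5) by simp
    then have "1 \<le> y" using power2_le_imp_le[of 1 y] y0 by simp
    then have "y \<le> y ^ q" using q by (intro self_le_power) auto
    with xy have xyq: "x < y ^ q" by simp
    have eA: "nA t = x * (nA 0 * cmod (\<alpha> t))" and eB: "nB t = y * (nB 0 * cmod (\<beta> t))"
      using nA0 nB0 pos by (auto simp: x_def y_def)
    have "cmod (P 0 / Q 0) * nA 0 / nB 0 ^ q \<le> cmod (P t / Q t) * nA t / nB t ^ q"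
      using elim(7) by (simp add: nA_def nB_def)
    also have "\<dots> = (cmod (P t / Q t) * cmod (\<alpha> t) / cmod (\<beta> t) ^ q) * (nA 0 / nB 0 ^ q) * (x / y ^ q)"
      unfolding eA eB by (simp add: power_mult_distrib mult_ac)
    also have "\<dots> < (cmod (P t / Q t) * cmod (\<alpha> t) / cmod (\<beta> t) ^ q) * (nA 0 / nB 0 ^ q) * 1"
      using pos nA0 nB0 xyq \<open>1 \<le> y\<close>
      by (intro mult_strict_left_mono mult_pos_pos divide_pos_pos zero_less_power) (auto simp: norm_divide)
    finally have "cmod (P 0 / Q 0) * (nA 0 / nB 0 ^ q)
       < (cmod (P t / Q t) * cmod (\<alpha> t) / cmod (\<beta> t) ^ q) * (nA 0 / nB 0 ^ q)" by simp
    moreover have "nA 0 / nB 0 ^ q > 0" using nA0 nB0 by simp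
    ultimately have "cmod (P 0) / cmod (Q 0) < cmod (P t) / cmod (Q t) * cmod (\<alpha> t) / cmod (\<beta> t) ^ q"
      by (simp only: mult_less_cancel_right_pos norm_divide)
    then have "cmod (Q t) * cmod (\<beta> t) ^ q / (cmod (P t) * cmod (\<alpha> t)) < cmod (Q 0) / cmod (P 0)"
      using pos PQ(3,4) by (simp add: field_simps)
    then show ?case using elim \<alpha>(2) \<beta>(2) by (simp add: norm_divide norm_mult norm_power)
  qed
  then obtain r where r: "r > 0" "\<And>t. t \<noteq> 0 \<Longrightarrow> dist t 0 < r \<Longrightarrow> P t \<noteq> 0 \<and> \<alpha> t \<noteq> 0 \<and>
     cmod (Q t * \<beta> t ^ q / (P t * \<alpha> t)) < cmod (Q 0 * \<beta> 0 ^ q / (P 0 * \<alpha> 0))"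
    unfolding eventually_at by auto
  define g where "g t = Q t * \<beta> t ^ q / (P t * \<alpha> t)" for t
  have nz: "P t \<noteq> 0 \<and> \<alpha> t \<noteq> 0" if "t \<in> ball 0 r" for t
    using r(2)[of t] that PQ(3) \<alpha>(2) by (cases "t = 0") (auto simp: dist_commute)
  have "g holomorphic_on ball 0 r"
    unfolding g_def[abs_def] using nz \<alpha>(1) \<beta>(1) PQ(1,2)
    by (intro holomorphic_intros) (auto elim: holomorphic_on_subset)
  then have "g constant_on ball 0 r"
  proof (rule maximum_modulus_principle[where U = "ball 0 r" and \<xi> = 0])
    fix z assume "z \<in> ball (0::complex) r"
    then show "cmod (g z) \<le> cmod (g 0)"
      using r(2)[of z] by (cases "z = 0") (auto simp: g_def dist_commute less_imp_le)
  qed (use r(1) in auto)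
  then have "g (complex_of_real (r / 2)) = g 0"
    using r(1) unfolding constant_on_def by (auto simp: dist_norm)
  moreover have "cmod (g (complex_of_real (r / 2))) < cmod (g 0)"
    using r(1) r(2)[of "complex_of_real (r / 2)"] by (simp add: g_def)
  ultimately show False by simp
qed

text \<open>Two solutions of the first \<open>n\<close> equations, the second one vanishing at an index where the first does
  not, are independent, and a combination of them solves one more equation.\<close>

lemma homogeneous_system:
  fixes a :: "nat \<Rightarrow> 'a \<Rightarrow> complex"
  assumes "finite J" "n < card J"
  shows "\<exists>x. (\<exists>j\<in>J. x j \<noteq> 0) \<and> (\<forall>j. j \<notin> J \<longrightarrow> x j = 0) \<and> (\<forall>i<n. (\<Sum>j\<in>J. a i j * x j) = 0)"
  using assms
proof (induction n arbitrary: J)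
  case 0
  then obtain j where "j \<in> J" by (metis card.empty all_not_in_conv less_irrefl)
  then show ?case by (intro exI[of _ "\<lambda>i. if i = j then 1 else 0"]) auto
next
  case (Suc n)
  then obtain x where x: "\<exists>j\<in>J. x j \<noteq> 0" "\<forall>j. j \<notin> J \<longrightarrow> x j = 0" "\<forall>i<n. (\<Sum>j\<in>J. a i j * x j) = 0"
    using Suc.IH[OF Suc.prems(1) Suc_lessD[OF Suc.prems(2)]] by blast
  then obtain p where p: "p \<in> J" "x p \<noteq> 0" by blast
  have "finite (J - {p})" "n < card (J - {p})" using Suc.prems p by simp_all
  then obtain y where y: "\<exists>j\<in>J - {p}. y j \<noteq> 0" "\<forall>j. j \<notin> J - {p} \<longrightarrow> y j = 0"
      "\<forall>i<n. (\<Sum>j\<in>J - {p}. a i j * y j) = 0"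
    using Suc.IH[of "J - {p}"] by blast
  have yJ: "(\<Sum>j\<in>J. a i j * y j) = (\<Sum>j\<in>J - {p}. a i j * y j)" for i
    using p y(2) Suc.prems(1) by (simp add: sum.remove)
  define s where "s = (\<Sum>j\<in>J. a n j * x j)"
  define t where "t = (\<Sum>j\<in>J. a n j * y j)"
  show ?case
  proof (cases "t = 0")
    case True
    then show ?thesis using y yJ by (intro exI[of _ y]) (auto simp: less_Suc_eq t_def)
  next
    case False
    have lin: "(\<Sum>j\<in>J. a i j * (t * x j - s * y j))
        = t * (\<Sum>j\<in>J. a i j * x j) - s * (\<Sum>j\<in>J. a i j * y j)" for i
      by (simp add: sum_distrib_left sum_subtractf algebra_simps)
    have "y p = 0" using y(2) by blast
    then have "\<exists>j\<in>J. t * x j - s * y j \<noteq> 0" using p False by (intro bexI[of _ p]) auto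
    moreover have "\<forall>i<Suc n. (\<Sum>j\<in>J. a i j * (t * x j - s * y j)) = 0"
      unfolding lin using x(3) y(3) yJ by (auto simp: less_Suc_eq s_def t_def)
    moreover have "\<forall>j. j \<notin> J \<longrightarrow> t * x j - s * y j = 0" using x(2) y(2) by simp
    ultimately show ?thesis by (intro exI[of _ "\<lambda>j. t * x j - s * y j"]) blast
  qed
qed

section \<open>Minima of quotients of metrics, and common zeros of forms\<close>

text \<open>The type \<open>nat \<Rightarrow> complex\<close> carries the product topology.\<close>

lemma tendsto_fun_iff:
  fixes g :: "'a \<Rightarrow> nat \<Rightarrow> complex"
  shows "(g \<longlongrightarrow> l) F \<longleftrightarrow> (\<forall>i. ((\<lambda>x. g x i) \<longlongrightarrow> l i) F)"
proof -
  have "(g \<longlongrightarrow> l) F \<longleftrightarrow> limitin (product_topology (\<lambda>i. euclidean) UNIV) g l F"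
    by (simp only: euclidean_product_topology limitin_canonical_iff)
  also have "\<dots> \<longleftrightarrow> (\<forall>i. ((\<lambda>x. g x i) \<longlongrightarrow> l i) F)"
    unfolding limitin_componentwise by simp
  finally show ?thesis .
qed

lemma line_tendsto: "((\<lambda>t i. v i + t * w i) \<longlongrightarrow> (v :: nat \<Rightarrow> complex)) (at 0)"
proof -
  have "((\<lambda>t. v i + t * w i) \<longlongrightarrow> v i + 0 * w i) (at 0)" for i
    by (intro tendsto_intros)
  then show ?thesis unfolding tendsto_fun_iff by simp
qed

definition unit_sphere :: "nat \<Rightarrow> (nat \<Rightarrow> complex) set" where
  "unit_sphere k = {v. (\<forall>i. i \<notin> {..k} \<longrightarrow> v i = 0) \<and> (\<Sum>i\<le>k. (cmod (v i))\<^sup>2) = 1}"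

lemma compact_unit_sphere: "compact (unit_sphere k)"
proof -
  let ?S = "\<lambda>i. if i \<le> k then cball (0::complex) 1 else {0}"
  have "compactin (product_topology (\<lambda>i. euclidean) UNIV) (PiE UNIV ?S)"
    unfolding compactin_PiE by auto
  then have "compact (PiE UNIV ?S)"
    by (simp only: euclidean_product_topology compactin_euclidean_iff)
  moreover have "closed {v :: nat \<Rightarrow> complex. (\<Sum>i\<le>k. (cmod (v i))\<^sup>2) = 1}"
    by (intro closed_Collect_eq continuous_intros continuous_on_product_coordinates)
  ultimately have "compact (PiE UNIV ?S \<inter> {v. (\<Sum>i\<le>k. (cmod (v i))\<^sup>2) = 1})"
    by (rule compact_Int_closed)
  moreover have "unit_sphere k = PiE UNIV ?S \<inter> {v. (\<Sum>i\<le>k. (cmod (v i))\<^sup>2) = 1}"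
  proof (intro subset_antisym subsetI IntI)
    fix v assume v: "v \<in> unit_sphere k"
    have "cmod (v i) \<le> 1" if "i \<le> k" for i
    proof -
      have "(cmod (v i))\<^sup>2 \<le> (\<Sum>i\<le>k. (cmod (v i))\<^sup>2)"
        using that by (intro member_le_sum) auto
      then show ?thesis using v power2_le_imp_le[of "cmod (v i)" 1] by (simp add: unit_sphere_def)
    qed
    then show "v \<in> PiE UNIV ?S" using v by (auto simp: unit_sphere_def)
    show "v \<in> {v. (\<Sum>i\<le>k. (cmod (v i))\<^sup>2) = 1}" using v by (simp add: unit_sphere_def)
  next
    fix v assume v: "v \<in> PiE UNIV ?S \<inter> {v. (\<Sum>i\<le>k. (cmod (v i))\<^sup>2) = 1}"
    then have vi: "v i \<in> ?S i" for i using PiE_mem[of v UNIV ?S i] by blast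
    have "v i = 0" if "\<not> i \<le> k" for i using vi[of i] that by simp
    then show "v \<in> unit_sphere k" using v by (simp add: unit_sphere_def)
  qed
  ultimately show ?thesis by simp
qed

lemma unit_sphere_subset: "unit_sphere k \<subseteq> vecs k"
proof
  fix v assume v: "v \<in> unit_sphere k"
  then have "\<exists>i\<in>{..k}. v i \<noteq> 0"
    by (rule_tac ccontr) (simp add: unit_sphere_def)
  then show "v \<in> vecs k" using v by (auto simp: unit_sphere_def vecs_def)
qed

lemma normalize:
  assumes "v \<in> vecs k"
  obtains c where "c > 0" "(\<lambda>i. complex_of_real c * v i) \<in> unit_sphere k"
proof -
  define N where "N = (\<Sum>i\<le>k. (cmod (v i))\<^sup>2)"
  have N: "N > 0" using assms unfolding N_def vecs_def by (auto intro!: sum_pos2)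
  have "(\<Sum>i\<le>k. (cmod (complex_of_real (1 / sqrt N) * v i))\<^sup>2) = (1 / sqrt N)\<^sup>2 * N"
    using N by (simp add: N_def norm_mult norm_divide power_mult_distrib power_divide sum_distrib_left sum_divide_distrib)
  also have "\<dots> = 1" using N by (simp add: power_divide)
  finally show thesis using N assms
    by (intro that[of "1 / sqrt N"]) (auto simp: unit_sphere_def vecs_def)
qed

text \<open>Around \<open>v0\<close>, the function \<open>\<Phi>\<close> on projective space is \<open>\<bar>P / Q\<bar> \<parallel>A\<parallel> / \<parallel>B\<parallel>\<^sup>q\<close> for forms that do not
  vanish at \<open>v0\<close>; for \<open>A\<close> and \<open>B\<close> this means that some component does not vanish.\<close>

definition metric_quotient_at ::
  "nat \<Rightarrow> nat \<Rightarrow> (nat point \<Rightarrow> real) \<Rightarrow> (nat \<Rightarrow> complex) \<Rightarrow> ((nat \<Rightarrow> complex) \<Rightarrow> complex) \<Rightarrow>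
   ((nat \<Rightarrow> complex) \<Rightarrow> complex) \<Rightarrow> nat set \<Rightarrow> (nat \<Rightarrow> (nat \<Rightarrow> complex) \<Rightarrow> complex) \<Rightarrow>
   nat set \<Rightarrow> (nat \<Rightarrow> (nat \<Rightarrow> complex) \<Rightarrow> complex) \<Rightarrow> bool" where
  "metric_quotient_at k q \<Phi> v0 P Q I A J B \<longleftrightarrow> finite I \<and> finite J \<and>
     (\<exists>d. homog k d P) \<and> (\<exists>d. homog k d Q) \<and> (\<forall>i\<in>I. \<exists>d. homog k d (A i)) \<and> (\<forall>j\<in>J. \<exists>d. homog k d (B j)) \<and>
     P v0 \<noteq> 0 \<and> Q v0 \<noteq> 0 \<and> (\<exists>i\<in>I. A i v0 \<noteq> 0) \<and> (\<exists>j\<in>J. B j v0 \<noteq> 0) \<and>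
     near k v0 (\<lambda>v. \<Phi> (pt v) =
       cmod (P v / Q v) * L2_set (\<lambda>i. cmod (A i v)) I / L2_set (\<lambda>j. cmod (B j v)) J ^ q)"

lemma metric_quotient_tendsto:
  assumes m: "metric_quotient_at k q \<Phi> v0 P Q I A J B" and v0: "v0 \<in> vecs k"
    and c: "(c \<longlongrightarrow> v0) F" "\<forall>\<^sub>F x in F. c x \<in> vecs k"
  shows "((\<lambda>x. \<Phi> (pt (c x))) \<longlongrightarrow> \<Phi> (pt v0)) F"
    and "\<forall>\<^sub>F x in F. \<Phi> (pt (c x)) =
      cmod (P (c x) / Q (c x)) * L2_set (\<lambda>i. cmod (A i (c x))) I / L2_set (\<lambda>j. cmod (B j (c x))) J ^ q"
proof -
  let ?E = "\<lambda>v. cmod (P v / Q v) * L2_set (\<lambda>i. cmod (A i v)) I / L2_set (\<lambda>j. cmod (B j v)) J ^ q"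
  have fin: "finite I" "finite J" and Q0: "Q v0 \<noteq> 0" and B0: "\<exists>j\<in>J. B j v0 \<noteq> 0"
    and h: "\<exists>d. homog k d P" "\<exists>d. homog k d Q" "\<And>i. i \<in> I \<Longrightarrow> \<exists>d. homog k d (A i)" "\<And>j. j \<in> J \<Longrightarrow> \<exists>d. homog k d (B j)"
    using m unfolding metric_quotient_at_def by blast+
  have nr: "near k v0 (\<lambda>v. \<Phi> (pt v) = ?E v)" using m unfolding metric_quotient_at_def by simp
  then show ev: "\<forall>\<^sub>F x in F. \<Phi> (pt (c x)) = ?E (c x)"
    using c by (rule near_eventually)
  have lim: "((\<lambda>x. P (c x)) \<longlongrightarrow> P v0) F" "((\<lambda>x. Q (c x)) \<longlongrightarrow> Q v0) F"
    using h(1,2) homog_tendsto[OF _ c(1)] by blast+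
  have limA: "((\<lambda>x. A i (c x)) \<longlongrightarrow> A i v0) F" if "i \<in> I" for i
    using h(3)[OF that] homog_tendsto[OF _ c(1)] by blast
  have limB: "((\<lambda>x. B j (c x)) \<longlongrightarrow> B j v0) F" if "j \<in> J" for j
    using h(4)[OF that] homog_tendsto[OF _ c(1)] by blast
  have "((\<lambda>x. L2_set (\<lambda>i. cmod (A i (c x))) I) \<longlongrightarrow> L2_set (\<lambda>i. cmod (A i v0)) I) F"
    unfolding L2_set_def by (intro tendsto_intros limA)
  moreover have "((\<lambda>x. L2_set (\<lambda>j. cmod (B j (c x))) J) \<longlongrightarrow> L2_set (\<lambda>j. cmod (B j v0)) J) F"
    unfolding L2_set_def by (intro tendsto_intros limB)
  moreover have "L2_set (\<lambda>j. cmod (B j v0)) J ^ q \<noteq> 0"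
    using B0 fin(2) by (simp add: L2_set_eq_0_iff)
  ultimately have "((\<lambda>x. ?E (c x)) \<longlongrightarrow> ?E v0) F"
    using Q0 by (intro tendsto_divide tendsto_mult tendsto_norm tendsto_power lim)
  moreover have "\<Phi> (pt v0) = ?E v0" using near_self[OF nr v0] .
  ultimately show "((\<lambda>x. \<Phi> (pt (c x))) \<longlongrightarrow> \<Phi> (pt v0)) F"
    using tendsto_cong[OF ev] by simp
qed

lemma metric_quotient_minimum:
  assumes "\<And>v. v \<in> vecs k \<Longrightarrow> \<exists>P Q I A J B. metric_quotient_at k q \<Phi> v P Q I A J B"
  obtains v0 where "v0 \<in> vecs k" "\<And>v. v \<in> vecs k \<Longrightarrow> \<Phi> (pt v0) \<le> \<Phi> (pt v)"
proof -
  have "continuous_on (unit_sphere k) (\<lambda>v. \<Phi> (pt v))"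
    unfolding continuous_on_def
  proof
    fix v assume v: "v \<in> unit_sphere k"
    then have v': "v \<in> vecs k" using unit_sphere_subset by blast
    then obtain P Q I A J B where m: "metric_quotient_at k q \<Phi> v P Q I A J B"
      using assms by blast
    show "((\<lambda>v. \<Phi> (pt v)) \<longlongrightarrow> \<Phi> (pt v)) (at v within unit_sphere k)"
      by (rule metric_quotient_tendsto(1)[OF m v'])
        (use unit_sphere_subset[of k] in
          \<open>auto simp: eventually_at_filter tendsto_ident_at intro!: always_eventually\<close>)
  qed
  moreover have "unit_sphere k \<noteq> {}"
    using normalize[OF vecs_nonempty] by blast
  ultimately obtain v0 where v0: "v0 \<in> unit_sphere k" "\<forall>v\<in>unit_sphere k. \<Phi> (pt v0) \<le> \<Phi> (pt v)"
    using continuous_attains_inf[OF compact_unit_sphere] by blast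
  show thesis
  proof (rule that)
    show "v0 \<in> vecs k" using v0 unit_sphere_subset by blast
    fix v assume "v \<in> vecs k"
    then obtain c where "c > 0" "(\<lambda>i. complex_of_real c * v i) \<in> unit_sphere k"
      by (rule normalize)
    with v0(2) show "\<Phi> (pt v0) \<le> \<Phi> (pt v)" using pt_scale[of "complex_of_real c" v] by force
  qed
qed

lemma line_in_vecs:
  assumes "v0 \<in> vecs k" "\<forall>i. i \<notin> {..k} \<longrightarrow> w i = 0"
  shows "\<forall>\<^sub>F t in at 0. (\<lambda>i. v0 i + t * w i) \<in> vecs k"
proof -
  obtain j where j: "j \<le> k" "v0 j \<noteq> 0" using assms(1) by (auto simp: vecs_def)
  have "\<forall>\<^sub>F t in at 0. v0 j + t * w j \<noteq> 0"
    using line_tendsto[of v0 w] j(2) unfolding tendsto_fun_iff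
    by (auto intro: tendsto_imp_eventually_ne)
  then show ?thesis
    by eventually_elim (use assms j in \<open>auto simp: vecs_def\<close>)
qed

text \<open>The direction \<open>w\<close> is one in which the point with coordinates \<open>A\<close> stays fixed to first order and the
  point with coordinates \<open>B\<close> moves.\<close>

lemma metric_quotient_no_minimum:
  assumes m: "metric_quotient_at k q \<Phi> v0 P Q I A J B" and q: "q \<ge> 1" and v0: "v0 \<in> vecs k"
    and min: "\<And>v. v \<in> vecs k \<Longrightarrow> \<Phi> (pt v0) \<le> \<Phi> (pt v)"
    and w: "\<forall>i. i \<notin> {..k} \<longrightarrow> w i = 0"
    and A: "\<And>i. i \<in> I \<Longrightarrow> ((\<lambda>t. A i (\<lambda>l. v0 l + t * w l)) has_field_derivative c * A i v0) (at 0)"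
    and B: "\<And>j. j \<in> J \<Longrightarrow> ((\<lambda>t. B j (\<lambda>l. v0 l + t * w l)) has_field_derivative b j) (at 0)"
      "\<And>\<mu>. \<exists>j\<in>J. b j \<noteq> \<mu> * B j v0"
  shows False
proof -
  let ?l = "\<lambda>t i. v0 i + t * w i"
  let ?E = "\<lambda>v. cmod (P v / Q v) * L2_set (\<lambda>i. cmod (A i v)) I / L2_set (\<lambda>j. cmod (B j v)) J ^ q"
  have l0: "?l 0 = v0" by simp
  have fin: "finite I" "finite J" and nz: "P v0 \<noteq> 0" "Q v0 \<noteq> 0" "\<exists>i\<in>I. A i v0 \<noteq> 0" "\<exists>j\<in>J. B j v0 \<noteq> 0"
    and h: "\<exists>d. homog k d P" "\<exists>d. homog k d Q" "\<And>i. i \<in> I \<Longrightarrow> \<exists>d. homog k d (A i)" "\<And>j. j \<in> J \<Longrightarrow> \<exists>d. homog k d (B j)"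
    using m unfolding metric_quotient_at_def by blast+
  note lv = line_in_vecs[OF v0 w]
  have ev\<Phi>: "\<forall>\<^sub>F t in at 0. \<Phi> (pt (?l t)) = ?E (?l t)"
    by (rule metric_quotient_tendsto(2)[OF m v0 line_tendsto lv])
  have \<Phi>0: "\<Phi> (pt v0) = ?E v0"
    using m near_self[OF _ v0] unfolding metric_quotient_at_def by fast
  have ev: "\<forall>\<^sub>F t in at 0. ?E (?l 0) \<le> ?E (?l t)"
    using ev\<Phi> lv unfolding l0
  proof eventually_elim
    case (elim t)
    then show ?case using min[OF elim(2)] \<Phi>0 by simp
  qed
  show False
  proof (rule no_minimum_on_disc[where P = "\<lambda>t. P (?l t)" and Q = "\<lambda>t. Q (?l t)" and
        A = "\<lambda>i t. A i (?l t)" and B = "\<lambda>j t. B j (?l t)" and c = c and b = b, OF fin q])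
    show "(\<lambda>t. P (?l t)) holomorphic_on UNIV" "(\<lambda>t. Q (?l t)) holomorphic_on UNIV"
      using h(1,2) homog_line_holomorphic by blast+
    show "(\<lambda>t. A i (?l t)) holomorphic_on UNIV" if "i \<in> I" for i
      using h(3)[OF that] homog_line_holomorphic by blast
    show "(\<lambda>t. B j (?l t)) holomorphic_on UNIV" if "j \<in> J" for j
      using h(4)[OF that] homog_line_holomorphic by blast
    show "P (?l 0) \<noteq> 0" "Q (?l 0) \<noteq> 0" "\<exists>i\<in>I. A i (?l 0) \<noteq> 0" "\<exists>j\<in>J. B j (?l 0) \<noteq> 0"
      using nz by simp_all
    show "((\<lambda>t. A i (?l t)) has_field_derivative c * A i (?l 0)) (at 0)" if "i \<in> I" for i
      using A[OF that] by simp
    show "((\<lambda>t. B j (?l t)) has_field_derivative b j) (at 0)" if "j \<in> J" for j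
      using B(1)[OF that] .
    show "\<exists>j\<in>J. b j \<noteq> \<mu> * B j (?l 0)" for \<mu>
      using B(2)[of \<mu>] by simp
  qed (rule ev)
qed

text \<open>A linear map \<open>D\<close> with at most \<open>k\<close> rows maps some tangent direction at \<open>v\<close>, represented by a vector
  orthogonal to \<open>v\<close>, into the line spanned by \<open>g\<close>: there are \<open>k + 2\<close> unknowns, the entries of \<open>w\<close> and the
  factor \<open>c\<close>, and at most \<open>k + 1\<close> equations.\<close>

lemma tangent_system:
  fixes D :: "nat \<Rightarrow> nat \<Rightarrow> complex"
  assumes J: "finite J" "card J \<le> k" and g: "\<exists>i\<in>J. g i \<noteq> 0" and v: "v \<in> vecs k"
  obtains w c where "w \<in> vecs k" "(\<Sum>j\<le>k. cnj (v j) * w j) = 0" "\<And>i. i \<in> J \<Longrightarrow> (\<Sum>j\<le>k. D i j * w j) = c * g i"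
proof -
  obtain f where f: "bij_betw f {..<card J} J"
    using ex_bij_betw_nat_finite[OF J(1)] by (auto simp: atLeast0LessThan)
  define a where "a i j = (if i < card J then (if j \<le> k then D (f i) j else - g (f i))
    else if j \<le> k then cnj (v j) else 0)" for i j
  obtain x where x: "\<exists>j\<in>{..Suc k}. x j \<noteq> 0" "\<forall>i<Suc (card J). (\<Sum>j\<le>Suc k. a i j * x j) = 0"
    using homogeneous_system[of "{..Suc k}" "Suc (card J)" a] J(2) by auto
  \<comment> \<open>The last unknown is the factor of proportionality. If the others vanished, it would vanish too.\<close>
  define w where "w j = (if j \<le> k then x j else 0)" for j
  have s: "(\<Sum>j\<le>k. D i j * w j) = x (Suc k) * g i" if "i \<in> J" for i
  proof -
    have "i \<in> f ` {..<card J}" using f that by (simp add: bij_betw_def)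
    then obtain l where l: "l < card J" "f l = i" by blast
    then have "(\<Sum>j\<le>Suc k. a l j * x j) = 0" using x(2) by auto
    then show ?thesis using l by (simp add: a_def w_def algebra_simps)
  qed
  have "(\<Sum>j\<le>Suc k. a (card J) j * x j) = 0" using x(2) by blast
  then have o: "(\<Sum>j\<le>k. cnj (v j) * w j) = 0" by (simp add: a_def w_def)
  have "\<exists>j\<le>k. w j \<noteq> 0"
  proof (rule ccontr)
    assume "\<not> ?thesis"
    then have w0: "w j = 0" for j by (cases "j \<le> k") (auto simp: w_def)
    then have "x (Suc k) = 0" using g s by auto
    then show False using x(1) w0 by (metis atMost_iff le_Suc_eq w_def)
  qed
  then have "w \<in> vecs k" by (auto simp: vecs_def w_def)
  then show thesis using s o that by blast
qed

lemma orthogonal_not_multiple: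
  assumes "v \<in> vecs k" "w \<in> vecs k" "(\<Sum>j\<le>k. cnj (v j) * w j) = 0"
  shows "\<exists>j\<in>{..k}. w j \<noteq> \<mu> * v j"
proof (rule ccontr)
  assume "\<not> ?thesis"
  then have w: "\<forall>j\<le>k. w j = \<mu> * v j" by auto
  have "(\<Sum>j\<le>k. cnj (v j) * w j) = (\<Sum>j\<le>k. \<mu> * complex_of_real ((cmod (v j))\<^sup>2))"
    using w by (intro sum.cong) (auto simp: complex_norm_square simp flip: of_real_power)
  also have "\<dots> = \<mu> * complex_of_real (\<Sum>j\<le>k. (cmod (v j))\<^sup>2)"
    by (simp only: of_real_sum sum_distrib_left)
  finally have "\<mu> * complex_of_real (\<Sum>j\<le>k. (cmod (v j))\<^sup>2) = 0" using assms(3) by simp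
  moreover have "(\<Sum>j\<le>k. (cmod (v j))\<^sup>2) > 0"
    using assms(1) unfolding vecs_def by (auto intro!: sum_pos2)
  ultimately have "\<mu> = 0" by (metis less_irrefl mult_eq_0_iff of_real_eq_0_iff)
  then show False using w assms(2) by (auto simp: vecs_def)
qed

text \<open>Without a common zero the forms would define a map to a projective space of dimension at most
  \<open>k - 1\<close>, and \<open>\<parallel>G v\<parallel> / \<parallel>v\<parallel>\<^sup>d\<close> would be a metric quotient; at its minimum the map degenerates in some
  direction.\<close>

lemma forms_common_zero:
  fixes J :: "nat set"
  assumes d: "d \<ge> 1" and J: "finite J" "card J \<le> k" and G: "\<And>i. i \<in> J \<Longrightarrow> homog k d (G i)"
  shows "\<exists>v\<in>vecs k. \<forall>i\<in>J. G i v = 0"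
proof (rule ccontr)
  assume "\<not> ?thesis"
  then have nz: "\<exists>i\<in>J. G i v \<noteq> 0" if "v \<in> vecs k" for v using that by blast
  define \<Phi> where "\<Phi> x = L2_set (\<lambda>i. cmod (G i (rep x))) J / L2_set (\<lambda>j. cmod (rep x j)) {..k} ^ d" for x
  have \<Phi>: "\<Phi> (pt v) = L2_set (\<lambda>i. cmod (G i v)) J / L2_set (\<lambda>j. cmod (v j)) {..k} ^ d" for v
  proof -
    obtain c where c: "c \<noteq> 0" "rep (pt v) = (\<lambda>i. c * v i)" using rep_pt by blast
    have "L2_set (\<lambda>i. cmod (G i (rep (pt v)))) J = L2_set (\<lambda>i. cmod c ^ d * cmod (G i v)) J"
      unfolding c(2) by (rule L2_set_cong) (auto simp: homog_scale[OF G] norm_mult norm_power)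
    moreover have "L2_set (\<lambda>j. cmod (rep (pt v) j)) {..k} = L2_set (\<lambda>j. cmod c * cmod (v j)) {..k}"
      unfolding c(2) by (simp add: norm_mult)
    ultimately show ?thesis using c(1)
      by (simp add: \<Phi>_def power_mult_distrib flip: L2_set_right_distrib)
  qed
  have m: "metric_quotient_at k d \<Phi> v (\<lambda>v. 1) (\<lambda>v. 1) J G {..k} (\<lambda>j v. v j)" if "v \<in> vecs k" for v
    unfolding metric_quotient_at_def
    using G J nz[OF that] that homog_const[of k 1] homog_coord[of _ k]
    by (auto simp: \<Phi> near_def vecs_def intro!: exI[of _ "\<lambda>v. 1"])
  then obtain v0 where v0: "v0 \<in> vecs k" "\<And>v. v \<in> vecs k \<Longrightarrow> \<Phi> (pt v0) \<le> \<Phi> (pt v)"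
    using metric_quotient_minimum by blast
  have "\<forall>i\<in>J. \<exists>H. gradient k (G i) H" using G homog_gradient by metis
  then obtain H where H: "\<And>i. i \<in> J \<Longrightarrow> gradient k (G i) (H i)" by metis
  obtain w c where w: "w \<in> vecs k" "(\<Sum>j\<le>k. cnj (v0 j) * w j) = 0"
      "\<And>i. i \<in> J \<Longrightarrow> (\<Sum>j\<le>k. H i j v0 * w j) = c * G i v0"
    using tangent_system[OF J nz[OF v0(1)] v0(1), of "\<lambda>i j. H i j v0"] by metis
  show False
  proof (rule metric_quotient_no_minimum[OF m[OF v0(1)] d v0])
    show "\<forall>i. i \<notin> {..k} \<longrightarrow> w i = 0" using w(1) by (auto simp: vecs_def)
    show "((\<lambda>t. G i (\<lambda>l. v0 l + t * w l)) has_field_derivative c * G i v0) (at 0)" if "i \<in> J" for i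
      using gradient_line[OF H[OF that], of v0 w] w(3)[OF that] by simp
    show "((\<lambda>t. v0 j + t * w j) has_field_derivative w j) (at 0)" for j
      by (auto intro!: derivative_eq_intros)
    show "\<exists>j\<in>{..k}. w j \<noteq> \<mu> * v0 j" for \<mu>
      by (rule orthogonal_not_multiple[OF v0(1) w(1,2)])
  qed
qed

section \<open>Varieties containing a hypersurface\<close>

text \<open>The ideal of a set of points, as a property of functions on the cone.\<close>

definition vanishes :: "nat \<Rightarrow> nat point set \<Rightarrow> ((nat \<Rightarrow> complex) \<Rightarrow> complex) \<Rightarrow> bool" where
  "vanishes k Z f \<longleftrightarrow> (\<forall>v\<in>vecs k. pt v \<in> Z \<longrightarrow> f v = 0)"

lemma vanishes_mono: "vanishes k Z f \<Longrightarrow> X \<subseteq> Z \<Longrightarrow> vanishes k X f"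
  by (auto simp: vanishes_def)

text \<open>Up to the coordinates beyond \<open>k\<close>, the only other vector is zero, where a form of positive degree
  vanishes.\<close>

lemma homog_zero_on_vecs:
  assumes "homog k e f" "\<And>v. v \<in> vecs k \<Longrightarrow> f v = 0"
  shows "f = (\<lambda>v. 0)"
proof
  fix v :: "nat \<Rightarrow> complex"
  define w where "w i = (if i \<le> k then v i else 0)" for i
  have "f v = f w" by (rule homog_cong[OF assms(1)]) (simp add: w_def)
  moreover have "f w = 0"
  proof (cases "w \<in> vecs k")
    case False
    then have w0: "w = (\<lambda>i. 0)" by (force simp: w_def vecs_def)
    let ?u = "\<lambda>i. if i = 0 then 1 else (0::complex)"
    have "f (\<lambda>i. 0 * ?u i) = 0 ^ e * f ?u" by (rule homog_scale[OF assms(1)])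
    then show ?thesis using assms(2)[OF vecs_nonempty] w0 by simp
  qed (rule assms(2))
  ultimately show "f v = 0" by simp
qed

lemma homog_no_zero_divisors:
  assumes "homog k d f" "homog k e g" "\<And>v. v \<in> vecs k \<Longrightarrow> f v * g v = 0"
  shows "f = (\<lambda>v. 0) \<or> g = (\<lambda>v. 0)"
proof (rule ccontr)
  assume "\<not> ?thesis"
  then obtain v w where "v \<in> vecs k" "f v \<noteq> 0" "w \<in> vecs k" "g w \<noteq> 0"
    using homog_zero_on_vecs[OF assms(1)] homog_zero_on_vecs[OF assms(2)] by blast
  then obtain u where "u \<in> vecs k" "f u \<noteq> 0" "g u \<noteq> 0"
    using homog_common_nonzero[OF assms(1,2)] by blast
  then show False using assms(3) by fastforce
qed

lemma vanishes_prime: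
  assumes Z: "irreducible_variety {..k} Z" and f: "homog k d f" and g: "homog k e g"
    and fg: "vanishes k Z (\<lambda>v. f v * g v)"
  shows "vanishes k Z f \<or> vanishes k Z g"
proof -
  have cl: "closedin (zariski {..k}) Z" using Z by (simp add: irreducible_variety_def)
  then have ZP: "Z \<subseteq> Proj {..k}" using closedin_subset topspace_zariski by blast
  let ?A = "Z \<inter> {x \<in> Proj {..k}. f (rep x) = 0}" and ?B = "Z \<inter> {x \<in> Proj {..k}. g (rep x) = 0}"
  have "f (rep x) = 0 \<or> g (rep x) = 0" if "x \<in> Z" for x
    using fg rep_in_vecs[of x k] that ZP unfolding vanishes_def
    by (metis mult_eq_0_iff subsetD)
  then have "Z = ?A \<union> ?B" using ZP by blast
  moreover have "closedin (zariski {..k}) ?A" "closedin (zariski {..k}) ?B"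
    using cl closedin_zero_set f g by blast+
  ultimately have "Z = ?A \<or> Z = ?B" using Z unfolding irreducible_variety_def by blast
  moreover have "vanishes k Z f" if "Z = ?A"
    using that homog_rep_eq_0[OF f] unfolding vanishes_def by blast
  moreover have "vanishes k Z g" if "Z = ?B"
    using that homog_rep_eq_0[OF g] unfolding vanishes_def by blast
  ultimately show ?thesis by blast
qed

text \<open>A point \<open>a\<close> of the cone and a linear form \<open>lin\<close> with value \<open>1\<close> at \<open>a\<close>, which serves as coordinate
  along the fibres of the projection from \<open>a\<close>.\<close>

locale direction =
  fixes k :: nat and a :: "nat \<Rightarrow> complex" and lin :: "(nat \<Rightarrow> complex) \<Rightarrow> complex"
  assumes lin: "homog k 1 lin"
    and lin_shift: "\<And>v t. lin (\<lambda>i. v i + t * a i) = lin v + t"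
begin

text \<open>Forms pulled back by the projection from \<open>a\<close>: the coefficients of polynomials in \<open>lin\<close>.\<close>

definition coef :: "nat \<Rightarrow> ((nat \<Rightarrow> complex) \<Rightarrow> complex) \<Rightarrow> bool" where
  "coef e c \<longleftrightarrow> homog k e c \<and> (\<forall>v t. c (\<lambda>i. v i + t * a i) = c v)"

lemma coef_mult: "coef d b \<Longrightarrow> coef e c \<Longrightarrow> coef (d + e) (\<lambda>v. b v * c v)"
  by (simp add: coef_def homog_mult)

lemma coef_add: "coef e b \<Longrightarrow> coef e c \<Longrightarrow> coef e (\<lambda>v. b v + c v)"
  by (simp add: coef_def homog_add)

lemma coef_power: "coef e c \<Longrightarrow> coef (e * n) (\<lambda>v. c v ^ n)"
  by (simp add: coef_def homog_power)

text \<open>Forms of degree \<open>e\<close> that are polynomials of degree less than \<open>n\<close> in \<open>lin\<close>. The condition \<open>n \<le> e\<close>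
  keeps the truncated difference \<open>e - n\<close> from being mistaken for the degree of a coefficient;
  a coefficient that would have negative degree is zero.\<close>

fun deg_less :: "nat \<Rightarrow> nat \<Rightarrow> ((nat \<Rightarrow> complex) \<Rightarrow> complex) \<Rightarrow> bool" where
  "deg_less 0 e f \<longleftrightarrow> f = (\<lambda>v. 0)"
| "deg_less (Suc n) e f \<longleftrightarrow> (\<exists>c g. deg_less n e g \<and> (c = (\<lambda>v. 0) \<or> n \<le> e \<and> coef (e - n) c) \<and>
     f = (\<lambda>v. lin v ^ n * c v + g v))"

lemma deg_less_homog: "deg_less n e f \<Longrightarrow> homog k e f"
proof (induction n arbitrary: f)
  case (Suc n)
  then obtain c g where cg: "deg_less n e g" "c = (\<lambda>v. 0) \<or> n \<le> e \<and> coef (e - n) c" "f = (\<lambda>v. lin v ^ n * c v + g v)"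
    by auto
  have "homog k e (\<lambda>v. lin v ^ n * c v)"
    using cg(2)
  proof
    assume "n \<le> e \<and> coef (e - n) c"
    then show ?thesis using homog_mult[OF homog_power[OF lin, of n], of "e - n" c] by (simp add: coef_def)
  qed (simp add: homog_zero)
  then show ?case using Suc.IH[OF cg(1)] cg(3) homog_add by simp
qed (simp add: homog_zero)

lemma deg_less_SucI: "deg_less n e f \<Longrightarrow> deg_less (Suc n) e f"
  unfolding deg_less.simps by (intro exI[of _ "\<lambda>v. 0"] exI[of _ f]) simp

lemma deg_less_mono: "deg_less n e f \<Longrightarrow> n \<le> m \<Longrightarrow> deg_less m e f"
  by (rotate_tac, induction m rule: dec_induct) (auto simp del: deg_less.simps intro: deg_less_SucI)

lemma deg_less_zero: "deg_less n e (\<lambda>v. 0)"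
  using deg_less_mono[of 0 e "\<lambda>v. 0" n] by simp

lemma deg_less_add: "deg_less n e f \<Longrightarrow> deg_less n e g \<Longrightarrow> deg_less n e (\<lambda>v. f v + g v)"
proof (induction n arbitrary: f g)
  case (Suc n)
  then obtain c f' d g' where
    f: "deg_less n e f'" "c = (\<lambda>v. 0) \<or> n \<le> e \<and> coef (e - n) c" "f = (\<lambda>v. lin v ^ n * c v + f' v)" and
    g: "deg_less n e g'" "d = (\<lambda>v. 0) \<or> n \<le> e \<and> coef (e - n) d" "g = (\<lambda>v. lin v ^ n * d v + g' v)"
    by auto
  have "(\<lambda>v. c v + d v) = (\<lambda>v. 0) \<or> n \<le> e \<and> coef (e - n) (\<lambda>v. c v + d v)"
    using f(2) g(2) coef_add by auto
  moreover have "(\<lambda>v. f v + g v) = (\<lambda>v. lin v ^ n * (c v + d v) + (f' v + g' v))"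
    unfolding f(3) g(3) by (simp add: algebra_simps)
  ultimately show ?case using Suc.IH[OF f(1) g(1)] unfolding deg_less.simps by blast
qed simp

lemma deg_less_coef_mult: "coef d b \<Longrightarrow> deg_less n e f \<Longrightarrow> deg_less n (d + e) (\<lambda>v. b v * f v)"
proof (induction n arbitrary: f)
  case (Suc n)
  then obtain c g where cg: "deg_less n e g" "c = (\<lambda>v. 0) \<or> n \<le> e \<and> coef (e - n) c" "f = (\<lambda>v. lin v ^ n * c v + g v)"
    by auto
  have "(\<lambda>v. b v * c v) = (\<lambda>v. 0) \<or> n \<le> d + e \<and> coef (d + e - n) (\<lambda>v. b v * c v)"
    using cg(2) coef_mult[OF Suc.prems(1), of "e - n" c] by auto
  moreover have "(\<lambda>v. b v * f v) = (\<lambda>v. lin v ^ n * (b v * c v) + b v * g v)"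
    unfolding cg(3) by (simp add: algebra_simps)
  ultimately show ?case using Suc.IH[OF Suc.prems(1) cg(1)] unfolding deg_less.simps
    by (intro exI[of _ "\<lambda>v. b v * c v"] exI[of _ "\<lambda>v. b v * g v"]) blast
qed simp

lemma deg_less_l_mult: "deg_less n e f \<Longrightarrow> deg_less (n + j) (e + j) (\<lambda>v. lin v ^ j * f v)"
proof (induction n arbitrary: f)
  case 0
  then show ?case using deg_less_zero by simp
next
  case (Suc n)
  then obtain c g where cg: "deg_less n e g" "c = (\<lambda>v. 0) \<or> n \<le> e \<and> coef (e - n) c" "f = (\<lambda>v. lin v ^ n * c v + g v)"
    by auto
  have "c = (\<lambda>v. 0) \<or> n + j \<le> e + j \<and> coef (e + j - (n + j)) c"
    using cg(2) by auto
  moreover have "(\<lambda>v. lin v ^ j * f v) = (\<lambda>v. lin v ^ (n + j) * c v + lin v ^ j * g v)"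
    unfolding cg(3) by (simp add: algebra_simps power_add)
  ultimately show ?case using Suc.IH[OF cg(1)] unfolding add_Suc deg_less.simps by blast
qed

lemma deg_less_mult: "deg_less n d f \<Longrightarrow> deg_less m e g \<Longrightarrow> deg_less (n + m) (d + e) (\<lambda>v. f v * g v)"
proof (induction n arbitrary: f)
  case 0
  then show ?case using deg_less_zero by simp
next
  case (Suc n)
  then obtain c f' where cf: "deg_less n d f'" "c = (\<lambda>v. 0) \<or> n \<le> d \<and> coef (d - n) c" "f = (\<lambda>v. lin v ^ n * c v + f' v)"
    by auto
  have "deg_less (m + n) (d + e) (\<lambda>v. lin v ^ n * (c v * g v))"
    using cf(2)
  proof
    assume c: "n \<le> d \<and> coef (d - n) c"
    then have "deg_less m (d - n + e) (\<lambda>v. c v * g v)" using deg_less_coef_mult Suc.prems(2) by blast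
    from deg_less_l_mult[OF this, of n] show ?thesis using c by simp
  qed (simp add: deg_less_zero)
  then have "deg_less (n + m) (d + e) (\<lambda>v. lin v ^ n * (c v * g v))" by (simp add: add.commute)
  from deg_less_add[OF this Suc.IH[OF cf(1) Suc.prems(2)]] have "deg_less (n + m) (d + e) (\<lambda>v. f v * g v)"
    unfolding cf(3) by (simp add: algebra_simps)
  then show ?case by (metis deg_less_SucI add_Suc)
qed

lemma homog_deg_less: "homog k e f \<Longrightarrow> \<exists>n. deg_less n e f"
proof (induction rule: homog.induct)
  case (homog_const c)
  have "coef 0 (\<lambda>v. c)" by (simp add: coef_def homog.homog_const)
  then show ?case by (intro exI[of _ "Suc 0"]) (auto intro!: exI[of _ "\<lambda>v. c"])
next
  case (homog_coord i)
  have 1: "coef 0 (\<lambda>v. a i)" by (simp add: coef_def homog.homog_const)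
  have "homog k 1 (\<lambda>v. v i - a i * lin v)"
    using homog_coord by (intro homog_diff homog_cmult lin homog.homog_coord)
  then have "coef 1 (\<lambda>v. v i - a i * lin v)"
    by (simp add: coef_def lin_shift algebra_simps)
  then have "deg_less (Suc 0) 1 (\<lambda>v. v i - a i * lin v)" by (auto intro!: exI[of _ "\<lambda>v. v i - a i * lin v"])
  then have "deg_less (Suc (Suc 0)) 1 (\<lambda>v. lin v ^ Suc 0 * a i + (v i - a i * lin v))"
    unfolding deg_less.simps(2)[of "Suc 0"] using 1
    by (intro exI[of _ "\<lambda>v. a i"] exI[of _ "\<lambda>v. v i - a i * lin v"]) simp
  then have "deg_less (Suc (Suc 0)) 1 (\<lambda>v. v i)" by (simp add: algebra_simps del: deg_less.simps)
  then show ?case by blast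
next
  case (homog_add e f g)
  then obtain n m where "deg_less n e f" "deg_less m e g" by blast
  then have "deg_less (max n m) e f" "deg_less (max n m) e g" by (auto intro: deg_less_mono)
  then show ?case using deg_less_add by blast
next
  case (homog_mult d f e g)
  then show ?case using deg_less_mult by blast
qed

text \<open>Division with remainder by \<open>g\<close>, whose leading coefficient is \<open>c\<close>, after multiplication by a power of
  \<open>c\<close>. The quotient has to be a form, of a degree that is only determined when it is nonzero.\<close>

lemma pseudo_division:
  assumes g: "g = (\<lambda>v. lin v ^ n * c v + g' v)" "deg_less n d g'" "n \<le> d" "coef (d - n) c"
    and f: "deg_less m e f"
  shows "\<exists>N E h r. deg_less (m - n) E h \<and> (h = (\<lambda>v. 0) \<or> E + d = e + N * (d - n)) \<and>
    deg_less n (e + N * (d - n)) r \<and> (\<forall>v. c v ^ N * f v = g v * h v + r v)"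
  using f
proof (induction m arbitrary: e f)
  case 0
  then show ?case
    by (intro exI[of _ 0] exI[of _ "\<lambda>v. 0"]) (auto simp: deg_less_zero)
next
  case (Suc m)
  show ?case
  proof (cases "Suc m \<le> n")
    case True
    then have "deg_less n e f" using Suc.prems deg_less_mono by blast
    then show ?thesis
      using deg_less_zero by (intro exI[of _ 0] exI[of _ "\<lambda>v. 0"] exI[of _ f]) auto
  next
    case False
    then have nm: "n \<le> m" by simp
    obtain b f' where bf: "deg_less m e f'" "b = (\<lambda>v. 0) \<or> m \<le> e \<and> coef (e - m) b" "f = (\<lambda>v. lin v ^ m * b v + f' v)"
      using Suc.prems by auto
    from bf(2) show ?thesis
    proof
      assume "b = (\<lambda>v. 0)"
      then have "f = f'" using bf(3) by simp
      with Suc.IH[OF bf(1)] obtain N E h r where "deg_less (m - n) E h"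
        "h = (\<lambda>v. 0) \<or> E + d = e + N * (d - n)" "deg_less n (e + N * (d - n)) r"
        "\<forall>v. c v ^ N * f v = g v * h v + r v" by blast
      moreover have "deg_less (Suc m - n) E h" using \<open>deg_less (m - n) E h\<close> by (rule deg_less_mono) simp
      ultimately show ?thesis by blast
    next
      assume b: "m \<le> e \<and> coef (e - m) b"
      \<comment> \<open>The leading term cancels in \<open>c f\<close> minus a multiple of \<open>g\<close>.\<close>
      define f2 where "f2 v = c v * f' v + (- 1) * (lin v ^ (m - n) * (b v * g' v))" for v
      have *: "deg_less n (e - m + d) (\<lambda>v. b v * g' v)" using b deg_less_coef_mult g(2) by blast
      have "deg_less m (d - n + e) (\<lambda>v. lin v ^ (m - n) * (b v * g' v))"
      proof -
        have "e - m + d + (m - n) = d - n + e" "n + (m - n) = m" using b nm g(3) by simp_all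
        then show ?thesis using deg_less_l_mult[OF *, of "m - n"] by metis
      qed
      moreover have "coef 0 (\<lambda>v. -1)" by (simp add: coef_def homog_const)
      ultimately have "deg_less m (d - n + e) (\<lambda>v. (-1) * (lin v ^ (m - n) * (b v * g' v)))"
        using deg_less_coef_mult by fastforce
      then have "deg_less m (d - n + e) f2"
        unfolding f2_def[abs_def] by (rule deg_less_add[OF deg_less_coef_mult[OF g(4) bf(1)]])
      from Suc.IH[OF this] obtain N E h r where
        I: "deg_less (m - n) E h" "h = (\<lambda>v. 0) \<or> E + d = d - n + e + N * (d - n)"
           "deg_less n (d - n + e + N * (d - n)) r" "\<forall>v. c v ^ N * f2 v = g v * h v + r v" by blast
      define E' where "E' = (e - m) + N * (d - n) + (m - n)"
      have E': "E' + d = e + Suc N * (d - n)" using b nm g(3) by (simp add: E'_def)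
      have "deg_less (m - n) E' h"
        using I(2)
      proof
        assume "E + d = d - n + e + N * (d - n)"
        then have "E = E'" using E' by simp
        then show ?thesis using I(1) by simp
      qed (simp add: deg_less_zero)
      then have 1: "deg_less (Suc m - n) E' h" by (rule deg_less_mono) simp
      have "coef (N * (d - n) + (e - m)) (\<lambda>v. c v ^ N * b v)"
        using coef_mult[OF coef_power[OF g(4), of N] conjunct2[OF b]]
        by (simp only: mult.commute[of "d - n" N])
      then have "deg_less (Suc 0) (N * (d - n) + (e - m)) (\<lambda>v. c v ^ N * b v)"
        by (auto intro!: exI[of _ "\<lambda>v. c v ^ N * b v"])
      from deg_less_l_mult[OF this, of "m - n"]
      have 2: "deg_less (Suc m - n) E' (\<lambda>v. lin v ^ (m - n) * (c v ^ N * b v))"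
        using nm by (simp add: E'_def Suc_diff_le add_ac del: deg_less.simps)
      have eq: "c v ^ Suc N * f v = g v * (h v + lin v ^ (m - n) * (c v ^ N * b v)) + r v" for v
      proof -
        have "lin v ^ m = lin v ^ n * lin v ^ (m - n)" using nm by (simp flip: power_add)
        then have cf: "c v * f v = f2 v + g v * (lin v ^ (m - n) * b v)"
          unfolding f2_def bf(3) g(1) by (simp add: algebra_simps)
        have "c v ^ Suc N * f v = c v ^ N * (c v * f v)" by simp
        also have "\<dots> = c v ^ N * f2 v + g v * (lin v ^ (m - n) * (c v ^ N * b v))"
          unfolding cf by (simp add: algebra_simps)
        finally have "c v ^ Suc N * f v = c v ^ N * f2 v + g v * (lin v ^ (m - n) * (c v ^ N * b v))" .
        then show ?thesis using I(4) by (simp add: algebra_simps)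
      qed
      show ?thesis
      proof (intro exI conjI)
        show "deg_less (Suc m - n) E' (\<lambda>v. h v + lin v ^ (m - n) * (c v ^ N * b v))"
          by (rule deg_less_add[OF 1 2])
        show "deg_less n (e + Suc N * (d - n)) r" using I(3) by (simp add: add_ac)
        show "\<forall>v. c v ^ Suc N * f v = g v * (h v + lin v ^ (m - n) * (c v ^ N * b v)) + r v"
          using eq by blast
      qed (use E' in simp)
    qed
  qed
qed

text \<open>The projection from \<open>a\<close> maps the hypersurface onto the base: on each line through \<open>a\<close> the form \<open>p\<close>
  restricts to a polynomial, which is not constant because it behaves like \<open>t\<^sup>e p(a)\<close> at infinity and
  therefore has a zero. A function constant along these lines that vanishes on the hypersurface is
  zero.\<close>

lemma coef_vanishing_on_hypersurface:
  assumes k: "k \<ge> 1" and a: "a \<in> vecs k" and p: "homog k e p" "e \<ge> 1" "p a \<noteq> 0"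
    and c: "coef d c" "vanishes k {x \<in> Proj {..k}. p (rep x) = 0} c"
  shows "c = (\<lambda>v. 0)"
proof (rule ccontr)
  assume "c \<noteq> (\<lambda>v. 0)"
  then obtain v where v: "v \<in> vecs k" "c v \<noteq> 0"
    using homog_zero_on_vecs c(1) unfolding coef_def by blast
  have "\<exists>w\<in>vecs k. c w \<noteq> 0 \<and> (\<forall>s. w \<noteq> (\<lambda>i. s * a i))"
  proof (cases "\<exists>s. v = (\<lambda>i. s * a i)")
    case True
    then obtain s where s: "v = (\<lambda>i. s * a i)" by blast
    have "\<forall>v t. c (\<lambda>i. v i + t * a i) = c v" using c(1) by (simp add: coef_def)
    from this[rule_format, of "\<lambda>i. 0" s] have "c (\<lambda>i. 0 + s * a i) = c (\<lambda>i. 0)" .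
    then have "c (\<lambda>i. 0) \<noteq> 0" using v s by simp
    moreover have "c (\<lambda>i. 0 * a i) = 0 ^ d * c a" using c(1) homog_scale unfolding coef_def by blast
    ultimately have "d = 0" by (cases d) auto
    then have cc: "c w = c v" for w using homog_degree_0 c(1) unfolding coef_def by blast
    \<comment> \<open>A constant can be tested at any vector outside the line, such as one of two coordinate vectors.\<close>
    let ?e = "\<lambda>j i. if i = j then 1 else (0::complex)"
    have "(\<forall>s. ?e 0 \<noteq> (\<lambda>i. s * a i)) \<or> (\<forall>s. ?e 1 \<noteq> (\<lambda>i. s * a i))"
    proof (rule ccontr)
      assume "\<not> ?thesis"
      then obtain s t where st: "?e 0 = (\<lambda>i. s * a i)" "?e 1 = (\<lambda>i. t * a i)" by blast
      have "s * a 0 = 1" "s * a 1 = 0" "t * a 1 = 1"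
        using fun_cong[OF st(1), of 0] fun_cong[OF st(1), of 1] fun_cong[OF st(2), of 1] by simp_all
      then show False by auto
    qed
    moreover have "?e 0 \<in> vecs k" "?e 1 \<in> vecs k" using k by (auto simp: vecs_def)
    ultimately show ?thesis using cc v(2) by metis
  qed (use v in blast)
  then obtain w where w: "w \<in> vecs k" "c w \<noteq> 0" "\<And>s. w \<noteq> (\<lambda>i. s * a i)" by blast
  obtain P where P: "\<And>t. p (\<lambda>i. w i + t * a i) = poly P t" using homog_line_poly[OF p(1)] by blast
  have "\<not> constant (poly P)"
  proof
    assume "constant (poly P)"
    then have const: "poly P t = poly P 0" for t by (simp add: constant_def)
    obtain Q where Q: "\<And>s. p (\<lambda>i. a i + s * w i) = poly Q s" using homog_line_poly[OF p(1)] by blast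
    \<comment> \<open>Seen from \<open>a\<close> the restriction would be a multiple of \<open>s\<^sup>e\<close>, hence zero at \<open>a\<close>.\<close>
    have "poly Q s = s ^ e * poly P 0" if "s \<noteq> 0" for s
    proof -
      have "poly Q s = p (\<lambda>i. s * (w i + (1 / s) * a i))"
        unfolding Q[symmetric] using that by (intro arg_cong[of _ _ p]) (auto simp: field_simps)
      also have "\<dots> = s ^ e * poly P (1 / s)" by (simp only: homog_scale[OF p(1)] P)
      finally show ?thesis using const by metis
    qed
    then have "\<forall>\<^sub>F s in at 0. poly Q s = s ^ e * poly P 0"
      by (simp add: eventually_at_filter)
    moreover have "((\<lambda>s. s ^ e * poly P 0) \<longlongrightarrow> 0 ^ e * poly P 0) (at 0)"
      by (intro tendsto_intros)
    moreover have "(poly Q \<longlongrightarrow> poly Q 0) (at 0)"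
      by (intro tendsto_intros)
    ultimately have "poly Q 0 = 0 ^ e * poly P 0"
      using tendsto_cong tendsto_unique trivial_limit_at by fastforce
    then show False using p(2,3) Q[of 0] by simp
  qed
  then obtain t where t: "poly P t = 0" using Fundamental_Theorem_Algebra.fundamental_theorem_of_algebra by blast
  let ?u = "\<lambda>i. w i + t * a i"
  have "\<exists>i. ?u i \<noteq> 0"
  proof (rule ccontr)
    assume "\<not> ?thesis"
    then have "w = (\<lambda>i. (- t) * a i)" by (auto simp: eq_neg_iff_add_eq_0)
    then show False using w(3) by blast
  qed
  then have "?u \<in> vecs k" using w(1) a unfolding vecs_def by force
  moreover from this have "pt ?u \<in> {x \<in> Proj {..k}. p (rep x) = 0}"
    using t P pt_in_Proj homog_rep_eq_0[OF p(1)] by simp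
  ultimately have "c ?u = 0" using c(2) unfolding vanishes_def by blast
  then show False using w(2) c(1) unfolding coef_def by simp
qed

text \<open>Let \<open>g\<close> and \<open>f\<close> be nonzero forms of least degree in \<open>lin\<close> vanishing on \<open>X\<close> and on \<open>Z\<close>. Division by
  \<open>g\<close> leaves no remainder for forms vanishing on \<open>X\<close>, by minimality. Applied to \<open>f\<close> it gives
  \<open>c\<^sup>N f = g h\<close> with \<open>h\<close> of smaller degree than \<open>f\<close>; as the ideal of \<open>Z\<close> is prime and does not contain \<open>h\<close>,
  it contains \<open>g\<close>. Applied to \<open>p\<close> it then shows that \<open>c\<^sup>N p\<close> vanishes on \<open>Z\<close>, and no power of \<open>c\<close> does.\<close>

lemma defining_form_vanishes:
  assumes k: "k \<ge> 1" and a: "a \<in> vecs k" and p: "homog k e p" "e \<ge> 1" "p a \<noteq> 0"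
    and X: "X = {x \<in> Proj {..k}. p (rep x) = 0}"
    and Z: "irreducible_variety {..k} Z" "X \<subseteq> Z"
    and q: "homog k b q" "q \<noteq> (\<lambda>v. 0)" "vanishes k Z q"
  shows "vanishes k Z p"
proof -
  note coefX = coef_vanishing_on_hypersurface[OF k a p, folded X]
  define GX where "GX n \<longleftrightarrow> (\<exists>d g. deg_less n d g \<and> g \<noteq> (\<lambda>v. 0) \<and> vanishes k X g)" for n
  define GZ where "GZ n \<longleftrightarrow> (\<exists>d g. deg_less n d g \<and> g \<noteq> (\<lambda>v. 0) \<and> vanishes k Z g)" for n
  obtain n0 where "deg_less n0 b q" using homog_deg_less[OF q(1)] by blast
  then have "GZ n0" using q by (auto simp: GZ_def)
  then have GXn0: "GX n0" using vanishes_mono[OF _ Z(2)] by (auto simp: GX_def GZ_def)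
  define n1 where "n1 = (LEAST n. GX n)"
  have n1: "GX n1" "\<And>m. m < n1 \<Longrightarrow> \<not> GX m"
    using GXn0 unfolding n1_def by (auto intro: LeastI dest: not_less_Least)
  define m where "m = (LEAST n. GZ n)"
  have m: "GZ m" "\<And>j. j < m \<Longrightarrow> \<not> GZ j"
    using \<open>GZ n0\<close> unfolding m_def by (auto intro: LeastI dest: not_less_Least)
  obtain d g where g: "deg_less n1 d g" "g \<noteq> (\<lambda>v. 0)" "vanishes k X g" using n1(1) by (auto simp: GX_def)
  then obtain n where n: "n1 = Suc n" by (cases n1) auto
  obtain c g' where cg: "deg_less n d g'" "c = (\<lambda>v. 0) \<or> n \<le> d \<and> coef (d - n) c" "g = (\<lambda>v. lin v ^ n * c v + g' v)"
    using g(1) n by auto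
  have c0: "c \<noteq> (\<lambda>v. 0)"
  proof
    assume "c = (\<lambda>v. 0)"
    then have "deg_less n d g" using cg by simp
    then have "GX n" using g unfolding GX_def by blast
    then show False using n1(2) n by blast
  qed
  then have c: "n \<le> d" "coef (d - n) c" using cg(2) by auto
  have "n \<noteq> 0"
  proof
    assume "n = 0"
    then have "g = c" using cg by simp
    then show False using coefX[OF c(2)] g c0 by blast
  qed
  have div: "\<exists>N E h. deg_less (j - n) E h \<and> (\<forall>v. c v ^ N * f v = g v * h v)"
    if f: "deg_less j i f" "vanishes k X f" for f i j
  proof -
    obtain N E h r where r: "deg_less (j - n) E h" "deg_less n (i + N * (d - n)) r"
        "\<forall>v. c v ^ N * f v = g v * h v + r v"
      using pseudo_division[OF cg(3,1) c f(1)] by blast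
    have "r v = c v ^ N * f v - g v * h v" for v using r(3) by simp
    then have "vanishes k X r" using f(2) g(3) by (simp add: vanishes_def)
    then have "r = (\<lambda>v. 0)" using r(2) n1(2)[of n] n unfolding GX_def by blast
    then have "\<forall>v. c v ^ N * f v = g v * h v" using r(3) by simp
    then show ?thesis using r(1) by blast
  qed
  have hc: "homog k ((d - n) * N) (\<lambda>v. c v ^ N)" for N
    using coef_power[OF c(2)] by (simp add: coef_def)
  have cN: "(\<lambda>v. c v ^ N) \<noteq> (\<lambda>v. 0)" for N
    using c0 by (auto simp: fun_eq_iff)
  have "vanishes k Z g"
  proof -
    obtain i f where f: "deg_less m i f" "f \<noteq> (\<lambda>v. 0)" "vanishes k Z f" using m(1) by (auto simp: GZ_def)
    then obtain N E h where h: "deg_less (m - n) E h" "\<forall>v. c v ^ N * f v = g v * h v"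
      using div[OF f(1) vanishes_mono[OF f(3) Z(2)]] by blast
    have "h \<noteq> (\<lambda>v. 0)"
    proof
      assume "h = (\<lambda>v. 0)"
      then have "c v ^ N * f v = 0" for v using h(2) by simp
      then show False using homog_no_zero_divisors[OF hc deg_less_homog[OF f(1)]] cN f(2) by blast
    qed
    moreover have "m \<noteq> 0" using f(1,2) by (cases m) auto
    then have "m - n < m" using \<open>n \<noteq> 0\<close> by simp
    ultimately have "\<not> vanishes k Z h" using m(2) h(1) unfolding GZ_def by blast
    moreover have "vanishes k Z (\<lambda>v. g v * h v)" using f(3) h(2) unfolding vanishes_def by (metis mult_zero_right)
    ultimately show ?thesis
      using vanishes_prime[OF Z(1) deg_less_homog[OF g(1)] deg_less_homog[OF h(1)]] by blast
  qed
  obtain j where "deg_less j e p" using homog_deg_less[OF p(1)] by blast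
  moreover have "vanishes k X p" using homog_rep_eq_0[OF p(1)] by (auto simp: vanishes_def X)
  ultimately obtain N E h where h: "\<forall>v. c v ^ N * p v = g v * h v" using div by blast
  have "vanishes k Z (\<lambda>v. c v ^ N * p v)" using \<open>vanishes k Z g\<close> h by (simp add: vanishes_def)
  then have "vanishes k Z (\<lambda>v. c v ^ N) \<or> vanishes k Z p" by (rule vanishes_prime[OF Z(1) hc p(1)])
  moreover have "\<not> vanishes k Z (\<lambda>v. c v ^ N)"
    using coefX[OF coef_power[OF c(2)]] cN vanishes_mono[OF _ Z(2)] by blast
  ultimately show ?thesis by blast
qed

end

text \<open>If \<open>Z\<close> misses a point, this point serves as centre of the projection, since it does not lie on \<open>X\<close>
  either, and some nonzero form vanishes on \<open>Z\<close>.\<close>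

lemma hypersurface_maximal:
  assumes k: "k \<ge> 1" and X: "irreducible_hypersurface k X"
    and Z: "irreducible_variety {..k} Z" "X \<subseteq> Z"
  shows "Z = X \<or> Z = Proj {..k}"
proof (rule disjCI)
  assume "Z \<noteq> Proj {..k}"
  have cl: "closedin (zariski {..k}) Z" using Z by (simp add: irreducible_variety_def)
  then have ZP: "Z \<subseteq> Proj {..k}" using closedin_subset topspace_zariski by blast
  with \<open>Z \<noteq> Proj {..k}\<close> obtain v where v: "v \<in> vecs k" "pt v \<notin> Z" by (auto simp: Proj_eq_image)
  obtain b q where q: "homog k b q" "q v \<noteq> 0" "\<And>v. v \<in> vecs k \<Longrightarrow> pt v \<in> Z \<Longrightarrow> q v = 0"
    using closedin_separating_form[OF cl v] by blast
  obtain e P where P: "e \<ge> 1" "P \<in> forms {..k} e" "X = {x \<in> Proj {..k}. eval P (rep x) = 0}"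
    using X unfolding irreducible_hypersurface_def by blast
  note p = homog_eval[OF P(2)]
  have "pt v \<notin> X" using v(2) Z(2) by blast
  then have a: "eval P v \<noteq> 0" using P(3) pt_in_Proj[OF v(1)] homog_rep_eq_0[OF p] by simp
  obtain j where j: "j \<le> k" "v j \<noteq> 0" using v(1) by (auto simp: vecs_def)
  have "vanishes k Z (eval P)"
  proof (rule direction.defining_form_vanishes)
    show "direction k v (\<lambda>w. (1 / v j) * w j)"
    proof
      show "homog k 1 (\<lambda>w. (1 / v j) * w j)" using j by (intro homog_cmult homog_coord) simp
    qed (use j in \<open>simp_all add: field_simps\<close>)
    show "q \<noteq> (\<lambda>v. 0)" using q(2) by auto
    show "vanishes k Z q" using q(3) by (simp add: vanishes_def)
  qed (use v a P p k Z q(1) in simp_all)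
  then have "x \<in> X" if "x \<in> Z" for x
    using rep_in_vecs[of x k] that ZP unfolding P(3) vanishes_def by auto
  then show "Z = X" using Z(2) by blast
qed

section \<open>Endomorphisms given by forms\<close>

lemma subtopology_Proj: "subtopology (zariski {..k}) (Proj {..k}) = zariski {..k::nat}"
  using subtopology_topspace[of "zariski {..k}"] by (simp add: topspace_zariski)

lemma morphism_globalI:
  assumes G: "\<And>j. j \<le> l \<Longrightarrow> homog k e (G j)" and A: "A \<subseteq> Proj {..k}"
    and g: "\<And>x. x \<in> A \<Longrightarrow> (\<exists>j\<le>l. G j (rep x) \<noteq> 0) \<and> g x = pt (\<lambda>j. if j \<le> l then G j (rep x) else 0)"
  shows "morphism {..k} {..l} A g"
proof -
  have "\<forall>j\<in>{..l}. \<exists>p. p \<in> forms {..k} e \<and> G j = eval p"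
    using G homog_imp_form by blast
  then obtain P where P: "\<forall>j\<in>{..l}. P j \<in> forms {..k} e \<and> G j = eval (P j)"
    by (rule bchoice[THEN exE])
  have "form_map {..l} P x = pt (\<lambda>j. if j \<le> l then G j (rep x) else 0)" for x
    unfolding form_map_def by (rule arg_cong[of _ _ pt]) (use P in auto)
  moreover have "\<exists>j\<in>{..l}. eval (P j) (rep x) \<noteq> 0" if "x \<in> A" for x
    using g[OF that] P by auto
  ultimately show ?thesis
    unfolding morphism_def using g A P openin_Proj
    by (intro ballI exI[of _ "Proj {..k}"] exI[of _ e] exI[of _ P]) auto
qed

lemma vecs_truncate: "v \<in> vecs k \<Longrightarrow> (\<lambda>j. if j \<le> k then v j else 0) = v"
  by (auto simp: vecs_def)

lemma morphism_identity:
  fixes k :: nat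
  assumes "\<And>x. x \<in> Proj {..k} \<Longrightarrow> g x = x"
  shows "morphism {..k} {..k} (Proj {..k}) g"
proof (rule morphism_globalI)
  show "homog k 1 (\<lambda>v. v j)" if "j \<le> k" for j using that by (rule homog_coord)
  fix x assume x: "x \<in> Proj {..k}"
  then show "(\<exists>j\<le>k. rep x j \<noteq> 0) \<and> g x = pt (\<lambda>j. if j \<le> k then rep x j else 0)"
    using rep_in_vecs[OF x] assms[OF x] by (auto simp: vecs_truncate) (auto simp: vecs_def)
qed simp

lemma twisting_line_bundle: "is_line_bundle {..k} (Proj {..k}) (twisting k)"
  unfolding is_line_bundle_def
proof (intro conjI ballI)
  fix a assume a: "a \<in> idx (twisting k)"
  then have ak: "a \<le> k" by (simp add: twisting_def)
  show "openin (subtopology (zariski {..k}) (Proj {..k})) (patch (twisting k) a)"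
    using openin_nonzero_set[OF homog_coord[OF ak]] by (simp add: subtopology_Proj twisting_def)
  fix b assume "b \<in> idx (twisting k)"
  then have bk: "b \<le> k" by (simp add: twisting_def)
  show "regular_unit {..k} (patch (twisting k) a \<inter> patch (twisting k) b) (transition (twisting k) a b)"
    by (rule regular_unit_ratio[OF homog_coord[OF bk] homog_coord[OF ak]]) (auto simp: twisting_def)
next
  have "\<exists>a\<le>k. rep x a \<noteq> 0" if "x \<in> Proj {..k}" for x
    using rep_in_vecs(1)[OF that] by (auto simp: vecs_def)
  then show "(\<Union>a\<in>idx (twisting k). patch (twisting k) a) = Proj {..k}"
    by (auto simp: twisting_def)
qed (auto simp: twisting_def)

text \<open>The identity is the embedding given by \<open>O(1)\<close>.\<close>

lemma twisting_ample: "ample {..k} (Proj {..k}) (twisting k)"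
proof -
  have "inv_into (Proj {..k}) id x = x" if "x \<in> Proj {..k}" for x
    using inv_into_f_f[of id "Proj {..k}" x] that by simp
  then have "closed_immersion {..k} {..k} (Proj {..k}) id"
    unfolding closed_immersion_def using closedin_topspace[of "zariski {..k}"]
    by (auto simp: topspace_zariski intro!: morphism_identity)
  moreover have "line_bundle_iso {..k} (tensor_power (twisting k) 1) (pullback (Proj {..k}) id (twisting k))"
    unfolding line_bundle_iso_def
  proof (intro exI conjI ballI)
    let ?u = "\<lambda>c a x. rep x a / (rep x c :: complex)"
    fix a c assume "a \<in> idx (tensor_power (twisting k) 1)" "c \<in> idx (pullback (Proj {..k}) id (twisting k))"
    then have ac: "a \<le> k" "c \<le> k" by (auto simp: tensor_power_def pullback_def twisting_def)
    show "regular_unit {..k} (patch (tensor_power (twisting k) 1) a \<inter>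
        patch (pullback (Proj {..k}) id (twisting k)) c) (?u c a)"
      by (rule regular_unit_ratio[OF homog_coord[OF ac(1)] homog_coord[OF ac(2)]])
        (auto simp: twisting_def tensor_power_def pullback_def)
  qed (auto simp: twisting_def tensor_power_def pullback_def)
  ultimately have "very_ample {..k} (Proj {..k}) (tensor_power (twisting k) 1)"
    unfolding very_ample_def by blast
  then show ?thesis
    unfolding ample_def using twisting_line_bundle by blast
qed

text \<open>A tuple of forms of the same degree without common zeros; \<open>g\<close> is the induced endomorphism and
  \<open>lift\<close> the polynomial map of the cone above it.\<close>

locale form_endo =
  fixes k d :: nat and G :: "nat \<Rightarrow> nat mpoly"
  assumes G: "\<And>j. j \<le> k \<Longrightarrow> G j \<in> forms {..k} d"
    and nz: "\<And>v. v \<in> vecs k \<Longrightarrow> \<exists>j\<le>k. eval (G j) v \<noteq> 0"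
begin

definition lift :: "(nat \<Rightarrow> complex) \<Rightarrow> nat \<Rightarrow> complex" where
  "lift v = (\<lambda>j. if j \<le> k then eval (G j) v else 0)"

abbreviation g :: "nat point \<Rightarrow> nat point" where
  "g \<equiv> form_map {..k} G"

lemma lift_homog: "homog k d (\<lambda>v. lift v j)"
  using G homog_eval homog_zero by (cases "j \<le> k") (auto simp: lift_def)

lemma lift_vecs: "v \<in> vecs k \<Longrightarrow> lift v \<in> vecs k"
  using nz[of v] by (auto simp: lift_def vecs_def)

lemma g_pt: "g (pt v) = pt (lift v)"
proof -
  obtain c where c: "c \<noteq> 0" "rep (pt v) = (\<lambda>i. c * v i)" using rep_pt by blast
  have "lift (rep (pt v)) = (\<lambda>j. c ^ d * lift v j)"
    unfolding c(2) by (rule ext, rule homog_scale[OF lift_homog])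
  then show ?thesis
    using pt_scale[of "c ^ d" "lift v"] c(1) by (simp add: form_map_def lift_def)
qed

lemma g_Proj: "x \<in> Proj {..k} \<Longrightarrow> g x \<in> Proj {..k}"
  unfolding Proj_eq_image using g_pt lift_vecs by force

lemma g_funpow_Proj: "x \<in> Proj {..k} \<Longrightarrow> (g ^^ n) x \<in> Proj {..k}"
  by (induction n) (auto intro: g_Proj)

lemma lift_funpow_homog: "j \<le> k \<Longrightarrow> homog k (d ^ n) (\<lambda>v. (lift ^^ n) v j)"
proof (induction n arbitrary: j)
  case 0
  then show ?case using homog_coord[of j k] by simp
next
  case (Suc n)
  then show ?case
    using homog_comp[of k d "\<lambda>v. lift v j" k "d ^ n" "\<lambda>i v. (lift ^^ n) v i"] lift_homog by simp
qed

lemma lift_funpow_vecs: "v \<in> vecs k \<Longrightarrow> (lift ^^ n) v \<in> vecs k"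
  by (induction n) (auto intro: lift_vecs)

lemma g_funpow_pt: "(g ^^ n) (pt v) = pt ((lift ^^ n) v)"
  by (induction n) (auto simp: g_pt)

text \<open>The forms \<open>\<alpha>\<^sub>j x\<^sub>i - \<alpha>\<^sub>i x\<^sub>j\<close> with \<open>i \<noteq> j\<close> cut out the point \<open>\<alpha>\<close>, where \<open>\<alpha>\<^sub>j \<noteq> 0\<close>. Their pullbacks are \<open>k\<close>
  forms of degree \<open>d\<close>, and a common zero of them lies over \<open>\<alpha>\<close>.\<close>

lemma g_surj:
  assumes "d \<ge> 1" shows "g ` Proj {..k} = Proj {..k}"
proof
  show "g ` Proj {..k} \<subseteq> Proj {..k}" using g_Proj by blast
  show "Proj {..k} \<subseteq> g ` Proj {..k}"
  proof
    fix x assume "x \<in> Proj {..k}"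
    then obtain \<alpha> where \<alpha>: "\<alpha> \<in> vecs k" "x = pt \<alpha>" by (auto simp: Proj_eq_image)
    then obtain j where j: "j \<le> k" "\<alpha> j \<noteq> 0" by (auto simp: vecs_def)
    have "\<exists>v\<in>vecs k. \<forall>i\<in>{..k} - {j}. \<alpha> j * lift v i - \<alpha> i * lift v j = 0"
      by (rule forms_common_zero[OF assms])
        (use j in \<open>auto intro!: homog_diff homog_cmult lift_homog\<close>)
    then obtain v where v: "v \<in> vecs k" "\<And>i. i \<in> {..k} - {j} \<Longrightarrow> \<alpha> j * lift v i - \<alpha> i * lift v j = 0"
      by blast
    have *: "lift v i = (lift v j / \<alpha> j) * \<alpha> i" for i
    proof (cases "i \<in> {..k} - {j}")
      case True
      then show ?thesis using v(2)[OF True] j by (simp add: field_simps)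
    next
      case False
      then show ?thesis using j \<alpha>(1) by (auto simp: lift_def vecs_def)
    qed
    then have "lift v j / \<alpha> j \<noteq> 0" using lift_vecs[OF v(1)] unfolding vecs_def by force
    moreover have "lift v = (\<lambda>i. (lift v j / \<alpha> j) * \<alpha> i)" using * by blast
    ultimately have "pt (lift v) = pt \<alpha>" using pt_scale[of "lift v j / \<alpha> j" \<alpha>] by metis
    then show "x \<in> g ` Proj {..k}" using \<alpha>(2) g_pt pt_in_Proj[OF v(1)] by (metis imageI)
  qed
qed

lemma g_morphism: "morphism {..k} {..k} (Proj {..k}) g"
proof (rule morphism_globalI)
  show "homog k d (eval (G j))" if "j \<le> k" for j using G[OF that] by (rule homog_eval)
  show "(\<exists>j\<le>k. eval (G j) (rep x) \<noteq> 0) \<and> g x = pt (\<lambda>j. if j \<le> k then eval (G j) (rep x) else 0)"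
    if "x \<in> Proj {..k}" for x using nz rep_in_vecs(1)[OF that] by (simp add: form_map_def)
qed simp

text \<open>The isomorphism of the pullback of \<open>O(1)\<close> with \<open>O(d)\<close> is given by \<open>G a / x\<^sub>c\<^sup>d\<close>.\<close>

lemma g_polarizable:
  assumes "d > 1" shows "polarizable {..k} (Proj {..k}) g"
proof -
  have rg: "rep (g x) a \<noteq> 0 \<longleftrightarrow> eval (G a) (rep x) \<noteq> 0"
    "rep (g x) b / rep (g x) a = eval (G b) (rep x) / eval (G a) (rep x)"
    if "a \<le> k" "b \<le> k" for x a b
  proof -
    have "g x = pt (lift (rep x))" by (simp add: form_map_def lift_def)
    then obtain c where "c \<noteq> 0" "rep (g x) = (\<lambda>i. c * lift (rep x) i)" using rep_pt by metis
    then show "rep (g x) a \<noteq> 0 \<longleftrightarrow> eval (G a) (rep x) \<noteq> 0"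
      "rep (g x) b / rep (g x) a = eval (G b) (rep x) / eval (G a) (rep x)"
      using that by (auto simp: lift_def)
  qed
  have "line_bundle_iso {..k} (pullback (Proj {..k}) g (twisting k)) (tensor_power (twisting k) d)"
    (is "line_bundle_iso _ ?L ?M")
    unfolding line_bundle_iso_def
  proof (intro exI conjI ballI)
    let ?u = "\<lambda>c a x. eval (G a) (rep x) / rep x c ^ d"
    fix a c assume "a \<in> idx ?L" "c \<in> idx ?M"
    then have ac: "a \<le> k" "c \<le> k" by (auto simp: tensor_power_def pullback_def twisting_def)
    show "regular_unit {..k} (patch ?L a \<inter> patch ?M c) (?u c a)"
    proof (rule regular_unit_ratio[OF homog_eval[OF G[OF ac(1)]]])
      show "homog k d (\<lambda>v. v c ^ d)"
        using homog_power[OF homog_coord[OF ac(2)], of d] by simp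
      fix x assume "x \<in> patch ?L a \<inter> patch ?M c"
      then show "eval (G a) (rep x) \<noteq> 0 \<and> rep x c ^ d \<noteq> 0 \<and> ?u c a x = eval (G a) (rep x) / rep x c ^ d"
        using rg(1)[OF ac(1) ac(1)] by (simp add: twisting_def tensor_power_def pullback_def)
    qed (auto simp: twisting_def tensor_power_def pullback_def)
    fix b e x assume "b \<in> idx ?L" "e \<in> idx ?M" and x: "x \<in> patch ?L a \<inter> patch ?L b \<inter> patch ?M c \<inter> patch ?M e"
    then have be: "b \<le> k" "e \<le> k" by (auto simp: tensor_power_def pullback_def twisting_def)
    show "?u c a x * transition ?L a b x = transition ?M c e x * ?u e b x"
      using x rg(1)[OF ac(1) ac(1)] rg(1)[OF be(1) be(1)] rg(2)[OF ac(1) be(1)]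
      by (simp add: twisting_def tensor_power_def pullback_def power_divide)
  qed
  then show ?thesis
    unfolding polarizable_def using g_morphism g_Proj twisting_ample assms by blast
qed

end

lemma endo_form_forms: "endo_form k d f j \<in> forms {..k} d"
proof -
  have *: "(\<Sum>m\<in>M. Poly_Mapping.single m (c m)) \<in> forms {..k} d" if "M \<subseteq> monoms {..k} d"
    for M and c :: "(nat \<Rightarrow>\<^sub>0 nat) \<Rightarrow> complex"
    using that
  proof (induction M rule: infinite_finite_induct)
    case (insert x F)
    have "Poly_Mapping.keys (Poly_Mapping.single x (c x) + (\<Sum>m\<in>F. Poly_Mapping.single m (c m)))
      \<subseteq> Poly_Mapping.keys (Poly_Mapping.single x (c x)) \<union> Poly_Mapping.keys (\<Sum>m\<in>F. Poly_Mapping.single m (c m))"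
      by (rule Poly_Mapping.keys_add)
    then show ?case using insert by (auto simp: forms_def split: if_splits)
  qed (auto simp: forms_def)
  show ?thesis unfolding endo_form_def by (rule *) simp
qed

lemma End_form_endo: assumes "f \<in> End k d" shows "form_endo k d (endo_form k d f)"
proof
  show "endo_form k d f j \<in> forms {..k} d" for j by (rule endo_form_forms)
  fix v assume v: "v \<in> vecs k"
  then obtain j where "j \<le> k" "eval (endo_form k d f j) (rep (pt v)) \<noteq> 0"
    using assms pt_in_Proj unfolding End_def by blast
  then show "\<exists>j\<le>k. eval (endo_form k d f j) v \<noteq> 0"
    using homog_rep_eq_0[OF homog_eval[OF endo_form_forms]] by blast
qed

section \<open>Directions in which a map degenerates\<close>

text \<open>Forms satisfy the identity theorem, as they have no zero divisors.\<close>

lemma near_zero: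
  assumes "homog k e f" "near k v0 (\<lambda>v. f v = 0)"
  shows "f = (\<lambda>v. 0)"
proof -
  obtain d s where s: "homog k d s" "s v0 \<noteq> 0" "\<forall>v\<in>vecs k. s v \<noteq> 0 \<longrightarrow> f v = 0"
    using assms(2) unfolding near_def by blast
  then have "s = (\<lambda>v. 0) \<or> f = (\<lambda>v. 0)"
    by (intro homog_no_zero_divisors[OF s(1) assms(1)]) auto
  then show ?thesis using s(2) by auto
qed

text \<open>A left inverse \<open>K\<close> of the embedding exists as a morphism. If \<open>B\<close> moved parallel to itself in the
  direction \<open>w\<close>, then by Euler's formula so would \<open>K(B)\<close>; but \<open>K(B(v))\<close> is a multiple of \<open>v\<close>, which moves
  in the direction \<open>w\<close> orthogonal to \<open>v0\<close>.\<close>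

lemma immersion_not_degenerate:
  assumes \<iota>: "closed_immersion {..k} {..N} (Proj {..k}) \<iota>"
    and v0: "v0 \<in> vecs k" and B: "represents k N (Proj {..k}) \<iota> v0 e B"
    and w: "w \<in> vecs k" "(\<Sum>j\<le>k. cnj (v0 j) * w j) = 0"
    and b: "\<And>j. j \<le> N \<Longrightarrow> ((\<lambda>t. B j (\<lambda>l. v0 l + t * w l)) has_field_derivative b j) (at 0)"
  shows "\<exists>j\<in>{..N}. b j \<noteq> \<mu> * B j v0"
proof (rule ccontr)
  assume "\<not> ?thesis"
  then have bB: "b j = \<mu> * B j v0" if "j \<le> N" for j using that by auto
  let ?\<kappa> = "inv_into (Proj {..k}) \<iota>" and ?l = "\<lambda>t i. v0 i + t * w i"
  have hB: "homog k e (B j)" for j using B by (simp add: represents_def)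
  have nB: "near k v0 (\<lambda>v. (\<lambda>j. B j v) \<in> vecs N \<and> \<iota> (pt v) = pt (\<lambda>j. B j v))"
    using B unfolding represents_def by (elim conjE near_mono) (simp add: pt_in_Proj)
  have y0: "\<iota> (pt v0) = pt (\<lambda>j. B j v0)" using near_self[OF nB v0] by blast
  obtain e' K where K: "represents N k (\<iota> ` Proj {..k}) ?\<kappa> (\<lambda>j. B j v0) e' K"
    using morphism_represents[of N k "\<iota> ` Proj {..k}" ?\<kappa> "\<lambda>j. B j v0"] \<iota> y0 pt_in_Proj[OF v0]
    unfolding closed_immersion_def by (metis imageI)
  then have hK: "homog N e' (K j)" for j by (simp add: represents_def)
  have "near k v0 (\<lambda>v. pt (\<lambda>j. B j v) \<in> \<iota> ` Proj {..k} \<longrightarrow> (\<lambda>j. K j (\<lambda>j. B j v)) \<in> vecs k \<and>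
      ?\<kappa> (pt (\<lambda>j. B j v)) = pt (\<lambda>j. K j (\<lambda>j. B j v)))"
  proof (rule near_comp[where G = B and l = N])
    show "near N (\<lambda>j. B j v0) (\<lambda>y. pt y \<in> \<iota> ` Proj {..k} \<longrightarrow> (\<lambda>j. K j y) \<in> vecs k \<and>
        ?\<kappa> (pt y) = pt (\<lambda>j. K j y))"
      using K unfolding represents_def by (rule conjunct2)
    show "near k v0 (\<lambda>v. (\<lambda>j. B j v) \<in> vecs N)" using nB by (rule near_mono) simp
  qed (rule hB)
  from near_conj[OF this nB]
  have nK: "near k v0 (\<lambda>v. \<exists>c. c \<noteq> 0 \<and> (\<lambda>j. K j (\<lambda>j. B j v)) = (\<lambda>j. c * v j))"
  proof (rule near_mono)
    fix v assume v: "v \<in> vecs k" and *: "(pt (\<lambda>j. B j v) \<in> \<iota> ` Proj {..k} \<longrightarrow>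
        (\<lambda>j. K j (\<lambda>j. B j v)) \<in> vecs k \<and> ?\<kappa> (pt (\<lambda>j. B j v)) = pt (\<lambda>j. K j (\<lambda>j. B j v))) \<and>
        (\<lambda>j. B j v) \<in> vecs N \<and> \<iota> (pt v) = pt (\<lambda>j. B j v)"
    then have "pt (\<lambda>j. B j v) \<in> \<iota> ` Proj {..k}" using pt_in_Proj[OF v] by (metis imageI)
    then have "?\<kappa> (\<iota> (pt v)) = pt (\<lambda>j. K j (\<lambda>j. B j v))" using * by simp
    moreover have "?\<kappa> (\<iota> (pt v)) = pt v"
      using \<iota> pt_in_Proj[OF v] unfolding closed_immersion_def by (simp add: inv_into_f_f)
    ultimately have "pt (\<lambda>j. K j (\<lambda>j. B j v)) = pt v" by simp
    then show "\<exists>c. c \<noteq> 0 \<and> (\<lambda>j. K j (\<lambda>j. B j v)) = (\<lambda>j. c * v j)" by (rule pt_eq_imp)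
  qed
  define \<kappa> where "\<kappa> j = K j (\<lambda>j. B j v0)" for j
  obtain c where c: "c \<noteq> 0" "\<And>j. \<kappa> j = c * v0 j"
    using near_self[OF nK v0] unfolding \<kappa>_def by metis
  have dK: "((\<lambda>t. K i (\<lambda>j. B j (?l t))) has_field_derivative \<mu> * (of_nat e' * \<kappa> i)) (at 0)" for i
  proof -
    obtain H where H: "gradient N (K i) H" using homog_gradient[OF hK] by blast
    have "((\<lambda>t. K i (\<lambda>j. B j (?l t))) has_field_derivative (\<Sum>j\<le>N. H j (\<lambda>j. B j (?l 0)) * b j)) (at 0)"
      by (rule gradientD[OF H]) (rule b)
    moreover have "(\<Sum>j\<le>N. H j (\<lambda>j. B j (?l 0)) * b j) = \<mu> * (\<Sum>j\<le>N. H j (\<lambda>j. B j v0) * B j v0)"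
      unfolding sum_distrib_left by (rule sum.cong) (simp_all add: bB)
    ultimately show ?thesis using euler[OF hK H, of "\<lambda>j. B j v0"] by (simp add: \<kappa>_def)
  qed
  \<comment> \<open>Differentiate the two-by-two minors of \<open>K(B(v))\<close> and \<open>v\<close>; the terms with \<open>\<mu>\<close> cancel.\<close>
  have wij: "\<kappa> i * w j = \<kappa> j * w i" for i j
  proof -
    let ?f = "\<lambda>t. K i (\<lambda>j. B j (?l t)) * ?l t j - K j (\<lambda>j. B j (?l t)) * ?l t i"
    have "(?f has_field_derivative (\<mu> * (of_nat e' * \<kappa> i) * ?l 0 j + w j * K i (\<lambda>j. B j (?l 0))
       - (\<mu> * (of_nat e' * \<kappa> j) * ?l 0 i + w i * K j (\<lambda>j. B j (?l 0))))) (at 0)"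
      by (intro DERIV_diff DERIV_mult dK) (auto intro!: derivative_eq_intros)
    moreover have "\<forall>\<^sub>F t in at 0. \<exists>c. c \<noteq> 0 \<and> (\<lambda>j. K j (\<lambda>j. B j (?l t))) = (\<lambda>j. c * ?l t j)"
      using near_eventually[OF nK line_tendsto line_in_vecs[OF v0]] w(1) by (simp add: vecs_def)
    then have "\<forall>\<^sub>F t in at 0. ?f t = 0"
    proof eventually_elim
      case (elim t)
      then obtain c where "\<And>j. K j (\<lambda>j. B j (?l t)) = c * ?l t j" by metis
      then show ?case by simp
    qed
    then have "\<forall>\<^sub>F t in nhds 0. ?f t = 0"
      using c(2) unfolding eventually_nhds_conv_at by (simp add: \<kappa>_def)
    then have "(?f has_field_derivative 0) (at 0)"
      by (subst DERIV_cong_ev[OF refl _ refl, of _ "\<lambda>t. 0"]) auto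
    ultimately have "\<mu> * (of_nat e' * \<kappa> i) * ?l 0 j + w j * K i (\<lambda>j. B j (?l 0))
       - (\<mu> * (of_nat e' * \<kappa> j) * ?l 0 i + w i * K j (\<lambda>j. B j (?l 0))) = 0"
      by (rule DERIV_unique)
    then show ?thesis by (simp add: \<kappa>_def[symmetric] c(2) algebra_simps)
  qed
  obtain i where i: "i \<le> k" "v0 i \<noteq> 0" using v0 by (auto simp: vecs_def)
  have "w j = (w i / v0 i) * v0 j" for j
    using wij[of i j] c i(2) by (simp add: field_simps)
  then show False using orthogonal_not_multiple[OF v0 w, of "w i / v0 i"] by blast
qed

text \<open>A map \<open>\<Psi>\<close> whose image lies in a hypersurface degenerates at every point. Let the form \<open>s\<close> of least
  degree vanish on the image. At a generic point some partial derivative \<open>R p\<close> of \<open>s\<close> does not vanish on the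
  image, so the gradient of \<open>s\<close> gives a linear relation between the components of the derivative of \<open>\<Psi>\<close>,
  which determines the component \<open>p\<close> by the others; \<open>tangent_system\<close> finds a direction for
  these. Arbitrary points are limits of generic ones, and unit vectors have convergent subsequences.\<close>

lemma degenerate_direction:
  assumes \<Psi>: "\<And>j. homog k e (\<Psi> j)" and r: "homog k b r" "r \<noteq> (\<lambda>v. 0)" "\<And>v. r (\<lambda>j. \<Psi> j v) = 0"
    and H: "\<And>j. gradient k (\<Psi> j) (H j)" "\<And>i j. homog k e' (H j i)"
    and v0: "v0 \<in> vecs k" and nz: "near k v0 (\<lambda>v. (\<lambda>j. \<Psi> j v) \<in> vecs k)"
  obtains w c where "w \<in> vecs k" "(\<Sum>j\<le>k. cnj (v0 j) * w j) = 0"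
    "\<And>j. j \<le> k \<Longrightarrow> (\<Sum>i\<le>k. H j i v0 * w i) = c * \<Psi> j v0"
proof -
  define V where "V b \<longleftrightarrow> (\<exists>r. homog k b r \<and> r \<noteq> (\<lambda>v. 0) \<and> (\<forall>v. r (\<lambda>j. \<Psi> j v) = 0))" for b
  have "V b" using r by (auto simp: V_def)
  define m where "m = (LEAST b. V b)"
  have m: "V m" "\<And>j. j < m \<Longrightarrow> \<not> V j"
    using \<open>V b\<close> unfolding m_def by (auto intro: LeastI dest: not_less_Least)
  obtain s where s: "homog k m s" "s \<noteq> (\<lambda>v. 0)" "\<And>v. s (\<lambda>j. \<Psi> j v) = 0"
    using m(1) by (auto simp: V_def)
  have m0: "m \<noteq> 0"
  proof
    assume "m = 0"
    then have "s v = s (\<lambda>j. \<Psi> j v0)" for v using homog_degree_0[OF s(1)] by blast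
    then show False using s(2,3) by auto
  qed
  obtain R where R: "gradient k s R" "\<And>i. homog k (m - 1) (R i)" using homog_gradient[OF s(1)] by blast
  \<comment> \<open>By Euler's formula the value of \<open>\<Psi>\<close> satisfies the linear relation that the gradient of \<open>s\<close> imposes on its derivative.\<close>
  have eul: "(\<Sum>j\<le>k. R j (\<lambda>j. \<Psi> j v) * \<Psi> j v) = 0" for v
    using euler[OF s(1) R(1), of "\<lambda>j. \<Psi> j v"] s(3) by simp
  have "\<exists>p\<le>k. R p \<noteq> (\<lambda>v. 0)"
  proof (rule ccontr)
    assume "\<not> ?thesis"
    then have "of_nat m * s v = 0" for v using euler[OF s(1) R(1), of v] by simp
    then have "s v = 0" for v using m0 by simp
    then show False using s(2) by blast
  qed
  then obtain p where p: "p \<le> k" "R p \<noteq> (\<lambda>v. 0)" by blast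
  have "\<not> (\<forall>v. R p (\<lambda>j. \<Psi> j v) = 0)"
    using m(2)[of "m - 1"] m0 p(2) R(2)[of p] unfolding V_def by auto
  then obtain z where z: "R p (\<lambda>j. \<Psi> j z) \<noteq> 0" by blast
  have hf: "homog k ((m - 1) * e) (\<lambda>v. R p (\<lambda>j. \<Psi> j v))"
    by (rule homog_comp[OF R(2)]) (rule \<Psi>)
  \<comment> \<open>The truncation keeps the line from \<open>v0\<close> to \<open>z'\<close> in the span of the cone.\<close>
  define z' where "z' j = (if j \<le> k then z j else 0)" for j
  have z': "R p (\<lambda>j. \<Psi> j z') \<noteq> 0"
    using homog_cong[OF hf, of z' z] z by (simp add: z'_def)
  let ?l = "\<lambda>t i. v0 i + t * (z' i - v0 i)"
  have "finite {t. R p (\<lambda>j. \<Psi> j (?l t)) = 0}"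
    by (rule homog_line_finite_zeros[OF hf, where t = 1]) (use z' in simp)
  then have "open (- ({t. R p (\<lambda>j. \<Psi> j (?l t)) = 0} - {0}))"
    by (intro open_Compl finite_imp_closed finite_Diff)
  then have evR: "\<forall>\<^sub>F t in at 0. R p (\<lambda>j. \<Psi> j (?l t)) \<noteq> 0"
    unfolding eventually_at_topological
    by (intro exI[of _ "- ({t. R p (\<lambda>j. \<Psi> j (?l t)) = 0} - {0})"]) auto
  have lv: "\<forall>\<^sub>F t in at 0. ?l t \<in> vecs k"
    by (rule line_in_vecs[OF v0]) (use v0 in \<open>auto simp: z'_def vecs_def\<close>)
  have good: "\<exists>w\<in>unit_sphere k. (\<Sum>j\<le>k. cnj (v j) * w j) = 0 \<and>
      (\<forall>i\<le>k. \<forall>j\<le>k. \<Psi> i v * (\<Sum>l\<le>k. H j l v * w l) = \<Psi> j v * (\<Sum>l\<le>k. H i l v * w l))"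
    if v: "v \<in> vecs k" "R p (\<lambda>j. \<Psi> j v) \<noteq> 0" "(\<lambda>j. \<Psi> j v) \<in> vecs k" for v
  proof -
    have rem: "(\<Sum>j\<le>k. R j (\<lambda>j. \<Psi> j v) * x j) =
        R p (\<lambda>j. \<Psi> j v) * x p + (\<Sum>j\<in>{..k} - {p}. R j (\<lambda>j. \<Psi> j v) * x j)" for x
      using p(1) by (simp add: sum.remove)
    have "\<exists>i\<in>{..k} - {p}. \<Psi> i v \<noteq> 0"
    proof (rule ccontr)
      assume *: "\<not> ?thesis"
      then have "(\<Sum>j\<in>{..k} - {p}. R j (\<lambda>j. \<Psi> j v) * \<Psi> j v) = 0" by (intro sum.neutral) auto
      then have "\<Psi> p v = 0" using rem[of "\<lambda>j. \<Psi> j v"] eul[of v] v(2) by simp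
      then show False using * v(3) by (auto simp: vecs_def)
    qed
    then obtain w c where w: "w \<in> vecs k" "(\<Sum>j\<le>k. cnj (v j) * w j) = 0"
        "\<And>i. i \<in> {..k} - {p} \<Longrightarrow> (\<Sum>j\<le>k. H i j v * w j) = c * \<Psi> i v"
      using tangent_system[of "{..k} - {p}" k "\<lambda>i. \<Psi> i v" v "\<lambda>i j. H i j v"] v(1) p(1) by auto
    have "((\<lambda>t. s (\<lambda>j. \<Psi> j (\<lambda>i. v i + t * w i))) has_field_derivative
        (\<Sum>j\<le>k. R j (\<lambda>j. \<Psi> j (\<lambda>i. v i + 0 * w i)) * (\<Sum>l\<le>k. H j l v * w l))) (at 0)"
      by (rule gradientD[OF R(1)]) (rule gradient_line[OF H(1)])
    then have "((\<lambda>t. 0) has_field_derivative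
        (\<Sum>j\<le>k. R j (\<lambda>j. \<Psi> j v) * (\<Sum>l\<le>k. H j l v * w l))) (at (0::complex))"
      using s(3) by simp
    then have "(\<Sum>j\<le>k. R j (\<lambda>j. \<Psi> j v) * (\<Sum>l\<le>k. H j l v * w l)) = 0"
      using DERIV_unique DERIV_const by blast
    moreover have "(\<Sum>j\<in>{..k} - {p}. R j (\<lambda>j. \<Psi> j v) * (\<Sum>l\<le>k. H j l v * w l))
        = (\<Sum>j\<in>{..k} - {p}. R j (\<lambda>j. \<Psi> j v) * (c * \<Psi> j v))"
      by (rule sum.cong) (simp_all only: w(3))
    then have "(\<Sum>j\<in>{..k} - {p}. R j (\<lambda>j. \<Psi> j v) * (\<Sum>l\<le>k. H j l v * w l))
        = c * (\<Sum>j\<in>{..k} - {p}. R j (\<lambda>j. \<Psi> j v) * \<Psi> j v)"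
      by (simp only: sum_distrib_left mult.left_commute)
    ultimately have e1: "R p (\<lambda>j. \<Psi> j v) * (\<Sum>l\<le>k. H p l v * w l)
        + c * (\<Sum>j\<in>{..k} - {p}. R j (\<lambda>j. \<Psi> j v) * \<Psi> j v) = 0"
      using rem[of "\<lambda>j. \<Sum>l\<le>k. H j l v * w l"] by (simp only:)
    have "(\<Sum>j\<in>{..k} - {p}. R j (\<lambda>j. \<Psi> j v) * \<Psi> j v) = - (R p (\<lambda>j. \<Psi> j v) * \<Psi> p v)"
      using rem[of "\<lambda>j. \<Psi> j v"] eul[of v] by (simp only: eq_neg_iff_add_eq_0 add.commute)
    with e1 have "R p (\<lambda>j. \<Psi> j v) * (\<Sum>l\<le>k. H p l v * w l) = R p (\<lambda>j. \<Psi> j v) * (c * \<Psi> p v)"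
      by (simp only:) (simp add: mult_ac)
    then have "(\<Sum>l\<le>k. H p l v * w l) = c * \<Psi> p v" using v(2) by simp
    then have all: "(\<Sum>l\<le>k. H j l v * w l) = c * \<Psi> j v" if "j \<le> k" for j
      using w(3)[of j] that by (cases "j = p") auto
    obtain a where a: "a > 0" "(\<lambda>i. complex_of_real a * w i) \<in> unit_sphere k"
      using normalize[OF w(1)] .
    let ?w = "\<lambda>i. complex_of_real a * w i"
    have sc: "(\<Sum>j\<le>k. x j * ?w j) = complex_of_real a * (\<Sum>j\<le>k. x j * w j)" for x
      by (simp add: sum_distrib_left mult_ac)
    show ?thesis
    proof (intro bexI[of _ ?w] conjI allI impI)
      show "(\<Sum>j\<le>k. cnj (v j) * ?w j) = 0" by (simp only: sc w(2) mult_zero_right)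
      show "\<Psi> i v * (\<Sum>l\<le>k. H j l v * ?w l) = \<Psi> j v * (\<Sum>l\<le>k. H i l v * ?w l)"
        if "i \<le> k" "j \<le> k" for i j
        unfolding sc all[OF that(1)] all[OF that(2)] by simp
    qed (rule a(2))
  qed
  define t where "t n = complex_of_real (inverse (real (Suc n)))" for n
  have "t n \<noteq> 0" for n unfolding t_def of_real_eq_0_iff by simp
  moreover have "t \<longlonglongrightarrow> 0"
    using tendsto_of_real[OF LIMSEQ_inverse_real_of_nat] unfolding t_def[abs_def] of_real_0 .
  ultimately have t: "filterlim t (at 0) sequentially"
    by (simp add: filterlim_at)
  define v where "v n = ?l (t n)" for n
  have vl: "v \<longlonglongrightarrow> v0" unfolding v_def by (rule filterlim_compose[OF line_tendsto t])
  have "\<forall>\<^sub>F t in at 0. ?l t \<in> vecs k \<and> R p (\<lambda>j. \<Psi> j (?l t)) \<noteq> 0 \<and> (\<lambda>j. \<Psi> j (?l t)) \<in> vecs k"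
    using lv evR near_eventually[OF nz line_tendsto lv] by eventually_elim blast
  then have ev: "\<forall>\<^sub>F n in sequentially. v n \<in> vecs k \<and> R p (\<lambda>j. \<Psi> j (v n)) \<noteq> 0 \<and> (\<lambda>j. \<Psi> j (v n)) \<in> vecs k"
    unfolding v_def using t by (rule eventually_compose_filterlim)
  obtain u0 where u0: "u0 \<in> unit_sphere k" using normalize[OF vecs_nonempty] by blast
  define T where "T v w \<longleftrightarrow> (\<Sum>j\<le>k. cnj (v j) * w j) = 0 \<and>
      (\<forall>i\<le>k. \<forall>j\<le>k. \<Psi> i v * (\<Sum>l\<le>k. H j l v * w l) = \<Psi> j v * (\<Sum>l\<le>k. H i l v * w l))" for v w
  have "\<exists>w. w \<in> unit_sphere k \<and> (v n \<in> vecs k \<and> R p (\<lambda>j. \<Psi> j (v n)) \<noteq> 0 \<and> (\<lambda>j. \<Psi> j (v n)) \<in> vecs k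
      \<longrightarrow> T (v n) w)" for n
    using good[of "v n"] u0 unfolding T_def by blast
  then obtain w where w: "\<And>n. w n \<in> unit_sphere k"
    "\<And>n. v n \<in> vecs k \<and> R p (\<lambda>j. \<Psi> j (v n)) \<noteq> 0 \<and> (\<lambda>j. \<Psi> j (v n)) \<in> vecs k \<Longrightarrow> T (v n) (w n)"
    by metis
  have evT: "\<forall>\<^sub>F n in sequentially. T (v n) (w n)"
    using ev by eventually_elim (rule w(2))
  obtain w0 \<rho> where w0: "w0 \<in> unit_sphere k" "strict_mono \<rho>" "(w \<circ> \<rho>) \<longlonglongrightarrow> w0"
    using compact_imp_seq_compact[OF compact_unit_sphere[of k]] w(1) unfolding seq_compact_def by metis
  have vl': "(\<lambda>n. v (\<rho> n)) \<longlonglongrightarrow> v0"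
    using LIMSEQ_subseq_LIMSEQ[OF vl w0(2)] by (simp add: comp_def)
  have evT': "\<forall>\<^sub>F n in sequentially. T (v (\<rho> n)) (w (\<rho> n))"
    using evT w0(2) by (rule eventually_subseq[rotated])
  have lim_v: "(\<lambda>n. v (\<rho> n) j) \<longlonglongrightarrow> v0 j" and lim_w: "(\<lambda>n. w (\<rho> n) j) \<longlonglongrightarrow> w0 j" for j
    using vl' w0(3) unfolding tendsto_fun_iff by (auto simp: comp_def)
  have lim_P: "(\<lambda>n. \<Psi> j (v (\<rho> n))) \<longlonglongrightarrow> \<Psi> j v0" for j by (rule homog_tendsto[OF \<Psi> vl'])
  have limH: "(\<lambda>n. H j i (v (\<rho> n))) \<longlonglongrightarrow> H j i v0" for i j by (rule homog_tendsto[OF H(2) vl'])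
  have "(\<lambda>n. \<Sum>j\<le>k. cnj (v (\<rho> n) j) * w (\<rho> n) j) \<longlonglongrightarrow> (\<Sum>j\<le>k. cnj (v0 j) * w0 j)"
    by (intro tendsto_intros lim_v lim_w)
  moreover have "\<forall>\<^sub>F n in sequentially. (\<Sum>j\<le>k. cnj (v (\<rho> n) j) * w (\<rho> n) j) = 0"
    using evT' by eventually_elim (simp add: T_def)
  ultimately have orth: "(\<Sum>j\<le>k. cnj (v0 j) * w0 j) = 0"
    using tendsto_unique[OF sequentially_bot _ tendsto_eventually] by blast
  have cross: "\<Psi> i v0 * (\<Sum>l\<le>k. H j l v0 * w0 l) = \<Psi> j v0 * (\<Sum>l\<le>k. H i l v0 * w0 l)"
    if ij: "i \<le> k" "j \<le> k" for i j
  proof (rule tendsto_unique[OF sequentially_bot])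
    show "(\<lambda>n. \<Psi> i (v (\<rho> n)) * (\<Sum>l\<le>k. H j l (v (\<rho> n)) * w (\<rho> n) l))
        \<longlonglongrightarrow> \<Psi> i v0 * (\<Sum>l\<le>k. H j l v0 * w0 l)"
      by (intro tendsto_intros lim_P limH lim_w)
    have "(\<lambda>n. \<Psi> j (v (\<rho> n)) * (\<Sum>l\<le>k. H i l (v (\<rho> n)) * w (\<rho> n) l))
        \<longlonglongrightarrow> \<Psi> j v0 * (\<Sum>l\<le>k. H i l v0 * w0 l)"
      by (intro tendsto_intros lim_P limH lim_w)
    moreover have "\<forall>\<^sub>F n in sequentially. \<Psi> i (v (\<rho> n)) * (\<Sum>l\<le>k. H j l (v (\<rho> n)) * w (\<rho> n) l)
        = \<Psi> j (v (\<rho> n)) * (\<Sum>l\<le>k. H i l (v (\<rho> n)) * w (\<rho> n) l)"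
      using evT' by eventually_elim (use ij in \<open>auto simp: T_def\<close>)
    ultimately show "(\<lambda>n. \<Psi> i (v (\<rho> n)) * (\<Sum>l\<le>k. H j l (v (\<rho> n)) * w (\<rho> n) l))
        \<longlonglongrightarrow> \<Psi> j v0 * (\<Sum>l\<le>k. H i l v0 * w0 l)"
      using tendsto_cong by fast
  qed
  obtain i where i: "i \<le> k" "\<Psi> i v0 \<noteq> 0" using near_self[OF nz v0] by (auto simp: vecs_def)
  show thesis
  proof (rule that)
    show "w0 \<in> vecs k" using w0(1) unit_sphere_subset by blast
    show "(\<Sum>l\<le>k. H j l v0 * w0 l) = (\<Sum>l\<le>k. H i l v0 * w0 l) / \<Psi> i v0 * \<Psi> j v0" if "j \<le> k" for j
      using cross[OF i(1) that] i(2) by (simp add: field_simps)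
  qed (rule orth)
qed

section \<open>The metric of a very ample line bundle\<close>

lemma represents_near:
  assumes "represents k l (Proj {..k}) g v0 e G"
  shows "near k v0 (\<lambda>v. (\<lambda>j. G j v) \<in> vecs l \<and> g (pt v) = pt (\<lambda>j. G j v))"
  using assms unfolding represents_def by (elim conjE near_mono) (simp add: pt_in_Proj)

lemma line_bundle_patch:
  assumes "is_line_bundle {..k::nat} (Proj {..k}) L" "a \<in> idx L"
  shows "openin (zariski {..k}) (patch L a)" "patch L a \<subseteq> Proj {..k}"
  using assms unfolding is_line_bundle_def subtopology_Proj by blast+

text \<open>On \<open>A\<close> and near \<open>v0\<close>, \<open>\<sigma>\<close> is the norm of the coordinates \<open>B\<close> up to a nonvanishing rational factor.\<close>

definition metric_at ::
  "nat \<Rightarrow> nat \<Rightarrow> nat point set \<Rightarrow> (nat point \<Rightarrow> real) \<Rightarrow> (nat \<Rightarrow> complex) \<Rightarrow>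
   (nat \<Rightarrow> (nat \<Rightarrow> complex) \<Rightarrow> complex) \<Rightarrow> bool" where
  "metric_at k N A \<sigma> v0 B \<longleftrightarrow> (\<exists>P Q d e. homog k d P \<and> homog k e Q \<and>
     near k v0 (\<lambda>v. pt v \<in> A \<longrightarrow> P v \<noteq> 0 \<and> Q v \<noteq> 0 \<and>
       \<sigma> (pt v) = cmod (P v / Q v) * L2_set (\<lambda>j. cmod (B j v)) {..N}))"

text \<open>The Fubini-Study metric on \<open>O(1)\<close>, transported to \<open>L\<^sup>n\<close>: the norm \<open>\<parallel>y\<parallel> / \<bar>y\<^sub>c\<bar>\<close> in the patch \<open>y\<^sub>c \<noteq> 0\<close> is
  divided by the isomorphism \<open>u c a\<close>. The result depends only on the patch \<open>a\<close> of \<open>L\<close> and changes by the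
  absolute value of the transition function of \<open>L\<^sup>n\<close>.\<close>

lemma very_ample_metric:
  assumes \<iota>: "morphism {..k} {..N} (Proj {..k}) \<iota>"
    and iso: "line_bundle_iso {..k} (tensor_power L n) (pullback (Proj {..k}) \<iota> (twisting N))"
    and L: "is_line_bundle {..k} (Proj {..k}) L"
  obtains \<sigma> where
    "\<And>a x. a \<in> idx L \<Longrightarrow> x \<in> patch L a \<Longrightarrow> \<sigma> a x > 0"
    "\<And>a b x. a \<in> idx L \<Longrightarrow> b \<in> idx L \<Longrightarrow> x \<in> patch L a \<inter> patch L b \<Longrightarrow>
       \<sigma> a x = cmod (transition L a b x) ^ n * \<sigma> b x"
    "\<And>a v0 e B. a \<in> idx L \<Longrightarrow> v0 \<in> vecs k \<Longrightarrow> pt v0 \<in> patch L a \<Longrightarrow>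
       represents k N (Proj {..k}) \<iota> v0 e B \<Longrightarrow> metric_at k N (patch L a) (\<sigma> a) v0 B"
proof -
  define y where "y x = rep (\<iota> x)" for x
  let ?V = "\<lambda>c. {x \<in> Proj {..k}. \<iota> x \<in> Proj {..N} \<and> y x c \<noteq> 0}"
  obtain u where
    u: "\<And>a c. a \<in> idx L \<Longrightarrow> c \<le> N \<Longrightarrow>
      regular_unit {..k} (patch L a \<inter> ?V c) (u c a)" and
    eq: "\<And>a b c d x. a \<in> idx L \<Longrightarrow> b \<in> idx L \<Longrightarrow> c \<le> N \<Longrightarrow> d \<le> N \<Longrightarrow>
      x \<in> patch L a \<inter> patch L b \<Longrightarrow> x \<in> Proj {..k} \<Longrightarrow> \<iota> x \<in> Proj {..N} \<Longrightarrow> y x c \<noteq> 0 \<Longrightarrow> y x d \<noteq> 0 \<Longrightarrow>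
      u c a x * transition L a b x ^ n = y x d / y x c * u d b x"
  proof -
    from iso obtain u where 1:
      "\<forall>a\<in>idx L. \<forall>c\<in>{..N}. regular_unit {..k} (patch L a \<inter>
         ?V c) (u c a)" and 2:
      "\<forall>a\<in>idx L. \<forall>b\<in>idx L. \<forall>c\<in>{..N}. \<forall>d\<in>{..N}. \<forall>x\<in>patch L a \<inter> patch L b \<inter>
        ?V c \<inter> ?V d.
         u c a x * transition L a b x ^ n = y x d / y x c * u d b x"
      unfolding line_bundle_iso_def tensor_power_def pullback_def twisting_def y_def
      by (elim exE conjE) (simp add: that)
    show thesis
    proof (rule that)
      show "regular_unit {..k} (patch L a \<inter> ?V c) (u c a)"
        if "a \<in> idx L" "c \<le> N" for a c using 1 that by simp
      show "u c a x * transition L a b x ^ n = y x d / y x c * u d b x"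
        if "a \<in> idx L" "b \<in> idx L" "c \<le> N" "d \<le> N" "x \<in> patch L a \<inter> patch L b" "x \<in> Proj {..k}"
          "\<iota> x \<in> Proj {..N}" "y x c \<noteq> 0" "y x d \<noteq> 0" for a b c d x
        by (rule 2[rule_format]) (use that in simp_all)
    qed
  qed
  define valid where "valid c x \<longleftrightarrow> c \<le> N \<and> \<iota> x \<in> Proj {..N} \<and> y x c \<noteq> 0" for c x
  have \<iota>P: "\<iota> x \<in> Proj {..N}" if x: "x \<in> Proj {..k}" for x
  proof -
    obtain v where v: "v \<in> vecs k" "x = pt v" using x by (auto simp: Proj_eq_image)
    then obtain e B where "represents k N (Proj {..k}) \<iota> v e B"
      using morphism_represents[OF \<iota>] x by blast
    from near_self[OF represents_near[OF this] v(1)] show ?thesis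
      using v(2) pt_in_Proj by auto
  qed
  have ex_valid: "\<exists>c. valid c x" if "x \<in> Proj {..k}" for x
    using rep_in_vecs(1)[OF \<iota>P[OF that]] \<iota>P[OF that] by (auto simp: valid_def y_def vecs_def)
  have unz: "u c a x \<noteq> 0" if "a \<in> idx L" "x \<in> patch L a" "valid c x" for a c x
    using u[OF that(1), of c] line_bundle_patch(2)[OF L that(1)] that
    unfolding regular_unit_def valid_def by blast
  define \<tau> where "\<tau> c a x = L2_set (\<lambda>j. cmod (y x j)) {..N} / (cmod (y x c) * cmod (u c a x))" for c a x
  have trans: "\<tau> c a x = cmod (transition L a b x) ^ n * \<tau> d b x"
    if ab: "a \<in> idx L" "b \<in> idx L" "x \<in> patch L a \<inter> patch L b" and cd: "valid c x" "valid d x" for a b c d x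
  proof -
    have x: "x \<in> Proj {..k}" using ab line_bundle_patch(2)[OF L] by blast
    have nz: "u c a x \<noteq> 0" "u d b x \<noteq> 0" "y x c \<noteq> 0" "y x d \<noteq> 0"
      using unz ab cd by (auto simp: valid_def)
    have "u c a x * transition L a b x ^ n = y x d / y x c * u d b x"
      using eq[OF ab(1,2), of c d x] ab(3) cd x unfolding valid_def by blast
    then have "y x c * u c a x * transition L a b x ^ n = y x d * u d b x"
      using nz by (simp add: field_simps)
    then have "cmod (y x c * u c a x * transition L a b x ^ n) = cmod (y x d * u d b x)" by simp
    then have e: "cmod (y x c) * cmod (u c a x) * cmod (transition L a b x) ^ n = cmod (y x d) * cmod (u d b x)"
      by (simp only: norm_mult norm_power)
    have "cmod (transition L a b x) ^ n \<noteq> 0"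
      using e nz by (metis mult_eq_0_iff norm_eq_zero)
    then have "X / s = cmod (transition L a b x) ^ n * (X / (s * cmod (transition L a b x) ^ n))" for X s :: real
      by simp
    from this[of "L2_set (\<lambda>j. cmod (y x j)) {..N}" "cmod (y x c) * cmod (u c a x)"]
    show ?thesis unfolding \<tau>_def e .
  qed
  \<comment> \<open>The isomorphism itself forces the transition function from a patch to itself to be trivial.\<close>
  have trans_refl: "cmod (transition L a a x) ^ n = 1" if "a \<in> idx L" "x \<in> patch L a" for a x
  proof -
    have x: "x \<in> Proj {..k}" using that line_bundle_patch(2)[OF L] by blast
    then obtain c where c: "valid c x" using ex_valid by blast
    have "u c a x * transition L a a x ^ n = y x c / y x c * u c a x"
      using eq[OF that(1,1), of c c x] that(2) c x unfolding valid_def by blast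
    then have "transition L a a x ^ n = 1" using unz[OF that c] c by (simp add: valid_def)
    then show ?thesis by (metis norm_one norm_power)
  qed
  define \<sigma> where "\<sigma> a x = \<tau> (SOME c. valid c x) a x" for a x
  have \<sigma>: "\<sigma> a x = \<tau> c a x" if "a \<in> idx L" "x \<in> patch L a" "valid c x" for a x c
    using trans[OF that(1,1), of x "SOME c. valid c x" c] that someI[of "\<lambda>c. valid c x" c]
    by (simp add: \<sigma>_def trans_refl)
  show thesis
  proof (rule that)
    fix a x assume a: "a \<in> idx L" "x \<in> patch L a"
    then have x: "x \<in> Proj {..k}" using line_bundle_patch(2)[OF L] by blast
    then obtain c where c: "valid c x" using ex_valid by blast
    have "L2_set (\<lambda>j. cmod (y x j)) {..N} \<noteq> 0"
      using c by (auto simp: L2_set_eq_0_iff valid_def)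
    then have "L2_set (\<lambda>j. cmod (y x j)) {..N} > 0" using L2_set_nonneg[of "\<lambda>j. cmod (y x j)"] by (simp add: less_le)
    then show "\<sigma> a x > 0" using \<sigma>[OF a c] unz[OF a c] c by (simp add: \<tau>_def valid_def)
  next
    fix a b x assume a: "a \<in> idx L" "b \<in> idx L" "x \<in> patch L a \<inter> patch L b"
    then have x: "x \<in> Proj {..k}" using line_bundle_patch(2)[OF L] by blast
    then obtain c where c: "valid c x" using ex_valid by blast
    show "\<sigma> a x = cmod (transition L a b x) ^ n * \<sigma> b x"
      using trans[OF a c c] \<sigma>[of a x c] \<sigma>[of b x c] a c by simp
  next
    fix a v0 e B assume a: "a \<in> idx L" and v0: "v0 \<in> vecs k" "pt v0 \<in> patch L a"
      and B: "represents k N (Proj {..k}) \<iota> v0 e B"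
    note nB = represents_near[OF B]
    have hB: "homog k e (B j)" for j using B by (simp add: represents_def)
    have "(\<lambda>j. B j v0) \<in> vecs N" using near_self[OF nB v0(1)] by blast
    then obtain c where c: "c \<le> N" "B c v0 \<noteq> 0" by (auto simp: vecs_def)
    have valid: "valid c (pt v)" if v: "(\<lambda>j. B j v) \<in> vecs N" "\<iota> (pt v) = pt (\<lambda>j. B j v)" "B c v \<noteq> 0" for v
    proof -
      obtain s where "s \<noteq> 0" "y (pt v) = (\<lambda>j. s * B j v)"
        using rep_pt[of "\<lambda>j. B j v"] v(2) by (auto simp: y_def)
      then show ?thesis using v c(1) pt_in_Proj by (auto simp: valid_def)
    qed
    have v0': "valid c (pt v0)" using valid near_self[OF nB v0(1)] c(2) by blast
    let ?A = "patch L a \<inter> ?V c"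
    have "pt v0 \<in> ?A" using v0 v0' pt_in_Proj by (auto simp: valid_def)
    from regular_unit_represents[OF u[OF a c(1)] this] obtain i p q where
      p: "homog k i p" "homog k i q" "near k v0 (\<lambda>v. pt v \<in> ?A \<longrightarrow> p v \<noteq> 0 \<and> q v \<noteq> 0 \<and> u c a (pt v) = p v / q v)"
      by blast
    have h: "homog k i q" "homog k (i + e) (\<lambda>v. p v * B c v)"
      using p(1,2) hB homog_mult by blast+
    have "near k v0 (\<lambda>v. pt v \<in> patch L a \<longrightarrow> q v \<noteq> 0 \<and> p v * B c v \<noteq> 0 \<and>
       \<sigma> a (pt v) = cmod (q v / (p v * B c v)) * L2_set (\<lambda>j. cmod (B j v)) {..N})"
      using near_conj[OF p(3) near_conj[OF nB near_nonzero[OF hB c(2)]]]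
    proof (rule near_mono, intro impI)
      fix v assume v: "v \<in> vecs k" "pt v \<in> patch L a" and
        *: "(pt v \<in> ?A \<longrightarrow> p v \<noteq> 0 \<and> q v \<noteq> 0 \<and> u c a (pt v) = p v / q v) \<and>
          ((\<lambda>j. B j v) \<in> vecs N \<and> \<iota> (pt v) = pt (\<lambda>j. B j v)) \<and> B c v \<noteq> 0"
      then have vl: "valid c (pt v)" using valid by blast
      then have "pt v \<in> ?A" using v pt_in_Proj by (auto simp: valid_def)
      then have uu: "p v \<noteq> 0" "q v \<noteq> 0" "u c a (pt v) = p v / q v" using * by blast+
      obtain s where s: "s \<noteq> 0" "y (pt v) = (\<lambda>j. s * B j v)"
        using rep_pt[of "\<lambda>j. B j v"] * by (auto simp: y_def)
      have "L2_set (\<lambda>j. cmod (y (pt v) j)) {..N} = cmod s * L2_set (\<lambda>j. cmod (B j v)) {..N}"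
        unfolding s(2) by (simp add: norm_mult flip: L2_set_right_distrib)
      then have "\<tau> c a (pt v) = cmod (q v / (p v * B c v)) * L2_set (\<lambda>j. cmod (B j v)) {..N}"
        using s uu * by (simp add: \<tau>_def norm_mult norm_divide mult_ac)
      then show "q v \<noteq> 0 \<and> p v * B c v \<noteq> 0 \<and>
         \<sigma> a (pt v) = cmod (q v / (p v * B c v)) * L2_set (\<lambda>j. cmod (B j v)) {..N}"
        using \<sigma>[OF a v(2) vl] uu * by simp
    qed
    then show "metric_at k N (patch L a) (\<sigma> a) v0 B"
      unfolding metric_at_def using h by blast
  qed
qed

section \<open>The metric quotient of a polarization\<close>

text \<open>The isomorphism of the pullback of \<open>L\<close> by \<open>\<psi>\<close> with \<open>L\<^sup>q\<close> compares the metric \<open>\<sigma>\<close> at \<open>\<psi> x\<close> with the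
  \<open>q\<close>-th power of \<open>\<sigma>\<close> at \<open>x\<close>; the transition functions cancel, so the quotient \<open>\<Phi>\<close> is a function
  on projective space. When \<open>\<psi>\<close> is the identity, the numerator cancels one of the \<open>q\<close> factors in
  the denominator, and the constant family takes the place of the numerator.\<close>

lemma polarization_quotient:
  assumes pol: "polarizable {..k} (Proj {..k}) \<psi>"
  obtains N \<iota> q \<Phi> where "closed_immersion {..k} {..N} (Proj {..k}) \<iota>" "q > 1"
    "\<And>v e \<Psi> b B c C. v \<in> vecs k \<Longrightarrow> represents k k (Proj {..k}) \<psi> v e \<Psi> \<Longrightarrow>
       represents k N (Proj {..k}) \<iota> (\<lambda>j. \<Psi> j v) c C \<Longrightarrow> represents k N (Proj {..k}) \<iota> v b B \<Longrightarrow>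
       \<exists>P Q. metric_quotient_at k q \<Phi> v P Q {..N} (\<lambda>i w. C i (\<lambda>j. \<Psi> j w)) {..N} B"
    "\<And>v b B. (\<And>x. x \<in> Proj {..k} \<Longrightarrow> \<psi> x = x) \<Longrightarrow> v \<in> vecs k \<Longrightarrow> represents k N (Proj {..k}) \<iota> v b B \<Longrightarrow>
       \<exists>P Q. metric_quotient_at k (q - 1) \<Phi> v P Q {0} (\<lambda>i w. 1) {..N} B"
proof -
  have \<psi>: "morphism {..k} {..k} (Proj {..k}) \<psi>" using pol by (simp add: polarizable_def)
  obtain L q where L: "ample {..k} (Proj {..k}) L" "q > 1"
      "line_bundle_iso {..k} (pullback (Proj {..k}) \<psi> L) (tensor_power L q)"
    using pol unfolding polarizable_def by blast
  let ?D = "\<lambda>a. {x \<in> Proj {..k}. \<psi> x \<in> patch L a}"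
  have lb: "is_line_bundle {..k} (Proj {..k}) L" using L(1) by (simp add: ample_def)
  obtain n N \<iota> where \<iota>: "n \<ge> 1" "closed_immersion {..k} {..N} (Proj {..k}) \<iota>"
      "line_bundle_iso {..k} (tensor_power L n) (pullback (Proj {..k}) \<iota> (twisting N))"
    using L(1) unfolding ample_def very_ample_def by blast
  have \<iota>m: "morphism {..k} {..N} (Proj {..k}) \<iota>" using \<iota>(2) by (simp add: closed_immersion_def)
  obtain \<sigma> where \<sigma>: "\<And>a x. a \<in> idx L \<Longrightarrow> x \<in> patch L a \<Longrightarrow> \<sigma> a x > 0"
    "\<And>a b x. a \<in> idx L \<Longrightarrow> b \<in> idx L \<Longrightarrow> x \<in> patch L a \<inter> patch L b \<Longrightarrow>
       \<sigma> a x = cmod (transition L a b x) ^ n * \<sigma> b x"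
    "\<And>a v0 e B. a \<in> idx L \<Longrightarrow> v0 \<in> vecs k \<Longrightarrow> pt v0 \<in> patch L a \<Longrightarrow>
       represents k N (Proj {..k}) \<iota> v0 e B \<Longrightarrow> metric_at k N (patch L a) (\<sigma> a) v0 B"
    by (rule very_ample_metric[OF \<iota>m \<iota>(3) lb]) (rule that; assumption)
  obtain u where
    u: "\<And>a c. a \<in> idx L \<Longrightarrow> c \<in> idx L \<Longrightarrow>
      regular_unit {..k} (?D a \<inter> patch L c) (u c a)" and
    eq: "\<And>a b c d x. a \<in> idx L \<Longrightarrow> b \<in> idx L \<Longrightarrow> c \<in> idx L \<Longrightarrow> d \<in> idx L \<Longrightarrow> x \<in> Proj {..k} \<Longrightarrow>
      \<psi> x \<in> patch L a \<inter> patch L b \<Longrightarrow> x \<in> patch L c \<inter> patch L d \<Longrightarrow>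
      u c a x * transition L a b (\<psi> x) = transition L c d x ^ q * u d b x"
  proof -
    from L(3) obtain u where 1:
      "\<forall>a\<in>idx L. \<forall>c\<in>idx L. regular_unit {..k} ({x \<in> Proj {..k}. \<psi> x \<in> patch L a} \<inter> patch L c) (u c a)" and 2:
      "\<forall>a\<in>idx L. \<forall>b\<in>idx L. \<forall>c\<in>idx L. \<forall>d\<in>idx L. \<forall>x\<in>{x \<in> Proj {..k}. \<psi> x \<in> patch L a} \<inter>
        {x \<in> Proj {..k}. \<psi> x \<in> patch L b} \<inter> patch L c \<inter> patch L d.
         u c a x * transition L a b (\<psi> x) = transition L c d x ^ q * u d b x"
      unfolding line_bundle_iso_def tensor_power_def pullback_def
      by (elim exE conjE) (simp add: that)
    show thesis
    proof (rule that)
      show "regular_unit {..k} (?D a \<inter> patch L c) (u c a)"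
        if "a \<in> idx L" "c \<in> idx L" for a c using 1 that by simp
      show "u c a x * transition L a b (\<psi> x) = transition L c d x ^ q * u d b x"
        if "a \<in> idx L" "b \<in> idx L" "c \<in> idx L" "d \<in> idx L" "x \<in> Proj {..k}"
          "\<psi> x \<in> patch L a \<inter> patch L b" "x \<in> patch L c \<inter> patch L d" for a b c d x
        by (rule 2[rule_format]) (use that in simp_all)
    qed
  qed
  define valid where "valid a x \<longleftrightarrow> a \<in> idx L \<and> x \<in> patch L a" for a x
  have ex: "\<exists>a. valid a x" if "x \<in> Proj {..k}" for x
    using lb that unfolding is_line_bundle_def valid_def by blast
  define \<phi> where "\<phi> a c x = cmod (u c a x) ^ n * \<sigma> a (\<psi> x) / \<sigma> c x ^ q" for a c x
  have indep: "\<phi> a c x = \<phi> b d x"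
    if x: "x \<in> Proj {..k}" and v: "valid a (\<psi> x)" "valid b (\<psi> x)" "valid c x" "valid d x" for a b c d x
  proof -
    have i: "a \<in> idx L" "b \<in> idx L" "c \<in> idx L" "d \<in> idx L"
      and p: "\<psi> x \<in> patch L a \<inter> patch L b" "x \<in> patch L c \<inter> patch L d" using v by (auto simp: valid_def)
    let ?s = "transition L a b (\<psi> x)" and ?t = "transition L c d x"
    have s1: "\<sigma> a (\<psi> x) = cmod ?s ^ n * \<sigma> b (\<psi> x)" by (rule \<sigma>(2)) (use i p in auto)
    have s2: "\<sigma> c x = cmod ?t ^ n * \<sigma> d x" by (rule \<sigma>(2)) (use i p in auto)
    have "\<sigma> c x > 0" "\<sigma> d x > 0" by (rule \<sigma>(1); use i p in auto)+
    then have t: "cmod ?t ^ n \<noteq> 0" using s2 by (metis less_irrefl mult_zero_left)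
    have "u c a x * ?s = ?t ^ q * u d b x" by (rule eq) (use x i p in auto)
    then have "cmod (u c a x * ?s) ^ n = cmod (?t ^ q * u d b x) ^ n" by simp
    then have e: "cmod (u c a x) ^ n * cmod ?s ^ n = (cmod ?t ^ n) ^ q * cmod (u d b x) ^ n"
      by (simp add: norm_mult norm_power power_mult_distrib flip: power_mult) (simp add: mult.commute)
    have "\<phi> a c x = (cmod (u c a x) ^ n * cmod ?s ^ n) * \<sigma> b (\<psi> x) / ((cmod ?t ^ n) ^ q * \<sigma> d x ^ q)"
      unfolding \<phi>_def s1 s2 by (simp add: power_mult_distrib mult.assoc)
    also have "\<dots> = \<phi> b d x" unfolding e \<phi>_def using t by auto
    finally show ?thesis .
  qed
  define \<Phi> where "\<Phi> x = \<phi> (SOME a. valid a (\<psi> x)) (SOME c. valid c x) x" for x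
  have \<Phi>: "\<Phi> x = \<phi> a c x" if "x \<in> Proj {..k}" "valid a (\<psi> x)" "valid c x" for a c x
    unfolding \<Phi>_def
    by (rule indep[OF that(1) someI[where P = "\<lambda>a. valid a (\<psi> x)", OF that(2)] that(2)
        someI[where P = "\<lambda>c. valid c x", OF that(3)] that(3)])
  have u_at: "\<exists>i P Q. homog k i P \<and> homog k i Q \<and> near k v (\<lambda>w. pt w \<in> ?D a \<inter> patch L c \<longrightarrow>
        P w \<noteq> 0 \<and> Q w \<noteq> 0 \<and> u c a (pt w) = P w / Q w)"
    if "valid a (\<psi> (pt v))" "valid c (pt v)" "v \<in> vecs k" for a c v
  proof -
    have "a \<in> idx L" "c \<in> idx L" "pt v \<in> ?D a \<inter> patch L c"
      using that pt_in_Proj by (auto simp: valid_def)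
    show ?thesis
      by (rule regular_unit_represents[OF u[OF \<open>a \<in> idx L\<close> \<open>c \<in> idx L\<close>] \<open>pt v \<in> _ \<inter> _\<close>])
        (intro exI conjI; assumption)
  qed
  have open_near: "near k v (\<lambda>w. pt w \<in> patch L a)" if "valid a (pt v)" for a v
    using openin_zariski_near line_bundle_patch(1)[OF lb] that unfolding valid_def by blast
  show thesis
  proof (rule that[OF \<iota>(2) L(2)])
    fix v e \<Psi> b B c C
    assume v: "v \<in> vecs k" and \<Psi>: "represents k k (Proj {..k}) \<psi> v e \<Psi>"
      and C: "represents k N (Proj {..k}) \<iota> (\<lambda>j. \<Psi> j v) c C" and B: "represents k N (Proj {..k}) \<iota> v b B"
    note nP = represents_near[OF \<Psi>] and nB = represents_near[OF B] and nC = represents_near[OF C]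
    have h: "homog k e (\<Psi> j)" "homog k b (B j)" "homog k c (C j)" for j
      using \<Psi> B C by (simp_all add: represents_def)
    have nPv: "near k v (\<lambda>w. (\<lambda>j. \<Psi> j w) \<in> vecs k)" using nP by (rule near_mono) simp
    note comp = near_comp[where G = \<Psi> and l = k and k = k, OF _ h(1) nPv]
    have hcomp: "homog k (d * e) (\<lambda>w. f (\<lambda>j. \<Psi> j w))" if "homog k d f" for d f
      using that h(1) by (rule homog_comp)
    have P0: "(\<lambda>j. \<Psi> j v) \<in> vecs k" "\<psi> (pt v) = pt (\<lambda>j. \<Psi> j v)" using near_self[OF nP v] by auto
    obtain a where a: "valid a (pt (\<lambda>j. \<Psi> j v))" using ex pt_in_Proj[OF P0(1)] by blast
    obtain l where l: "valid l (pt v)" using ex pt_in_Proj[OF v] by blast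
    have va: "valid a (\<psi> (pt v))" using a P0(2) by simp
    obtain i p q' where p: "homog k i p" "homog k i q'"
      "near k v (\<lambda>w. pt w \<in> ?D a \<inter> patch L l \<longrightarrow>
        p w \<noteq> 0 \<and> q' w \<noteq> 0 \<and> u l a (pt w) = p w / q' w)"
      using u_at[OF va l v] by (elim exE conjE) (rule that; assumption)
    have "metric_at k N (patch L a) (\<sigma> a) (\<lambda>j. \<Psi> j v) C"
      using \<sigma>(3)[OF _ P0(1) _ C] a by (simp add: valid_def)
    then obtain P1 Q1 i1 j1 where 1: "homog k i1 P1" "homog k j1 Q1"
      "near k (\<lambda>j. \<Psi> j v) (\<lambda>v. pt v \<in> patch L a \<longrightarrow> P1 v \<noteq> 0 \<and> Q1 v \<noteq> 0 \<and>
       \<sigma> a (pt v) = cmod (P1 v / Q1 v) * L2_set (\<lambda>j. cmod (C j v)) {..N})"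
      unfolding metric_at_def by blast
    have "metric_at k N (patch L l) (\<sigma> l) v B"
      using \<sigma>(3)[OF _ v _ B] l by (simp add: valid_def)
    then obtain P2 Q2 i2 j2 where 2: "homog k i2 P2" "homog k j2 Q2"
      "near k v (\<lambda>v. pt v \<in> patch L l \<longrightarrow> P2 v \<noteq> 0 \<and> Q2 v \<noteq> 0 \<and>
       \<sigma> l (pt v) = cmod (P2 v / Q2 v) * L2_set (\<lambda>j. cmod (B j v)) {..N})"
      unfolding metric_at_def by blast
    let ?C = "\<lambda>w. L2_set (\<lambda>i. cmod (C i (\<lambda>j. \<Psi> j w))) {..N}" and ?B = "\<lambda>w. L2_set (\<lambda>j. cmod (B j w)) {..N}"
    let ?P = "\<lambda>w. p w ^ n * P1 (\<lambda>j. \<Psi> j w) * Q2 w ^ q" and ?Q = "\<lambda>w. q' w ^ n * Q1 (\<lambda>j. \<Psi> j w) * P2 w ^ q"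
    have hPQ: "\<exists>d. homog k d ?P" "\<exists>d. homog k d ?Q"
      using p(1,2) 1(1,2) 2(1,2) homog_mult homog_power hcomp by meson+
    have main: "near k v (\<lambda>w. ?P w \<noteq> 0 \<and> ?Q w \<noteq> 0 \<and> \<Phi> (pt w) = cmod (?P w / ?Q w) *
        ?C w / ?B w ^ q)"
      using near_conj[OF near_conj[OF near_conj[OF p(3) comp[OF 1(3)]] near_conj[OF 2(3) nP]]
          near_conj[OF comp[OF open_near[OF a]] open_near[OF l]]]
    proof (rule near_mono, elim conjE)
      fix w assume w: "w \<in> vecs k"
        and m: "(\<lambda>j. \<Psi> j w) \<in> vecs k" "\<psi> (pt w) = pt (\<lambda>j. \<Psi> j w)"
          "pt (\<lambda>j. \<Psi> j w) \<in> patch L a" "pt w \<in> patch L l"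
        and p': "pt w \<in> ?D a \<inter> patch L l \<longrightarrow>
          p w \<noteq> 0 \<and> q' w \<noteq> 0 \<and> u l a (pt w) = p w / q' w"
        and 1: "pt (\<lambda>j. \<Psi> j w) \<in> patch L a \<longrightarrow> P1 (\<lambda>j. \<Psi> j w) \<noteq> 0 \<and> Q1 (\<lambda>j. \<Psi> j w) \<noteq> 0 \<and>
          \<sigma> a (pt (\<lambda>j. \<Psi> j w)) = cmod (P1 (\<lambda>j. \<Psi> j w) / Q1 (\<lambda>j. \<Psi> j w)) * ?C w"
        and 2: "pt w \<in> patch L l \<longrightarrow> P2 w \<noteq> 0 \<and> Q2 w \<noteq> 0 \<and>
          \<sigma> l (pt w) = cmod (P2 w / Q2 w) * ?B w"
      have nz: "p w \<noteq> 0" "q' w \<noteq> 0" "P1 (\<lambda>j. \<Psi> j w) \<noteq> 0" "Q1 (\<lambda>j. \<Psi> j w) \<noteq> 0" "P2 w \<noteq> 0" "Q2 w \<noteq> 0"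
        using m p' 1 2 pt_in_Proj[OF w] by auto
      have "\<Phi> (pt w) = \<phi> a l (pt w)"
        using \<Phi>[OF pt_in_Proj[OF w], of a l] m a l by (simp add: valid_def)
      also have "\<dots> = cmod (p w / q' w) ^ n *
          (cmod (P1 (\<lambda>j. \<Psi> j w) / Q1 (\<lambda>j. \<Psi> j w)) * ?C w) /
          (cmod (P2 w / Q2 w) * ?B w) ^ q"
        using m p' 1 2 pt_in_Proj[OF w] by (simp add: \<phi>_def)
      also have "\<dots> = cmod (?P w / ?Q w) *
        ?C w / ?B w ^ q"
        by (simp add: norm_mult norm_divide norm_power power_mult_distrib power_divide mult_ac)
      finally show "?P w \<noteq> 0 \<and> ?Q w \<noteq> 0 \<and> \<Phi> (pt w) = cmod (?P w / ?Q w) *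
        ?C w / ?B w ^ q"
        using nz by simp
    qed
    have "(\<lambda>j. B j v) \<in> vecs N" "(\<lambda>j. C j (\<lambda>j. \<Psi> j v)) \<in> vecs N"
      using near_self[OF nB v] near_self[OF nC P0(1)] by blast+
    then have "\<exists>j\<in>{..N}. B j v \<noteq> 0" "\<exists>i\<in>{..N}. C i (\<lambda>j. \<Psi> j v) \<noteq> 0" by (auto simp: vecs_def)
    moreover have "near k v (\<lambda>w. \<Phi> (pt w) = cmod (?P w / ?Q w) *
        ?C w / ?B w ^ q)"
      using main by (rule near_mono) blast
    moreover have "?P v \<noteq> 0" "?Q v \<noteq> 0" using near_self[OF main v] by blast+
    moreover have "\<exists>d. homog k d (\<lambda>w. C i (\<lambda>j. \<Psi> j w))" for i using hcomp[OF h(3)] by blast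
    moreover have "\<exists>d. homog k d (B j)" for j using h(2) by blast
    ultimately have "metric_quotient_at k q \<Phi> v ?P ?Q {..N} (\<lambda>i w. C i (\<lambda>j. \<Psi> j w)) {..N} B"
      unfolding metric_quotient_at_def using hPQ by (intro conjI) (assumption | simp)+
    then show "\<exists>P Q. metric_quotient_at k q \<Phi> v P Q {..N} (\<lambda>i w. C i (\<lambda>j. \<Psi> j w)) {..N} B"
      by blast
  next
    fix v b B
    assume id: "\<And>x. x \<in> Proj {..k} \<Longrightarrow> \<psi> x = x" and v: "v \<in> vecs k" and B: "represents k N (Proj {..k}) \<iota> v b B"
    note nB = represents_near[OF B]
    have h: "homog k b (B j)" for j using B by (simp_all add: represents_def)
    obtain l where l: "valid l (pt v)" using ex pt_in_Proj[OF v] by blast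
    have va: "valid l (\<psi> (pt v))" using l id[OF pt_in_Proj[OF v]] by simp
    obtain i p q' where p: "homog k i p" "homog k i q'"
      "near k v (\<lambda>w. pt w \<in> ?D l \<inter> patch L l \<longrightarrow>
        p w \<noteq> 0 \<and> q' w \<noteq> 0 \<and> u l l (pt w) = p w / q' w)"
      using u_at[OF va l v] by (elim exE conjE) (rule that; assumption)
    have "metric_at k N (patch L l) (\<sigma> l) v B"
      using \<sigma>(3)[OF _ v _ B] l by (simp add: valid_def)
    then obtain P2 Q2 i2 j2 where 2: "homog k i2 P2" "homog k j2 Q2"
      "near k v (\<lambda>v. pt v \<in> patch L l \<longrightarrow> P2 v \<noteq> 0 \<and> Q2 v \<noteq> 0 \<and>
       \<sigma> l (pt v) = cmod (P2 v / Q2 v) * L2_set (\<lambda>j. cmod (B j v)) {..N})"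
      unfolding metric_at_def by blast
    let ?B = "\<lambda>w. L2_set (\<lambda>j. cmod (B j w)) {..N}"
    let ?P = "\<lambda>w. p w ^ n * Q2 w ^ (q - 1)" and ?Q = "\<lambda>w. q' w ^ n * P2 w ^ (q - 1)"
    have hPQ: "\<exists>d. homog k d ?P" "\<exists>d. homog k d ?Q"
      using p(1,2) 2(1,2) homog_mult homog_power by meson+
    have main: "near k v (\<lambda>w. ?P w \<noteq> 0 \<and> ?Q w \<noteq> 0 \<and> \<Phi> (pt w) = cmod (?P w / ?Q w) *
        L2_set (\<lambda>i. cmod 1) {0::nat} / ?B w ^ (q - 1))"
      using near_conj[OF near_conj[OF p(3) 2(3)] open_near[OF l]]
    proof (rule near_mono, elim conjE)
      fix w assume w: "w \<in> vecs k" and m: "pt w \<in> patch L l"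
        and p': "pt w \<in> ?D l \<inter> patch L l \<longrightarrow>
          p w \<noteq> 0 \<and> q' w \<noteq> 0 \<and> u l l (pt w) = p w / q' w"
        and 2: "pt w \<in> patch L l \<longrightarrow> P2 w \<noteq> 0 \<and> Q2 w \<noteq> 0 \<and>
          \<sigma> l (pt w) = cmod (P2 w / Q2 w) * ?B w"
      note w' = pt_in_Proj[OF w]
      have nz: "p w \<noteq> 0" "q' w \<noteq> 0" "P2 w \<noteq> 0" "Q2 w \<noteq> 0"
        using m p' 2 w' id[OF w'] by auto
      have pos: "\<sigma> l (pt w) > 0" using \<sigma>(1) l m by (auto simp: valid_def)
      have "\<Phi> (pt w) = \<phi> l l (pt w)"
        using \<Phi>[OF w', of l l] m l id[OF w'] by (simp add: valid_def)
      also have "\<dots> = cmod (u l l (pt w)) ^ n * (\<sigma> l (pt w) / \<sigma> l (pt w) ^ q)"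
        by (simp add: \<phi>_def id[OF w'])
      also have "\<sigma> l (pt w) / \<sigma> l (pt w) ^ q = 1 / \<sigma> l (pt w) ^ (q - 1)"
        using pos L(2) by (cases q) auto
      also have "cmod (u l l (pt w)) ^ n * (1 / \<sigma> l (pt w) ^ (q - 1)) = cmod (p w / q' w) ^ n *
          (1 / (cmod (P2 w / Q2 w) * ?B w) ^ (q - 1))"
        using m p' 2 w' id[OF w'] by simp
      also have "\<dots> = cmod (?P w / ?Q w) *
        L2_set (\<lambda>i. cmod 1) {0::nat} / ?B w ^ (q - 1)"
        by (simp add: norm_mult norm_divide norm_power power_mult_distrib power_divide mult_ac)
      finally show "?P w \<noteq> 0 \<and> ?Q w \<noteq> 0 \<and> \<Phi> (pt w) = cmod (?P w / ?Q w) *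
        L2_set (\<lambda>i. cmod 1) {0::nat} / ?B w ^ (q - 1)"
        using nz by simp
    qed
    have "(\<lambda>j. B j v) \<in> vecs N" using near_self[OF nB v] by blast
    then have "\<exists>j\<in>{..N}. B j v \<noteq> 0" by (auto simp: vecs_def)
    moreover have "near k v (\<lambda>w. \<Phi> (pt w) = cmod (?P w / ?Q w) *
        L2_set (\<lambda>i. cmod 1) {0::nat} / ?B w ^ (q - 1))"
      using main by (rule near_mono) blast
    moreover have "?P v \<noteq> 0" "?Q v \<noteq> 0" using near_self[OF main v] by blast+
    moreover have "\<exists>d. homog k d (\<lambda>w. 1)" using homog_const by blast
    moreover have "\<exists>d. homog k d (B j)" for j using h by blast
    ultimately have "metric_quotient_at k (q - 1) \<Phi> v ?P ?Q {0} (\<lambda>i w. 1) {..N} B"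
      unfolding metric_quotient_at_def using hPQ by (intro conjI) (assumption | simp)+
    then show "\<exists>P Q. metric_quotient_at k (q - 1) \<Phi> v P Q {0} (\<lambda>i w. 1) {..N} B"
      by blast
  qed
qed

section \<open>Polarizable endomorphisms of projective space\<close>

text \<open>For the identity the numerator of the metric quotient is constant, hence degenerate in every
  direction.\<close>

lemma polarizable_not_identity:
  fixes k :: nat
  assumes "k \<ge> 1" and pol: "polarizable {..k} (Proj {..k}) \<psi>"
  shows "\<exists>x\<in>Proj {..k}. \<psi> x \<noteq> x"
proof (rule ccontr)
  assume "\<not> ?thesis"
  then have id: "\<psi> x = x" if "x \<in> Proj {..k}" for x using that by blast
  obtain N \<iota> q \<Phi> where \<iota>: "closed_immersion {..k} {..N} (Proj {..k}) \<iota>" and q: "q > 1"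
    and m: "\<And>v b B. v \<in> vecs k \<Longrightarrow> represents k N (Proj {..k}) \<iota> v b B \<Longrightarrow>
       \<exists>P Q. metric_quotient_at k (q - 1) \<Phi> v P Q {0} (\<lambda>i w. 1) {..N} B"
    by (rule polarization_quotient[OF pol]) (rule that, assumption+, use id in blast)
  have \<iota>m: "morphism {..k} {..N} (Proj {..k}) \<iota>" using \<iota> by (simp add: closed_immersion_def)
  have rep\<iota>: "\<exists>b B. represents k N (Proj {..k}) \<iota> v b B" if "v \<in> vecs k" for v
    using morphism_represents[OF \<iota>m pt_in_Proj[OF that]] by metis
  have "\<exists>P Q I A J B. metric_quotient_at k (q - 1) \<Phi> v P Q I A J B" if v: "v \<in> vecs k" for v
  proof -
    obtain b B where "represents k N (Proj {..k}) \<iota> v b B" using rep\<iota>[OF v] by blast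
    then show ?thesis using m[OF v] by blast
  qed
  then obtain v0 where v0: "v0 \<in> vecs k" "\<And>v. v \<in> vecs k \<Longrightarrow> \<Phi> (pt v0) \<le> \<Phi> (pt v)"
    using metric_quotient_minimum by blast
  obtain b B where B: "represents k N (Proj {..k}) \<iota> v0 b B" using rep\<iota>[OF v0(1)] by blast
  obtain P Q where PQ: "metric_quotient_at k (q - 1) \<Phi> v0 P Q {0} (\<lambda>i w. 1) {..N} B"
    using m[OF v0(1) B] by blast
  have hB: "homog k b (B j)" for j using B by (simp add: represents_def)
  have "\<forall>j. \<exists>H. gradient k (B j) H" using hB homog_gradient by metis
  then obtain H where H: "\<And>j. gradient k (B j) (H j)" by metis
  obtain w c where w: "w \<in> vecs k" "(\<Sum>j\<le>k. cnj (v0 j) * w j) = 0"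
    using tangent_system[of "{0}" k "\<lambda>i. 1" v0 "\<lambda>i j. 0"] \<open>k \<ge> 1\<close> v0(1) by auto
  show False
  proof (rule metric_quotient_no_minimum[OF PQ _ v0])
    show "\<forall>i. i \<notin> {..k} \<longrightarrow> w i = 0" using w(1) by (auto simp: vecs_def)
    show "((\<lambda>t. 1) has_field_derivative 0 * 1) (at (0::complex))" by simp
    show "((\<lambda>t. B j (\<lambda>l. v0 l + t * w l)) has_field_derivative (\<Sum>i\<le>k. H j i v0 * w i)) (at 0)" for j
      by (rule gradient_line[OF H])
    then show "\<exists>j\<in>{..N}. (\<Sum>i\<le>k. H j i v0 * w i) \<noteq> \<mu> * B j v0" for \<mu>
      by (rule immersion_not_degenerate[OF \<iota> v0(1) B w])
  qed (use q in simp)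
qed

text \<open>At the minimum of the metric quotient the map cannot degenerate, whereas maps into a hypersurface
  degenerate everywhere.\<close>

lemma polarizable_image_not_in_hypersurface:
  assumes pol: "polarizable {..k} (Proj {..k}) \<psi>" and r: "homog k b r" "r \<noteq> (\<lambda>v. 0)"
  shows "\<exists>x\<in>Proj {..k}. r (rep (\<psi> x)) \<noteq> 0"
proof (rule ccontr)
  assume "\<not> ?thesis"
  then have r0: "r (rep (\<psi> x)) = 0" if "x \<in> Proj {..k}" for x using that by blast
  have \<psi>: "morphism {..k} {..k} (Proj {..k}) \<psi>" using pol by (simp add: polarizable_def)
  obtain N \<iota> q \<Phi> where \<iota>: "closed_immersion {..k} {..N} (Proj {..k}) \<iota>" and q: "q > 1"
    and m: "\<And>v e \<Psi> b B c C. v \<in> vecs k \<Longrightarrow> represents k k (Proj {..k}) \<psi> v e \<Psi> \<Longrightarrow>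
       represents k N (Proj {..k}) \<iota> (\<lambda>j. \<Psi> j v) c C \<Longrightarrow> represents k N (Proj {..k}) \<iota> v b B \<Longrightarrow>
       \<exists>P Q. metric_quotient_at k q \<Phi> v P Q {..N} (\<lambda>i w. C i (\<lambda>j. \<Psi> j w)) {..N} B"
    by (rule polarization_quotient[OF pol]) (rule that, assumption+)
  have \<iota>m: "morphism {..k} {..N} (Proj {..k}) \<iota>" using \<iota> by (simp add: closed_immersion_def)
  have rep\<iota>: "\<exists>b B. represents k N (Proj {..k}) \<iota> v b B" if "v \<in> vecs k" for v
    using morphism_represents[OF \<iota>m pt_in_Proj[OF that]] by metis
  have rep\<psi>: "\<exists>e \<Psi>. represents k k (Proj {..k}) \<psi> v e \<Psi>" if "v \<in> vecs k" for v
    using morphism_represents[OF \<psi> pt_in_Proj[OF that]] by metis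
  have \<Psi>vecs: "(\<lambda>j. \<Psi> j v) \<in> vecs k" if "v \<in> vecs k" "represents k k (Proj {..k}) \<psi> v e \<Psi>" for v e \<Psi>
    using near_self[OF represents_near[OF that(2)] that(1)] by blast
  have "\<exists>P Q I A J B. metric_quotient_at k q \<Phi> v P Q I A J B" if v: "v \<in> vecs k" for v
  proof -
    obtain e \<Psi> where \<Psi>: "represents k k (Proj {..k}) \<psi> v e \<Psi>" using rep\<psi>[OF v] by blast
    obtain c C where C: "represents k N (Proj {..k}) \<iota> (\<lambda>j. \<Psi> j v) c C" using rep\<iota>[OF \<Psi>vecs[OF v \<Psi>]] by blast
    obtain b B where B: "represents k N (Proj {..k}) \<iota> v b B" using rep\<iota>[OF v] by blast
    show ?thesis using m[OF v \<Psi> C B] by blast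
  qed
  then obtain v0 where v0: "v0 \<in> vecs k" "\<And>v. v \<in> vecs k \<Longrightarrow> \<Phi> (pt v0) \<le> \<Phi> (pt v)"
    using metric_quotient_minimum by blast
  obtain e \<Psi> where \<Psi>: "represents k k (Proj {..k}) \<psi> v0 e \<Psi>" using rep\<psi>[OF v0(1)] by blast
  obtain c C where C: "represents k N (Proj {..k}) \<iota> (\<lambda>j. \<Psi> j v0) c C" using rep\<iota>[OF \<Psi>vecs[OF v0(1) \<Psi>]] by blast
  obtain b' B where B: "represents k N (Proj {..k}) \<iota> v0 b' B" using rep\<iota>[OF v0(1)] by blast
  obtain P Q where PQ: "metric_quotient_at k q \<Phi> v0 P Q {..N} (\<lambda>i w. C i (\<lambda>j. \<Psi> j w)) {..N} B"
    using m[OF v0(1) \<Psi> C B] by blast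
  have h\<Psi>: "homog k e (\<Psi> j)" and hC: "homog k c (C j)" and hB: "homog k b' (B j)" for j
    using \<Psi> C B by (simp_all add: represents_def)
  have "\<forall>j. \<exists>H. gradient k (\<Psi> j) H \<and> (\<forall>i. homog k (e - 1) (H i))" using homog_gradient[OF h\<Psi>] by metis
  then obtain H where H: "\<And>j. gradient k (\<Psi> j) (H j)" "\<And>j i. homog k (e - 1) (H j i)" by metis
  have "\<forall>j. \<exists>H. gradient k (B j) H" using hB homog_gradient by metis
  then obtain HB where HB: "\<And>j. gradient k (B j) (HB j)" by metis
  have "\<forall>j. \<exists>H. gradient k (C j) H" using hC homog_gradient by metis
  then obtain HC where HC: "\<And>j. gradient k (C j) (HC j)" by metis
  note nP = represents_near[OF \<Psi>]
  have "near k v0 (\<lambda>v. r (\<lambda>j. \<Psi> j v) = 0)"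
    using nP
  proof (rule near_mono)
    fix v assume v: "v \<in> vecs k" "(\<lambda>j. \<Psi> j v) \<in> vecs k \<and> \<psi> (pt v) = pt (\<lambda>j. \<Psi> j v)"
    then have "r (rep (pt (\<lambda>j. \<Psi> j v))) = 0" using r0[OF pt_in_Proj[OF v(1)]] by simp
    then show "r (\<lambda>j. \<Psi> j v) = 0" using homog_rep_eq_0[OF r(1)] by simp
  qed
  then have "(\<lambda>v. r (\<lambda>j. \<Psi> j v)) = (\<lambda>v. 0)"
    by (rule near_zero[rotated]) (rule homog_comp[OF r(1) h\<Psi>])
  then have r\<Psi>: "r (\<lambda>j. \<Psi> j v) = 0" for v by metis
  have "near k v0 (\<lambda>v. (\<lambda>j. \<Psi> j v) \<in> vecs k)" using nP by (rule near_mono) simp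
  from degenerate_direction[OF h\<Psi> r r\<Psi> H v0(1) this]
  obtain w l where w: "w \<in> vecs k" "(\<Sum>j\<le>k. cnj (v0 j) * w j) = 0"
    "\<And>j. j \<le> k \<Longrightarrow> (\<Sum>i\<le>k. H j i v0 * w i) = l * \<Psi> j v0" by metis
  show False
  proof (rule metric_quotient_no_minimum[OF PQ _ v0])
    show "\<forall>i. i \<notin> {..k} \<longrightarrow> w i = 0" using w(1) by (auto simp: vecs_def)
    show "((\<lambda>t. C i (\<lambda>j. \<Psi> j (\<lambda>l. v0 l + t * w l))) has_field_derivative (l * of_nat c) * C i (\<lambda>j. \<Psi> j v0)) (at 0)" for i
    proof -
      have "((\<lambda>t. C i (\<lambda>j. \<Psi> j (\<lambda>l. v0 l + t * w l))) has_field_derivative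
          (\<Sum>j\<le>k. HC i j (\<lambda>j. \<Psi> j (\<lambda>l. v0 l + 0 * w l)) * (\<Sum>i\<le>k. H j i v0 * w i))) (at 0)"
        by (rule gradientD[OF HC]) (rule gradient_line[OF H(1)])
      moreover have "(\<Sum>j\<le>k. HC i j (\<lambda>j. \<Psi> j (\<lambda>l. v0 l + 0 * w l)) * (\<Sum>i\<le>k. H j i v0 * w i))
          = (\<Sum>j\<le>k. HC i j (\<lambda>j. \<Psi> j v0) * (l * \<Psi> j v0))"
        by (rule sum.cong) (simp_all add: w(3))
      moreover have "\<dots> = l * (\<Sum>j\<le>k. HC i j (\<lambda>j. \<Psi> j v0) * \<Psi> j v0)"
        by (simp only: sum_distrib_left mult.left_commute)
      ultimately show ?thesis using euler[OF hC HC, of i "\<lambda>j. \<Psi> j v0"] by (simp add: mult.assoc)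
    qed
    show "((\<lambda>t. B j (\<lambda>l. v0 l + t * w l)) has_field_derivative (\<Sum>i\<le>k. HB j i v0 * w i)) (at 0)" for j
      by (rule gradient_line[OF HB])
    then show "\<exists>j\<in>{..N}. (\<Sum>i\<le>k. HB j i v0 * w i) \<noteq> \<mu> * B j v0" for \<mu>
      by (rule immersion_not_degenerate[OF \<iota> v0(1) B w(1,2)])
  qed (use q in simp)
qed

lemma polarizable_dominant:
  assumes "polarizable {..k} (Proj {..k}) \<psi>"
  shows "dominant k (total_map k \<psi>)"
proof -
  have "x \<in> zariski {..k} closure_of (\<psi> ` Proj {..k})" if x: "x \<in> Proj {..k}" for x
    unfolding in_closure_of
  proof (intro conjI allI impI)
    show "x \<in> topspace (zariski {..k})" using x by (simp add: topspace_zariski)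
    fix T assume T: "x \<in> T \<and> openin (zariski {..k}) T"
    obtain v where v: "v \<in> vecs k" "x = pt v" using x by (auto simp: Proj_eq_image)
    obtain b r where r: "homog k b r" "r v \<noteq> 0" "\<forall>v\<in>vecs k. r v \<noteq> 0 \<longrightarrow> pt v \<in> T"
      using openin_zariski_near[of k T v] T v(2) unfolding near_def by blast
    have "r \<noteq> (\<lambda>v. 0)" using r(2) by auto
    then obtain y where y: "y \<in> Proj {..k}" "r (rep (\<psi> y)) \<noteq> 0"
      using polarizable_image_not_in_hypersurface[OF assms r(1)] by blast
    then have "\<psi> y \<in> Proj {..k}" using assms by (auto simp: polarizable_def)
    then have "\<psi> y \<in> T" using r(3) y(2) rep_in_vecs by metis
    then show "\<exists>y. y \<in> \<psi> ` Proj {..k} \<and> y \<in> T" using y(1) by blast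
  qed
  moreover have "zariski {..k} closure_of (\<psi> ` Proj {..k}) \<subseteq> Proj {..k}"
    using closure_of_subset_topspace[of "zariski {..k}"] by (simp add: topspace_zariski)
  ultimately show ?thesis by (auto simp: dominant_def total_map_def)
qed

text \<open>Agreement in projective space means vanishing of the two-by-two minors of the coordinates, which are
  forms; so it extends from an open set to its closure.\<close>

lemma (in form_endo) morphism_eq_iterate:
  assumes \<psi>: "morphism {..k} {..k} (Proj {..k}) \<psi>"
    and W: "openin (zariski {..k}) W" "W \<noteq> {}" "\<And>x. x \<in> W \<Longrightarrow> \<psi> x = (g ^^ s) x"
    and x: "x \<in> Proj {..k}"
  shows "\<psi> x = (g ^^ s) x"
proof -
  obtain v where v: "v \<in> vecs k" "x = pt v" using x by (auto simp: Proj_eq_image)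
  obtain e \<Psi> where \<Psi>: "represents k k (Proj {..k}) \<psi> v e \<Psi>"
    using morphism_represents[OF \<psi>] x v(2) by blast
  note nP = represents_near[OF \<Psi>]
  obtain b p where p: "homog k b p" "p v \<noteq> 0"
      "\<forall>w\<in>vecs k. p w \<noteq> 0 \<longrightarrow> (\<lambda>j. \<Psi> j w) \<in> vecs k \<and> \<psi> (pt w) = pt (\<lambda>j. \<Psi> j w)"
    using nP unfolding near_def by blast
  obtain y where y: "y \<in> W" using W(2) by blast
  then have "y \<in> Proj {..k}" using openin_subset[OF W(1)] by (auto simp: topspace_zariski)
  then obtain z where z: "z \<in> vecs k" "pt z \<in> W" using y by (auto simp: Proj_eq_image)
  have hPsi: "homog k e (\<Psi> j)" for j using \<Psi> by (simp add: represents_def)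
  let ?F = "\<lambda>j v. (lift ^^ s) v j"
  have cross: "\<Psi> i v * ?F j v = \<Psi> j v * ?F i v" if ij: "i \<le> k" "j \<le> k" for i j
  proof -
    let ?f = "\<lambda>w. \<Psi> i w * ?F j w - \<Psi> j w * ?F i w"
    have hf: "homog k (e + d ^ s) ?f"
      using ij by (intro homog_diff homog_mult hPsi lift_funpow_homog)
    have "near k z (\<lambda>w. p w * ?f w = 0)"
      using openin_zariski_near[OF W(1) z(2)]
    proof (rule near_mono)
      fix w assume w: "w \<in> vecs k" "pt w \<in> W"
      show "p w * ?f w = 0"
      proof (cases "p w = 0")
        case False
        then have "pt (\<lambda>j. \<Psi> j w) = pt ((lift ^^ s) w)"
          using p(3) w W(3)[OF w(2)] g_funpow_pt by metis
        then obtain c where "(\<lambda>j. \<Psi> j w) = (\<lambda>j. c * ?F j w)" using pt_eq_imp by blast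
        then have "\<Psi> j w = c * ?F j w" for j by metis
        then show ?thesis by simp
      qed simp
    qed
    then have "(\<lambda>w. p w * ?f w) = (\<lambda>w. 0)"
      by (rule near_zero[OF homog_mult[OF p(1) hf]])
    then have "p v * ?f v = 0" by metis
    then show ?thesis using p(2) by simp
  qed
  have vv: "(\<lambda>j. \<Psi> j v) \<in> vecs k" "\<psi> x = pt (\<lambda>j. \<Psi> j v)" "(lift ^^ s) v \<in> vecs k" "(g ^^ s) x = pt ((lift ^^ s) v)"
    using near_self[OF nP v(1)] v lift_funpow_vecs g_funpow_pt by auto
  obtain i where i: "i \<le> k" "?F i v \<noteq> 0" using vv(3) by (auto simp: vecs_def)
  have *: "\<Psi> j v = (\<Psi> i v / ?F i v) * ?F j v" for j
  proof (cases "j \<le> k")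
    case True
    then show ?thesis using cross[OF i(1) True] i(2) by (simp add: field_simps)
  next
    case False
    then show ?thesis using vv(1,3) by (simp add: vecs_def)
  qed
  then have "\<Psi> i v / ?F i v \<noteq> 0" using vv(1) unfolding vecs_def by force
  then have "pt (\<lambda>j. (\<Psi> i v / ?F i v) * ?F j v) = pt ((lift ^^ s) v)"
    by (rule pt_scale)
  moreover have "(\<lambda>j. \<Psi> j v) = (\<lambda>j. (\<Psi> i v / ?F i v) * ?F j v)" using * by (rule ext)
  ultimately show ?thesis using vv(2,4) by simp
qed

theorem corollary1p2:
  fixes k d :: nat and U :: "endo set" and f :: endo and X :: "nat point set"
  assumes "k \<ge> 2" and "d \<ge> 2"
    and U_open: "openin (subtopology (zariski (coeff_index k d)) (End k d)) U"
    and U_dense: "subtopology (zariski (coeff_index k d)) (End k d) closure_of U = End k d"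
    and U_rational: "open_over_rat k d U"
    and U_rigid: "\<And>g h m. \<lbrakk>g \<in> U; rational_map k h; dominant k h; m \<ge> 1;
        rat_eq k (rat_comp h (total_map k (endo_map k d g ^^ m)))
                 (rat_comp (total_map k (endo_map k d g ^^ m)) h)\<rbrakk>
      \<Longrightarrow> \<exists>s. rat_eq k h (total_map k (endo_map k d g ^^ s))"
    and "f \<in> U"
    and "irreducible_hypersurface k X"
  shows "special k (endo_map k d f) X \<longleftrightarrow> preperiodic (endo_map k d f) X"
proof -
  have "f \<in> End k d" using openin_imp_subset[OF U_open] \<open>f \<in> U\<close> by blast
  then interpret form_endo k d "endo_form k d f" by (rule End_form_endo)
  have g: "endo_map k d f = g" by (simp add: endo_map_def)
  have XP: "X \<subseteq> Proj {..k}" using \<open>irreducible_hypersurface k X\<close> by (auto simp: irreducible_hypersurface_def)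
  show ?thesis
    unfolding g
  proof
    assume X: "preperiodic g X"
    have "(g ^^ 1) ` Proj {..k} = Proj {..k}" using g_surj \<open>d \<ge> 2\<close> by simp
    moreover have "polarizable {..k} (Proj {..k}) g" using g_polarizable \<open>d \<ge> 2\<close> by simp
    ultimately show "special k g X"
      unfolding special_def using X XP irreducible_Proj
      by (intro exI[of _ "Proj {..k}"] exI[of _ 1] exI[of _ g]) auto
  next
    assume "special k g X"
    then obtain Z n \<psi> where Z: "irreducible_variety {..k} Z" "X \<subseteq> Z" "n \<ge> 1"
        "polarizable {..k} Z \<psi>" "(g ^^ n) ` Z = Z" "\<forall>x\<in>Z. (g ^^ n) (\<psi> x) = \<psi> ((g ^^ n) x)"
        "preperiodic \<psi> X"
      unfolding special_def by blast
    consider "Z = X" | "Z = Proj {..k}"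
      using hypersurface_maximal[OF _ \<open>irreducible_hypersurface k X\<close> Z(1,2)] \<open>k \<ge> 2\<close> by auto
    then show "preperiodic g X"
    proof cases
      case 1
      then have "(g ^^ n) ` X = (g ^^ 0) ` X" using Z(5) by simp
      then show ?thesis unfolding preperiodic_def using Z(3) by (intro exI[of _ n] exI[of _ 0]) simp
    next
      case 2
      note pol = Z(4)[unfolded 2]
      have \<psi>m: "morphism {..k} {..k} (Proj {..k}) \<psi>" and \<psi>P: "\<And>x. x \<in> Proj {..k} \<Longrightarrow> \<psi> x \<in> Proj {..k}"
        using pol by (auto simp: polarizable_def)
      have ne: "Proj {..k} \<noteq> {}" using pt_in_Proj[OF vecs_nonempty] by blast
      then have "rational_map k (total_map k \<psi>)"
        using \<psi>m openin_Proj by (auto simp: rational_map_def total_map_def)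
      moreover have "rat_eq k (rat_comp (total_map k \<psi>) (total_map k (endo_map k d f ^^ n)))
          (rat_comp (total_map k (endo_map k d f ^^ n)) (total_map k \<psi>))"
        unfolding rat_eq_def g
        using openin_Proj ne g_funpow_Proj \<psi>P Z(6) 2
        by (intro exI[of _ "Proj {..k}"]) (auto simp: rat_comp_def total_map_def)
      ultimately obtain s where "rat_eq k (total_map k \<psi>) (total_map k (endo_map k d f ^^ s))"
        using U_rigid[OF \<open>f \<in> U\<close> _ polarizable_dominant[OF pol] Z(3)] by blast
      then obtain W where W: "openin (zariski {..k}) W" "W \<noteq> {}" "\<forall>x\<in>W. \<psi> x = (g ^^ s) x"
        unfolding rat_eq_def g total_map_def by auto
      have \<psi>g: "\<psi> x = (g ^^ s) x" if "x \<in> Proj {..k}" for x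
        by (rule morphism_eq_iterate[OF \<psi>m W(1,2) _ that]) (use W(3) in blast)
      have s: "s \<noteq> 0"
        using polarizable_not_identity[OF _ pol] \<psi>g \<open>k \<ge> 2\<close> by auto
      have it: "(\<psi> ^^ a) x = (g ^^ (s * a)) x" if "x \<in> Proj {..k}" for a x
      proof (induction a)
        case (Suc a)
        have "(\<psi> ^^ Suc a) x = (g ^^ s) ((g ^^ (s * a)) x)"
          using Suc \<psi>g[OF g_funpow_Proj[OF that]] by simp
        then show ?case by (simp add: funpow_add)
      qed simp
      then have im: "(\<psi> ^^ a) ` X = (g ^^ (s * a)) ` X" for a
        using XP by (intro image_cong) auto
      obtain a b where ab: "a > b" "(\<psi> ^^ a) ` X = (\<psi> ^^ b) ` X"
        using Z(7) unfolding preperiodic_def by blast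
      then have "s * a > s * b" "(g ^^ (s * a)) ` X = (g ^^ (s * b)) ` X"
        using s im by simp_all
      then show ?thesis unfolding preperiodic_def by blast
    qed
  qed
qed

end
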